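(* Let $n=2$ and let $u^i_t=(V^i(\mathbf u))_x$, $i=1,2$, be a strictly hyperbolic system of conservation laws which is Hamiltonian with respect to a non-degenerate third-order Hamiltonian operator $P^{ij}=\partial_x(g^{ij}\partial_x+c^{ij}_ku^k_x)\partial_x$. Then the system is linearisable: it is equivalent (modulo reciprocal transformations and affine transformations of the dependent variables, i.e. modulo projective equivalence of associated congruences) to a linear system $u^i_t=(a^i_ju^j)_x$, $i=1,2$, with constant coefficients $a^i_j$, which possesses the third-order Hamiltonian formulation $u^i_t=\eta^{ij}\partial_x^3\frac{\delta H}{\delta u^j}$ for a constant non-degenerate symmetric matrix $\eta^{ij}$.
   Context: Summation over repeated indices is understood; a comma in a lower index denotes a partial derivative. Strict hyperbolicity: the eigenvalues of $(\partial V^i/\partial u^j)$ are real and distinct. Third-order Hamiltonian operator: $g^{ij}(\mathbf u)$ is symmetric with $\det g^{ij}\neq0$, $g_{ij}$ is its inverse, $c_{ijk}=g_{iq}g_{jp}c^{pq}_k$; $P$ is Hamiltonian (defines a skew-symmetric bracket $\{F,G\}=\int\frac{\delta F}{\delta u^i}P^{ij}\frac{\delta G}{\delta u^j}dx$ satisfying the Jacobi identity), which is known to be equivalent to $$g_{mp,k}=-c_{mpk}-c_{pmk},\quad c_{mpk}=-c_{mkp},\quad c_{mpk}+c_{pkm}+c_{kmp}=0,\quad c_{mpk,l}=-g^{sq}c_{sml}c_{qpk}.$$ A system is Hamiltonian with respect to $P$ if $\mathbf u_t=(V(\mathbf u))_x=P\,\delta H/\delta\mathbf u$ for some functional $H=\int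 h\,dx$, possibly nonlocal: $h$ may depend on $x$, the potentials $b^i$ with $b^i_x=u^i$, and finitely many $x$-derivatives of $b^i$. For the linear system, $H=-\frac12\int\eta_{jp}a^p_kb^jb^k\,dx$, where $\eta_{ij}$ is the inverse of $\eta^{ij}$, and the Hamiltonian property means $\eta_{jp}a^p_k=\eta_{kp}a^p_j$. Equivalence: with an $n$-component system $u^i_t=(V^i(\mathbf u))_x$ one associates the $n$-parameter family (congruence) of lines $y^i=u^iy^{n+1}+V^i(\mathbf u)y^{n+2}$, $i=1,\dots,n$, in $\mathbb P^{n+1}$ with homogeneous coordinates $(y^1:\dots:y^{n+2})$. Reciprocal transformations $$d\tilde x=(a_iu^i+a)dx+(a_iV^i+b)dt,\qquad d\tilde t=(b_iu^i+c)dx+(b_iV^i+d)dt$$ ($a_i,b_i,a,b,c,d$ constants; the new densities and fluxes are defined by $u^idx+V^idt=\tilde u^id\tilde x+\tilde V^id\tilde t$), together with affine transformations of the dependent variables $u^i$, generate the group $SL(n+2)$ acting by projective transformations on the congruence. Two systems are called equivalent if they are related (locally) by such transformations, equivalently if their congruences are (locally) projectively equivalent. *)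

theory Defs
  imports "HOL-Analysis.Analysis"
begin

section \<open>Smooth maps\<close>

fun Ck_on :: "nat \<Rightarrow> 'a::euclidean_space set \<Rightarrow> ('a \<Rightarrow> 'b::real_normed_vector) \<Rightarrow> bool" where
  "Ck_on 0 S f \<longleftrightarrow> continuous_on S f"
| "Ck_on (Suc k) S f \<longleftrightarrow> (\<forall>x\<in>S. f differentiable (at x)) \<and>
     (\<forall>e\<in>Basis. Ck_on k S (\<lambda>x. frechet_derivative f (at x) e))"

text \<open>Meant for open \<open>S\<close>, where derivatives are unrestricted.\<close>

definition smooth_on :: "'a::euclidean_space set \<Rightarrow> ('a \<Rightarrow> 'b::real_normed_vector) \<Rightarrow> bool" where
  "smooth_on S f \<longleftrightarrow> (\<forall>k. Ck_on k S f)"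

definition diffeo_between ::
  "'a::euclidean_space set \<Rightarrow> 'a set \<Rightarrow> ('a \<Rightarrow> 'a) \<Rightarrow> bool" where
  "diffeo_between N M \<phi> \<longleftrightarrow> open N \<and> open M \<and>
     (\<exists>\<psi>. homeomorphism N M \<phi> \<psi> \<and> smooth_on N \<phi> \<and> smooth_on M \<psi>)"


section \<open>Differential functions on the jet space\<close>

text \<open>A point \<open>(x, w)\<close> consists of the independent variable \<open>x\<close> and the values \<open>w k\<close> of the
  \<open>k\<close>-th \<open>x\<close>-derivatives of \<open>n\<close> dependent variables, \<open>n = CARD('n)\<close>. The jet space carries the
  product topology; on functions of finite order, continuity is then the usual continuity in
  finitely many variables.\<close>

type_synonym 'n jet = "real \<times> (nat \<Rightarrow> real ^ 'n)"

definition jet_dx :: "('n::finite jet \<Rightarrow> real) \<Rightarrow> 'n jet \<Rightarrow> real" where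
  "jet_dx f p = deriv (\<lambda>s. f (fst p + s, snd p)) 0"

definition jet_du :: "nat \<Rightarrow> 'n::finite \<Rightarrow> ('n jet \<Rightarrow> real) \<Rightarrow> 'n jet \<Rightarrow> real" where
  "jet_du k i f p = deriv (\<lambda>s. f (fst p, (snd p)(k := snd p k + s *\<^sub>R axis i 1))) 0"

fun jet_Ck_on :: "nat \<Rightarrow> 'n::finite jet set \<Rightarrow> ('n jet \<Rightarrow> real) \<Rightarrow> bool" where
  "jet_Ck_on 0 W f \<longleftrightarrow> continuous_on W f"
| "jet_Ck_on (Suc m) W f \<longleftrightarrow> continuous_on W f \<and>
     (\<forall>p\<in>W. (\<lambda>s. f (fst p + s, snd p)) differentiable (at 0)) \<and>
     jet_Ck_on m W (jet_dx f) \<and>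
     (\<forall>k i. (\<forall>p\<in>W. (\<lambda>s. f (fst p, (snd p)(k := snd p k + s *\<^sub>R axis i 1)))
                        differentiable (at 0)) \<and>
            jet_Ck_on m W (jet_du k i f))"

text \<open>Smooth functions of \<open>x\<close>, the dependent variables and finitely many of their derivatives.\<close>

definition differential_function :: "'n::finite jet set \<Rightarrow> ('n jet \<Rightarrow> real) \<Rightarrow> bool" where
  "differential_function W f \<longleftrightarrow> (\<forall>m. jet_Ck_on m W f) \<and>
     (\<exists>N. \<forall>p\<in>W. \<forall>q\<in>W. fst p = fst q \<longrightarrow> (\<forall>k\<le>N. snd p k = snd q k) \<longrightarrow> f p = f q)"

text \<open>Total derivative and Euler operator \<open>E\<^sub>i(f) = \<Sum>\<^sub>k (- D)\<^sup>k (\<partial>f / \<partial>w\<^sup>i\<^sub>k)\<close>. For a differential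
  function only finitely many terms of each series are nonzero.\<close>

definition total_deriv :: "('n::finite jet \<Rightarrow> real) \<Rightarrow> 'n jet \<Rightarrow> real" where
  "total_deriv f p = jet_dx f p + (\<Sum>k. \<Sum>i\<in>UNIV. snd p (Suc k) $ i * jet_du k i f p)"

definition euler :: "'n::finite \<Rightarrow> ('n jet \<Rightarrow> real) \<Rightarrow> 'n jet \<Rightarrow> real" where
  "euler i f p = (\<Sum>k. (-1) ^ k * (total_deriv ^^ k) (jet_du k i f) p)"


section \<open>Third-order operators and their Hamiltonian property\<close>

text \<open>The coefficients are \<open>g u $ i $ j = g\<^sup>i\<^sup>j(u)\<close> and \<open>c u $ i $ j $ k = c\<^sup>i\<^sup>j\<^sub>k(u)\<close>, both as in the
  operator itself (upper indices). \<open>inner_op r g c\<close> is \<open>g\<^sup>i\<^sup>j D + c\<^sup>i\<^sup>j\<^sub>k u\<^sup>k\<^sub>x\<close> applied to \<open>\<psi>\<^sub>j\<close>, where \<open>u\<close>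
  is the \<open>r\<close>-th derivative of the dependent variables: \<open>r = 0\<close> when these are the \<open>u\<^sup>i\<close>, and
  \<open>r = 1\<close> when these are the potentials \<open>b\<^sup>i\<close> with \<open>b\<^sup>i\<^sub>x = u\<^sup>i\<close>.\<close>

definition inner_op :: "nat \<Rightarrow> (real ^ 'n::finite \<Rightarrow> real ^ 'n ^ 'n) \<Rightarrow>
    (real ^ 'n \<Rightarrow> real ^ 'n ^ 'n ^ 'n) \<Rightarrow> ('n \<Rightarrow> 'n jet \<Rightarrow> real) \<Rightarrow> 'n \<Rightarrow> 'n jet \<Rightarrow> real" where
  "inner_op r g c \<psi> i p =
     (\<Sum>j\<in>UNIV. g (snd p r) $ i $ j * total_deriv (\<psi> j) p
        + (\<Sum>k\<in>UNIV. c (snd p r) $ i $ j $ k * snd p (Suc r) $ k) * \<psi> j p)"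

definition third_order_op :: "(real ^ 'n::finite \<Rightarrow> real ^ 'n ^ 'n) \<Rightarrow>
    (real ^ 'n \<Rightarrow> real ^ 'n ^ 'n ^ 'n) \<Rightarrow> ('n \<Rightarrow> 'n jet \<Rightarrow> real) \<Rightarrow> 'n \<Rightarrow> 'n jet \<Rightarrow> real" where
  "third_order_op g c \<psi> i = total_deriv (inner_op 0 g c (\<lambda>j. total_deriv (\<psi> j)) i)"

text \<open>Density of the bracket of the functionals with densities \<open>f\<^sub>1\<close> and \<open>f\<^sub>2\<close>.\<close>

definition bracket :: "(real ^ 'n::finite \<Rightarrow> real ^ 'n ^ 'n) \<Rightarrow>
    (real ^ 'n \<Rightarrow> real ^ 'n ^ 'n ^ 'n) \<Rightarrow> ('n jet \<Rightarrow> real) \<Rightarrow> ('n jet \<Rightarrow> real) \<Rightarrow> 'n jet \<Rightarrow> real" where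
  "bracket g c f1 f2 p =
     (\<Sum>i\<in>UNIV. euler i f1 p * third_order_op g c (\<lambda>j. euler j f2) i p)"

text \<open>Functionals are integrals over a period of local densities which are 1-periodic in \<open>x\<close>,
  evaluated on smooth 1-periodic fields with values in \<open>U\<close>.\<close>

definition local_density :: "(real ^ 'n::finite) set \<Rightarrow> ('n jet \<Rightarrow> real) \<Rightarrow> bool" where
  "local_density U f \<longleftrightarrow> differential_function {p. snd p 0 \<in> U} f \<and>
     (\<forall>x w. w 0 \<in> U \<longrightarrow> f (x + 1, w) = f (x, w))"

definition periodic_field :: "(real ^ 'n::finite) set \<Rightarrow> (real \<Rightarrow> real ^ 'n) \<Rightarrow> bool" where
  "periodic_field U u \<longleftrightarrow> smooth_on UNIV u \<and> (\<forall>x. u (x + 1) = u x \<and> u x \<in> U)"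

definition jet_at :: "(real \<Rightarrow> real ^ 'n::finite) \<Rightarrow> real \<Rightarrow> 'n jet" where
  "jet_at u x = (x, \<lambda>k. ((\<lambda>v y. vector_derivative v (at y)) ^^ k) u x)"

definition functional :: "('n::finite jet \<Rightarrow> real) \<Rightarrow> (real \<Rightarrow> real ^ 'n) \<Rightarrow> real" where
  "functional f u = integral {0..1} (\<lambda>x. f (jet_at u x))"

definition hamiltonian_operator :: "(real ^ 'n::finite) set \<Rightarrow> (real ^ 'n \<Rightarrow> real ^ 'n ^ 'n) \<Rightarrow>
    (real ^ 'n \<Rightarrow> real ^ 'n ^ 'n ^ 'n) \<Rightarrow> bool" where
  "hamiltonian_operator U g c \<longleftrightarrow>
     (\<forall>f1 f2 u. local_density U f1 \<and> local_density U f2 \<and> periodic_field U u \<longrightarrow>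
        functional (bracket g c f1 f2) u = - functional (bracket g c f2 f1) u) \<and>
     (\<forall>f1 f2 f3 u. local_density U f1 \<and> local_density U f2 \<and> local_density U f3 \<and>
        periodic_field U u \<longrightarrow>
        functional (bracket g c (bracket g c f1 f2) f3) u
        + functional (bracket g c (bracket g c f2 f3) f1) u
        + functional (bracket g c (bracket g c f3 f1) f2) u = 0)"

definition nondegenerate_metric :: "(real ^ 'n::finite) set \<Rightarrow> (real ^ 'n \<Rightarrow> real ^ 'n ^ 'n) \<Rightarrow> bool" where
  "nondegenerate_metric U g \<longleftrightarrow> (\<forall>u\<in>U. transpose (g u) = g u \<and> det (g u) \<noteq> 0)"


section \<open>Systems of conservation laws \<open>u\<^sup>i\<^sub>t = (V\<^sup>i(u))\<^sub>x\<close>\<close>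

text \<open>\<open>CARD('n)\<close> many real eigenvalues of the Jacobian: all are real and they are distinct.\<close>

definition strictly_hyperbolic_on :: "(real ^ 'n::finite) set \<Rightarrow> (real ^ 'n \<Rightarrow> real ^ 'n) \<Rightarrow> bool" where
  "strictly_hyperbolic_on U V \<longleftrightarrow>
     (\<forall>u\<in>U. card {l::real. \<exists>v. v \<noteq> 0 \<and> matrix (frechet_derivative V (at u)) *v v = l *\<^sub>R v}
        = CARD('n))"

text \<open>The density \<open>h\<close> lives on (an open part \<open>W\<close>, over every point of \<open>U\<close>, of) the jet space of the
  potentials \<open>b\<close>, whose first derivatives are the \<open>u\<^sup>i\<close>. As \<open>u\<^sup>i = b\<^sup>i\<^sub>x\<close>, one has
  \<open>D (\<delta>H / \<delta>u\<^sup>j) = - \<delta>H / \<delta>b\<^sup>j\<close>, so that \<open>P \<delta>H/\<delta>u = D (g\<^sup>i\<^sup>j D + c\<^sup>i\<^sup>j\<^sub>k u\<^sup>k\<^sub>x) D \<delta>H/\<delta>u\<close> equals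
  \<open>- D (g\<^sup>i\<^sup>j D + c\<^sup>i\<^sup>j\<^sub>k u\<^sup>k\<^sub>x) \<delta>H/\<delta>b\<close>, also for nonlocal \<open>H\<close>.\<close>

definition hamiltonian_with :: "(real ^ 'n::finite) set \<Rightarrow> (real ^ 'n \<Rightarrow> real ^ 'n ^ 'n) \<Rightarrow>
    (real ^ 'n \<Rightarrow> real ^ 'n ^ 'n ^ 'n) \<Rightarrow> (real ^ 'n \<Rightarrow> real ^ 'n) \<Rightarrow>
    'n jet set \<Rightarrow> ('n jet \<Rightarrow> real) \<Rightarrow> bool" where
  "hamiltonian_with U g c V W h \<longleftrightarrow>
     open W \<and> (\<lambda>p. snd p 1) ` W = U \<and> differential_function W h \<and>
     (\<forall>p\<in>W. \<forall>i. total_deriv (\<lambda>q. V (snd q 1) $ i) p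
                 = - total_deriv (inner_op 1 g c (\<lambda>j. euler j h) i) p)"

definition hamiltonian_system :: "(real ^ 'n::finite) set \<Rightarrow> (real ^ 'n \<Rightarrow> real ^ 'n ^ 'n) \<Rightarrow>
    (real ^ 'n \<Rightarrow> real ^ 'n ^ 'n ^ 'n) \<Rightarrow> (real ^ 'n \<Rightarrow> real ^ 'n) \<Rightarrow> bool" where
  "hamiltonian_system U g c V \<longleftrightarrow> (\<exists>W h. hamiltonian_with U g c V W h)"


section \<open>Local equivalence\<close>

text \<open>\<open>reciprocal_related V p W q\<close>: a reciprocal transformation takes the system with fluxes \<open>V\<close>,
  for \<open>u\<close> near \<open>p\<close>, to the system with fluxes \<open>W\<close>, for the new densities \<open>\<phi> u\<close> near \<open>q\<close>. The two
  vector equations are the coefficients of \<open>dx\<close> and \<open>dt\<close> in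
  \<open>u\<^sup>i dx + V\<^sup>i dt = \<phi>\<^sup>i dx' + W\<^sup>i dt'\<close> with
  \<open>dx' = (\<alpha>\<^sub>i u\<^sup>i + a) dx + (\<alpha>\<^sub>i V\<^sup>i + b) dt\<close> and \<open>dt' = (\<beta>\<^sub>i u\<^sup>i + c) dx + (\<beta>\<^sub>i V\<^sup>i + d) dt\<close>.\<close>

definition reciprocal_related :: "(real ^ 'n::finite \<Rightarrow> real ^ 'n) \<Rightarrow> real ^ 'n \<Rightarrow>
    (real ^ 'n \<Rightarrow> real ^ 'n) \<Rightarrow> real ^ 'n \<Rightarrow> bool" where
  "reciprocal_related V p W q \<longleftrightarrow>
     (\<exists>\<alpha> \<beta> :: real ^ 'n. \<exists>a b c d :: real. \<exists>N M \<phi>.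
        a * d - b * c \<noteq> 0 \<and> diffeo_between N M \<phi> \<and> p \<in> N \<and> \<phi> p = q \<and>
        (\<forall>u\<in>N. (\<alpha> \<bullet> u + a) * (\<beta> \<bullet> V u + d) - (\<alpha> \<bullet> V u + b) * (\<beta> \<bullet> u + c) \<noteq> 0 \<and>
          u = (\<alpha> \<bullet> u + a) *\<^sub>R \<phi> u + (\<beta> \<bullet> u + c) *\<^sub>R W (\<phi> u) \<and>
          V u = (\<alpha> \<bullet> V u + b) *\<^sub>R \<phi> u + (\<beta> \<bullet> V u + d) *\<^sub>R W (\<phi> u)))"

text \<open>The constant \<open>\<gamma>\<close> accounts for the fact that a system determines its fluxes up to constants.\<close>

definition affinely_related :: "(real ^ 'n::finite \<Rightarrow> real ^ 'n) \<Rightarrow> real ^ 'n \<Rightarrow>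
    (real ^ 'n \<Rightarrow> real ^ 'n) \<Rightarrow> real ^ 'n \<Rightarrow> bool" where
  "affinely_related V p W q \<longleftrightarrow>
     (\<exists>(B :: real ^ 'n ^ 'n) \<beta> \<gamma> N.
        invertible B \<and> open N \<and> p \<in> N \<and> q = B *v p + \<beta> \<and>
        (\<forall>u\<in>N. W (B *v u + \<beta>) = B *v V u + \<gamma>))"

inductive locally_equivalent :: "(real ^ 'n::finite \<Rightarrow> real ^ 'n) \<Rightarrow> real ^ 'n \<Rightarrow>
    (real ^ 'n \<Rightarrow> real ^ 'n) \<Rightarrow> real ^ 'n \<Rightarrow> bool" where
  refl: "locally_equivalent V p V p"
| reciprocal: "locally_equivalent V p V' p' \<Longrightarrow> reciprocal_related V' p' W q \<Longrightarrow>
     locally_equivalent V p W q"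
| affine: "locally_equivalent V p V' p' \<Longrightarrow> affinely_related V' p' W q \<Longrightarrow>
     locally_equivalent V p W q"

end

theory Submission
  imports Defs
begin

text \<open>Evaluating the Jacobi identity only at constant fields, for densities \<open>\<phi>(x) u\<^sup>i\<close>, already forces
  \<open>c\<^sub>i\<^sub>j\<^sub>k = c\<^sub>i \<epsilon>\<^sub>j\<^sub>k\<close> and the equations for \<open>g\<^sub>i\<^sub>j\<^sub>,\<^sub>k\<close>, whose solutions are \<open>g\<^sub>i\<^sub>j = Q(e\<^sub>i, e\<^sub>j)\<close> for a constant
  quadratic form \<open>Q\<close> on three-space and \<open>e\<^sub>1 = (1, 0, -u\<^sup>2)\<close>, \<open>e\<^sub>2 = (0, 1, u\<^sup>1)\<close>. For a Hamiltonian system,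
  \<open>V\<^sup>i + (g\<^sup>i\<^sup>j D + c\<^sup>i\<^sup>j\<^sub>k u\<^sup>k\<^sub>x) \<psi>\<^sub>j\<close> with \<open>\<psi> = \<delta>H/\<delta>b\<close> is constant. Comparing coefficients of the
  derivatives of \<open>u\<close> shows that \<open>\<psi>\<^sub>i = \<Psi>(e\<^sub>i)\<close> for a covector \<open>\<Psi>\<close> depending on \<open>x\<close> and \<open>b\<close> only, and that
  \<open>\<Psi>\<close> annihilates \<open>e\<^sub>3 - c\<^sup>m e\<^sub>m\<close>. Hence \<open>Q\<close> is degenerate unless \<open>V\<close> is constant. It follows that the Pluecker
  coordinates of the lines of the congruence satisfy two independent linear equations. By strict
  hyperbolicity, two members of this pencil of line complexes consist of the lines that meet a fixed
  line. Such a congruence is projectively that of \<open>u\<^sup>1\<^sub>t = u\<^sup>1\<^sub>x\<close>, \<open>u\<^sup>2\<^sub>t = - u\<^sup>2\<^sub>x\<close>.\<close>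

section \<open>Directional derivatives on the jet space\<close>

text \<open>The density of the Hamiltonian lives on an open set of jets that need not be connected,
  so a vanishing derivative gives constancy only locally. For this reason the variational derivative
  is studied in one coordinate box around a jet over the given point of \<open>U\<close>, and all
  covectors and constants found there belong to that box. The degeneracy of Q has the following
  source. The relation between a covector and its contraction with c, multiplied by the determinant
  of the metric, says that adj(Q) applied to the covector is orthogonal to (-y, x, -1) for all small
  x, y. These vectors span three-space, so adj(Q) kills the covector. If Q is invertible, the
  covector is zero; otherwise adj(Q) is a nonzero multiple of k k^T with k in the kernel of Q, and
  the condition is that the covector annihilates k. In the flux equations a scalar factor 1 - k1 y +
  k2 x then cancels, which turns equations quadratic in x, y into linear ones for the Pluecker
  coordinates.\<close>

text \<open>Directions in the jet space: \<open>None\<close> is \<open>x\<close>, and \<open>Some (k, i)\<close> is the \<open>i\<close>-th component of the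
  \<open>k\<close>-th derivative. They make the two families of partial derivatives of the definitions uniform.\<close>

definition jet_move :: "(nat \<times> 'n) option \<Rightarrow> real \<Rightarrow> 'n::finite jet \<Rightarrow> 'n jet" where
  "jet_move d s p = (case d of None \<Rightarrow> (fst p + s, snd p)
     | Some (k, i) \<Rightarrow> (fst p, (snd p)(k := snd p k + s *\<^sub>R axis i 1)))"

definition jet_deriv :: "(nat \<times> 'n) option \<Rightarrow> ('n::finite jet \<Rightarrow> real) \<Rightarrow> 'n jet \<Rightarrow> real" where
  "jet_deriv d f p = deriv (\<lambda>s. f (jet_move d s p)) 0"

definition jet_diff_on :: "'n::finite jet set \<Rightarrow> ('n jet \<Rightarrow> real) \<Rightarrow> bool" where
  "jet_diff_on W f \<longleftrightarrow> (\<forall>p\<in>W. \<forall>d. (\<lambda>s. f (jet_move d s p)) differentiable (at 0))"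

lemma jet_dx_eq: "jet_dx f = jet_deriv None f"
  by (rule ext) (simp add: jet_dx_def jet_deriv_def jet_move_def)

lemma jet_du_eq: "jet_du k i f = jet_deriv (Some (k, i)) f"
  by (rule ext) (simp add: jet_du_def jet_deriv_def jet_move_def)

lemma jet_move_0 [simp]: "jet_move d 0 p = p"
  by (cases d) (auto simp: jet_move_def)

lemma jet_move_add: "jet_move d s (jet_move d t p) = jet_move d (t + s) p"
  by (cases d) (auto simp: jet_move_def algebra_simps)

text \<open>Merges the clauses for x and for the jet coordinates into one quantifier over
  directions, so that each closure property below needs a single induction.\<close>

lemma jet_Ck_on_Suc:
  fixes f :: "'a::finite jet \<Rightarrow> real"
  shows "jet_Ck_on (Suc m) W f \<longleftrightarrow>
     continuous_on W f \<and> jet_diff_on W f \<and> (\<forall>d. jet_Ck_on m W (jet_deriv d f))"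
proof -
  have all: "(\<forall>d. P d) \<longleftrightarrow> P None \<and> (\<forall>k i. P (Some (k, i)))" for P :: "(nat \<times> 'a) option \<Rightarrow> bool"
    by (metis not_None_eq surj_pair)
  show ?thesis
    unfolding jet_Ck_on.simps jet_diff_on_def jet_dx_eq jet_du_eq all
    by (simp add: jet_move_def) blast
qed

declare jet_Ck_on.simps(2) [simp del]

lemma continuous_on_jet_move: "continuous_on UNIV (\<lambda>s. jet_move d s p)"
proof (cases d)
  case None
  then show ?thesis by (auto simp: jet_move_def intro!: continuous_intros)
next
  case (Some ki)
  obtain k i where ki: "ki = (k, i)" by force
  have "continuous_on UNIV (\<lambda>s. (snd p)(k := snd p k + s *\<^sub>R axis i 1))"
  proof (rule continuous_on_coordinatewise_then_product)
    show "continuous_on UNIV (\<lambda>s. ((snd p)(k := snd p k + s *\<^sub>R axis i 1)) j)" for j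
      by (cases "j = k") (auto intro!: continuous_intros)
  qed
  then show ?thesis
    by (auto simp: jet_move_def Some ki intro!: continuous_intros)
qed

lemma eventually_jet_move_in:
  assumes "open W" "p \<in> W"
  shows "eventually (\<lambda>s. jet_move d s p \<in> W) (nhds 0)"
proof -
  have "open ((\<lambda>s. jet_move d s p) -` W)"
    by (rule open_vimage[OF assms(1) continuous_on_jet_move])
  moreover have "0 \<in> (\<lambda>s. jet_move d s p) -` W" using assms by simp
  ultimately show ?thesis
    unfolding eventually_nhds by (intro exI[of _ "(\<lambda>s. jet_move d s p) -` W"]) simp
qed

text \<open>Identities between differential functions hold only on their open domain
  \<open>W\<close>, while \<open>deriv\<close> acts on total functions. Openness keeps a short piece
  of each coordinate line inside \<open>W\<close>; this is why the rules below carry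
  \<open>W\<close> along.\<close>

lemma jet_deriv_cong:
  assumes "open W" "p \<in> W" "\<And>q. q \<in> W \<Longrightarrow> f q = g q"
  shows "jet_deriv d f p = jet_deriv d g p"
  unfolding jet_deriv_def
  by (rule deriv_cong_ev)
    (auto intro: eventually_mono[OF eventually_jet_move_in[OF assms(1,2)]] assms(3))

lemma jet_deriv_eqI:
  assumes "((\<lambda>s. f (jet_move d s p)) has_real_derivative D) (at 0)"
  shows "jet_deriv d f p = D"
  unfolding jet_deriv_def by (rule DERIV_imp_deriv) fact

lemma differentiable_real_iff:
  fixes f :: "real \<Rightarrow> real"
  shows "f differentiable (at x) \<longleftrightarrow> (f has_real_derivative (deriv f x)) (at x)"
  using DERIV_deriv_iff_real_differentiable by blast

lemma jet_diff_onD: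
  assumes "jet_diff_on W f" "p \<in> W"
  shows "((\<lambda>s. f (jet_move d s p)) has_real_derivative jet_deriv d f p) (at 0)"
  using assms unfolding jet_diff_on_def jet_deriv_def differentiable_real_iff by blast

lemma jet_diff_onI:
  assumes "\<And>p d. p \<in> W \<Longrightarrow> ((\<lambda>s. f (jet_move d s p)) has_real_derivative D d p) (at 0)"
  shows "jet_diff_on W f"
  unfolding jet_diff_on_def real_differentiable_def using assms by blast

lemma jet_diff_on_shift:
  assumes "jet_diff_on W f" "jet_move d t p \<in> W"
  shows "((\<lambda>s. f (jet_move d s p)) has_real_derivative jet_deriv d f (jet_move d t p)) (at t)"
proof -
  have "((\<lambda>s. f (jet_move d (t + s) p)) has_real_derivative jet_deriv d f (jet_move d t p)) (at 0)"
    using jet_diff_onD[OF assms, of d] by (simp add: jet_move_add)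
  then show ?thesis
    using DERIV_shift[of "\<lambda>s. f (jet_move d s p)" _ 0 t] by (simp add: add.commute)
qed

lemma jet_diff_on_cong:
  assumes "open W" "\<And>q. q \<in> W \<Longrightarrow> f q = g q" "jet_diff_on W g"
  shows "jet_diff_on W f"
proof (rule jet_diff_onI)
  fix p d assume p: "p \<in> W"
  have "eventually (\<lambda>s. f (jet_move d s p) = g (jet_move d s p)) (nhds 0)"
    by (auto intro: eventually_mono[OF eventually_jet_move_in[OF assms(1) p]] assms(2))
  then show "((\<lambda>s. f (jet_move d s p)) has_real_derivative jet_deriv d g p) (at 0)"
    using jet_diff_onD[OF assms(3) p, of d] DERIV_cong_ev by fastforce
qed

lemma jet_Ck_on_cong:
  assumes "open W" "\<And>q. q \<in> W \<Longrightarrow> f q = g q" "jet_Ck_on m W g"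
  shows "jet_Ck_on m W f"
  using assms(2,3)
proof (induction m arbitrary: f g)
  case 0
  then show ?case using continuous_on_cong[of W W f g] by auto
next
  case (Suc m)
  show ?case unfolding jet_Ck_on_Suc
  proof (intro conjI allI)
    show "continuous_on W f" using Suc.prems continuous_on_cong[of W W f g] by (auto simp: jet_Ck_on_Suc)
    show "jet_diff_on W f"
      using jet_diff_on_cong[OF assms(1) Suc.prems(1)] Suc.prems(2) by (auto simp: jet_Ck_on_Suc)
    fix d
    show "jet_Ck_on m W (jet_deriv d f)"
      by (rule Suc.IH[of _ "jet_deriv d g"])
        (use Suc.prems jet_deriv_cong[OF assms(1) _ Suc.prems(1)] in \<open>auto simp: jet_Ck_on_Suc\<close>)
  qed
qed

lemma jet_Ck_on_mono: "jet_Ck_on m W f \<Longrightarrow> n \<le> m \<Longrightarrow> jet_Ck_on n W f"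
proof (induction m arbitrary: f n)
  case (Suc m)
  then show ?case
    by (cases n) (auto simp: jet_Ck_on_Suc)
qed auto

lemma jet_Ck_on_const [simp]: "jet_Ck_on m (W :: 'a::finite jet set) (\<lambda>_. c)"
proof (induction m arbitrary: c)
  case (Suc m)
  have "jet_deriv d (\<lambda>_. c) = (\<lambda>_. 0)" for d :: "(nat \<times> 'a) option"
    by (rule ext) (simp add: jet_deriv_def)
  moreover have "jet_diff_on W (\<lambda>_. c)"
    by (simp add: jet_diff_on_def)
  ultimately show ?case
    unfolding jet_Ck_on_Suc using Suc by auto
qed simp

lemma jet_diff_on_add:
  assumes "jet_diff_on W f" "jet_diff_on W g"
  shows "jet_diff_on W (\<lambda>p. f p + g p)"
  by (rule jet_diff_onI, rule DERIV_add) (rule jet_diff_onD[OF assms(1)] jet_diff_onD[OF assms(2)], assumption)+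

lemma jet_deriv_add:
  assumes "jet_diff_on W f" "jet_diff_on W g" "p \<in> W"
  shows "jet_deriv d (\<lambda>p. f p + g p) p = jet_deriv d f p + jet_deriv d g p"
  by (rule jet_deriv_eqI, rule DERIV_add) (rule jet_diff_onD[OF assms(1,3)] jet_diff_onD[OF assms(2,3)])+

lemma jet_diff_on_mult:
  assumes "jet_diff_on W f" "jet_diff_on W g"
  shows "jet_diff_on W (\<lambda>p. f p * g p)"
  by (rule jet_diff_onI, rule DERIV_mult) (rule jet_diff_onD[OF assms(1)] jet_diff_onD[OF assms(2)],
    assumption)+

lemma jet_deriv_mult:
  assumes "jet_diff_on W f" "jet_diff_on W g" "p \<in> W"
  shows "jet_deriv d (\<lambda>p. f p * g p) p = jet_deriv d f p * g p + f p * jet_deriv d g p"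
  using jet_deriv_eqI[OF DERIV_mult[OF jet_diff_onD[OF assms(1,3)] jet_diff_onD[OF assms(2,3)]]]
  by (simp add: algebra_simps)

lemma jet_Ck_on_add:
  assumes "open W" "jet_Ck_on m W f" "jet_Ck_on m W g"
  shows "jet_Ck_on m W (\<lambda>p. f p + g p)"
  using assms(2,3)
proof (induction m arbitrary: f g)
  case 0
  then show ?case by (auto intro!: continuous_intros)
next
  case (Suc m)
  note * = Suc.prems[unfolded jet_Ck_on_Suc]
  show ?case unfolding jet_Ck_on_Suc
  proof (intro conjI allI)
    show "continuous_on W (\<lambda>p. f p + g p)" using * by (auto intro!: continuous_intros)
    show "jet_diff_on W (\<lambda>p. f p + g p)" using * by (auto intro!: jet_diff_on_add)
    show "jet_Ck_on m W (jet_deriv d (\<lambda>p. f p + g p))" for d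
      by (rule jet_Ck_on_cong[OF assms(1) _ Suc.IH[of "jet_deriv d f" "jet_deriv d g"]])
         (use * in \<open>auto intro!: jet_deriv_add[where W = W]\<close>)
  qed
qed

lemma jet_Ck_on_mult:
  assumes "open W" "jet_Ck_on m W f" "jet_Ck_on m W g"
  shows "jet_Ck_on m W (\<lambda>p. f p * g p)"
  using assms(2,3)
proof (induction m arbitrary: f g)
  case 0
  then show ?case by (auto intro!: continuous_intros)
next
  case (Suc m)
  note * = Suc.prems[unfolded jet_Ck_on_Suc]
  have m: "jet_Ck_on m W f" "jet_Ck_on m W g"
    by (rule jet_Ck_on_mono[OF Suc.prems(1)] jet_Ck_on_mono[OF Suc.prems(2)], simp)+
  show ?case unfolding jet_Ck_on_Suc
  proof (intro conjI allI)
    show "continuous_on W (\<lambda>p. f p * g p)" using * by (auto intro!: continuous_intros)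
    show "jet_diff_on W (\<lambda>p. f p * g p)" using * by (auto intro!: jet_diff_on_mult)
    show "jet_Ck_on m W (jet_deriv d (\<lambda>p. f p * g p))" for d
      by (rule jet_Ck_on_cong[OF assms(1), where g = "\<lambda>p. jet_deriv d f p * g p + f p * jet_deriv d g p"])
         (use * m in \<open>auto intro!: jet_deriv_mult[where W = W] jet_Ck_on_add[OF assms(1)] Suc.IH\<close>)
  qed
qed

lemma jet_coord_move:
  "snd (jet_move d s p) k $ i = snd p k $ i + (if d = Some (k, i) then s else 0)"
  by (auto simp: jet_move_def axis_def split: option.splits prod.splits)

lemma fst_jet_move: "fst (jet_move d s p) = fst p + (if d = None then s else 0)"
  by (auto simp: jet_move_def split: option.splits prod.splits)

lemma continuous_on_jet_snd [continuous_intros]: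
  "continuous_on W (\<lambda>p::real \<times> (nat \<Rightarrow> real ^ 'n::finite). snd p k)"
  using continuous_on_product_coordinates[of k]
  by (intro continuous_on_compose2[OF _ continuous_on_snd[OF continuous_on_id], of UNIV "\<lambda>w. w k"]) auto

lemma jet_Ck_on_coord: "jet_Ck_on m W (\<lambda>p. snd p k $ i)"
proof (cases m)
  case 0
  then show ?thesis by (auto intro!: continuous_intros)
next
  case (Suc n)
  have d: "((\<lambda>s. snd (jet_move d s p) k $ i) has_real_derivative (if d = Some (k, i) then 1 else 0)) (at 0)"
    for d p unfolding jet_coord_move by (auto intro!: derivative_eq_intros)
  have "jet_deriv d (\<lambda>p. snd p k $ i) = (\<lambda>_. if d = Some (k, i) then 1 else 0)" for d
    by (rule ext, rule jet_deriv_eqI[OF d])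
  then show ?thesis
    unfolding Suc jet_Ck_on_Suc using jet_diff_onI[OF d] by (auto intro!: continuous_intros)
qed

lemma jet_Ck_on_fst:
  assumes "\<And>n x. (A n has_real_derivative A (Suc n) x) (at x)"
  shows "jet_Ck_on m (W :: 'a::finite jet set) (\<lambda>p. A n (fst p))"
proof (induction m arbitrary: n)
  have c: "continuous_on UNIV (A n)" for n
    using assms by (meson DERIV_isCont continuous_at_imp_continuous_on)
  have c': "continuous_on W (\<lambda>p. A n (fst p))" for n
    by (rule continuous_on_compose2[OF c]) (auto intro!: continuous_intros)
  {
    case 0
    show ?case using c' by simp
  next
    case (Suc m)
    have d: "((\<lambda>s. A n (fst (jet_move d s p))) has_real_derivative
              (if d = None then A (Suc n) (fst p) else 0)) (at 0)" for d p
      unfolding fst_jet_move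
      by (auto intro!: DERIV_chain'[OF _ assms, THEN DERIV_cong] derivative_eq_intros)
    have "jet_deriv d (\<lambda>p. A n (fst p)) = (\<lambda>p. if d = None then A (Suc n)
      (fst p) else 0)" for d :: "(nat \<times> 'a) option"
      by (rule ext, rule jet_deriv_eqI[OF d])
    moreover have "jet_Ck_on m W (\<lambda>p. if d = None then A (Suc n) (fst p) else 0)" for d :: "(nat \<times> 'a) option"
      using Suc by (cases d) auto
    ultimately show ?case
      unfolding jet_Ck_on_Suc using c' Suc jet_diff_onI[OF d] by (auto simp: if_distrib)
  }
qed

section \<open>Differential functions of finite order\<close>

definition jet_order :: "'n::finite jet set \<Rightarrow> nat \<Rightarrow> ('n jet \<Rightarrow> real) \<Rightarrow> bool" where
  "jet_order W n f \<longleftrightarrow> (\<forall>p\<in>W. \<forall>q\<in>W. fst p = fst q \<longrightarrow> (\<forall>k<n. snd p k = snd q k) \<longrightarrow> f p = f q)"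

lemma jet_orderD:
  "jet_order W n f \<Longrightarrow> p \<in> W \<Longrightarrow> q \<in> W \<Longrightarrow> fst p = fst q \<Longrightarrow> (\<And>k. k < n \<Longrightarrow> snd p k = snd q k) \<Longrightarrow> f p = f q"
  unfolding jet_order_def by blast

lemma jet_order_mono: "jet_order W n f \<Longrightarrow> n \<le> m \<Longrightarrow> jet_order W m f"
  unfolding jet_order_def by (meson less_le_trans)

lemma jet_order_subset: "jet_order W n f \<Longrightarrow> W' \<subseteq> W \<Longrightarrow> jet_order W' n f"
  unfolding jet_order_def by blast

lemma jet_move_agree:
  assumes "fst p = fst q" "snd p k = snd q k"
  shows "snd (jet_move d s p) k = snd (jet_move d s q) k"
  using assms by (auto simp: jet_move_def split: option.splits prod.splits)

lemma jet_order_deriv: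
  assumes W: "open W" and f: "jet_order W n f"
  shows "jet_order W n (jet_deriv d f)"
  unfolding jet_order_def
proof (intro ballI impI)
  fix p q assume p: "p \<in> W" and q: "q \<in> W" and e: "fst p = fst q" "\<forall>k<n. snd p k = snd q k"
  have "eventually (\<lambda>s. f (jet_move d s p) = f (jet_move d s q)) (nhds 0)"
    using eventually_jet_move_in[OF W p, of d] eventually_jet_move_in[OF W q, of d]
  proof eventually_elim
    case (elim s)
    show ?case
      by (rule jet_orderD[OF f elim]) (use e in \<open>auto simp: fst_jet_move intro!: jet_move_agree\<close>)
  qed
  then show "jet_deriv d f p = jet_deriv d f q"
    unfolding jet_deriv_def by (rule deriv_cong_ev) simp
qed

lemma jet_order_move:
  assumes "jet_order W n f" "p \<in> W" "jet_move (Some (k, i)) s p \<in> W" "n \<le> k"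
  shows "f (jet_move (Some (k, i)) s p) = f p"
  by (rule jet_orderD[OF assms(1,3,2)]) (use assms(4) in \<open>auto simp: jet_move_def\<close>)

lemma jet_deriv_order_zero:
  assumes "open W" "jet_order W n f" "p \<in> W" "n \<le> k"
  shows "jet_deriv (Some (k, i)) f p = 0"
proof -
  have "eventually (\<lambda>s. f (jet_move (Some (k, i)) s p) = f p) (nhds 0)"
    using eventually_jet_move_in[OF assms(1,3)]
    by eventually_elim (rule jet_order_move[OF assms(2,3) _ assms(4)])
  then show ?thesis unfolding jet_deriv_def by (subst deriv_cong_ev[where g = "\<lambda>_. f p"]) auto
qed

section \<open>Total derivative and Euler operator on functions of finite order\<close>

lemma total_deriv_jet_deriv:
  "total_deriv f p = jet_deriv None f p + (\<Sum>k. \<Sum>i\<in>UNIV. snd p (Suc k) $ i * jet_deriv (Some (k, i)) f p)"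
  by (simp add: total_deriv_def jet_dx_eq jet_du_eq)

lemma total_deriv_finite:
  assumes "open W" "jet_order W n f" "p \<in> W"
  shows "total_deriv f p =
    jet_deriv None f p + (\<Sum>k<n. \<Sum>i\<in>UNIV. snd p (Suc k) $ i * jet_deriv (Some (k, i)) f p)"
  unfolding total_deriv_jet_deriv
  by (subst suminf_finite[where N = "{..<n}"]) (auto simp: jet_deriv_order_zero[OF assms] not_less)

lemma total_deriv_cong:
  assumes "open W" "p \<in> W" "\<And>q. q \<in> W \<Longrightarrow> f q = g q"
  shows "total_deriv f p = total_deriv g p"
  using jet_deriv_cong[OF assms(1,2), of f g, OF assms(3)] by (simp add: total_deriv_jet_deriv)

lemma total_deriv_pow_cong:
  assumes "open W" "p \<in> W" "\<And>q. q \<in> W \<Longrightarrow> f q = g q"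
  shows "(total_deriv ^^ k) f p = (total_deriv ^^ k) g p"
  using assms(2) by (induction k arbitrary: p) (auto intro!: total_deriv_cong[OF assms(1)] assms(3))

lemma total_deriv_zero [simp]: "total_deriv (\<lambda>_. 0) = (\<lambda>_. 0)"
  by (rule ext) (simp add: total_deriv_jet_deriv jet_deriv_def)

lemma total_deriv_pow_zero [simp]: "(total_deriv ^^ k) (\<lambda>_. 0) = (\<lambda>_. 0)"
  by (induction k) auto

lemma euler_finite:
  assumes "open W" "jet_order W n f" "p \<in> W"
  shows "euler j f p = (\<Sum>k<n. (-1) ^ k * (total_deriv ^^ k) (jet_deriv (Some (k, j)) f) p)"
  unfolding euler_def jet_du_eq
proof (rule suminf_finite)
  fix k assume "k \<notin> {..<n}"
  then have "(total_deriv ^^ k) (jet_deriv (Some (k, j)) f) p = (total_deriv ^^ k) (\<lambda>_. 0) p"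
    by (intro total_deriv_pow_cong[OF assms(1,3)] jet_deriv_order_zero[OF assms(1,2)]) auto
  then show "(- 1) ^ k * (total_deriv ^^ k) (jet_deriv (Some (k, j)) f) p = 0" by simp
qed simp

definition jet_smooth :: "'n::finite jet set \<Rightarrow> nat \<Rightarrow> ('n jet \<Rightarrow> real) \<Rightarrow> bool" where
  "jet_smooth W n f \<longleftrightarrow> (\<forall>m. jet_Ck_on m W f) \<and> jet_order W n f"

lemma jet_smooth_imp_diff: "jet_smooth W n f \<Longrightarrow> jet_diff_on W f"
  unfolding jet_smooth_def using jet_Ck_on_Suc by blast

lemma jet_smooth_mono: "jet_smooth W n f \<Longrightarrow> n \<le> m \<Longrightarrow> jet_smooth W m f"
  using jet_order_mono unfolding jet_smooth_def by blast

lemma jet_smooth_deriv: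
  assumes "open W" "jet_smooth W n f"
  shows "jet_smooth W n (jet_deriv d f)"
  using assms jet_order_deriv[OF assms(1)] jet_Ck_on_Suc unfolding jet_smooth_def by blast

lemma jet_smooth_cong:
  assumes "open W" "\<And>p. p \<in> W \<Longrightarrow> f p = g p" "jet_smooth W n g"
  shows "jet_smooth W n f"
  unfolding jet_smooth_def
proof
  show "\<forall>m. jet_Ck_on m W f"
  proof
    fix m
    have "jet_Ck_on m W g" using assms(3) by (simp add: jet_smooth_def)
    with assms(1,2) show "jet_Ck_on m W f" by (rule jet_Ck_on_cong)
  qed
  show "jet_order W n f"
    using assms(3) unfolding jet_smooth_def jet_order_def by (metis assms(2))
qed

lemma jet_smooth_add:
  assumes "open W" "jet_smooth W n f" "jet_smooth W n g"
  shows "jet_smooth W n (\<lambda>p. f p + g p)"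
  unfolding jet_smooth_def
proof
  show "\<forall>m. jet_Ck_on m W (\<lambda>p. f p + g p)"
    using jet_Ck_on_add[OF assms(1)] assms(2,3) unfolding jet_smooth_def by blast
  show "jet_order W n (\<lambda>p. f p + g p)"
    using assms(2,3) unfolding jet_smooth_def jet_order_def by metis
qed

lemma jet_smooth_mult:
  assumes "open W" "jet_smooth W n f" "jet_smooth W n g"
  shows "jet_smooth W n (\<lambda>p. f p * g p)"
  unfolding jet_smooth_def
proof
  show "\<forall>m. jet_Ck_on m W (\<lambda>p. f p * g p)"
    using jet_Ck_on_mult[OF assms(1)] assms(2,3) unfolding jet_smooth_def by blast
  show "jet_order W n (\<lambda>p. f p * g p)"
    using assms(2,3) unfolding jet_smooth_def jet_order_def by metis
qed

lemma jet_smooth_const: "jet_smooth W n (\<lambda>_. c)"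
  by (simp add: jet_smooth_def jet_order_def)

lemma jet_smooth_sum:
  assumes "open W" "\<And>i. i \<in> I \<Longrightarrow> jet_smooth W n (f i)"
  shows "jet_smooth W n (\<lambda>p. \<Sum>i\<in>I. f i p)"
  using assms(2)
  by (induction I rule: infinite_finite_induct) (auto intro: jet_smooth_add[OF assms(1)] jet_smooth_const)

lemma jet_smooth_coord: "k < n \<Longrightarrow> jet_smooth W n (\<lambda>p. snd p k $ i)"
  using jet_Ck_on_coord by (auto simp: jet_smooth_def jet_order_def)

lemma jet_smooth_total_deriv:
  assumes "open W" "jet_smooth W n f"
  shows "jet_smooth W (Suc n) (total_deriv f)"
proof (rule jet_smooth_cong[OF assms(1) total_deriv_finite[OF assms(1), of n f]])
  show "jet_order W n f" using assms by (simp add: jet_smooth_def)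
  have D: "jet_smooth W (Suc n) (jet_deriv d f)" for d
    by (rule jet_smooth_mono[OF jet_smooth_deriv[OF assms]]) simp
  show "jet_smooth W (Suc n) (\<lambda>p. jet_deriv None f p
      + (\<Sum>k<n. \<Sum>i\<in>UNIV. snd p (Suc k) $ i * jet_deriv (Some (k, i)) f p))"
    by (intro jet_smooth_add jet_smooth_sum jet_smooth_mult jet_smooth_coord D assms(1)) simp
qed auto

lemma jet_smooth_total_deriv_pow:
  assumes "open W" "jet_smooth W n f"
  shows "jet_smooth W (n + k) ((total_deriv ^^ k) f)"
  by (induction k) (auto intro: jet_smooth_total_deriv assms)

text \<open>The \<open>k\<close>-th summand, \<open>k < n\<close>, applies the total derivative
  \<open>k\<close> times to a function of order \<open>n\<close>; the doubled order covers all of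
  them.\<close>

lemma jet_smooth_euler:
  assumes "open W" "jet_smooth W n f"
  shows "jet_smooth W (n + n) (euler j f)"
proof (rule jet_smooth_cong[OF assms(1) euler_finite[OF assms(1), of n f]])
  show "jet_order W n f" using assms by (simp add: jet_smooth_def)
  have D: "jet_smooth W (n + n) ((total_deriv ^^ k) (jet_deriv (Some (k, j)) f))" if "k < n" for k
    by (rule jet_smooth_mono[OF jet_smooth_total_deriv_pow[OF assms(1) jet_smooth_deriv[OF assms]]])
      (use that in simp)
  show "jet_smooth W (n + n) (\<lambda>p. \<Sum>k<n. (-1) ^ k * (total_deriv ^^ k) (jet_deriv (Some (k, j)) f) p)"
    by (intro jet_smooth_sum jet_smooth_mult jet_smooth_const D assms(1)) simp
qed auto

lemma differential_function_smooth:
  "differential_function W f \<Longrightarrow> \<exists>n. jet_smooth W n f"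
  unfolding differential_function_def jet_smooth_def jet_order_def
  by (metis le_imp_less_Suc)

lemma jet_smooth_differential_function:
  "jet_smooth W n f \<Longrightarrow> differential_function W f"
  unfolding differential_function_def jet_smooth_def jet_order_def
  by (meson less_imp_le)

section \<open>Boxes in the jet space and the kernel of the total derivative\<close>

text \<open>Coordinates from the \<open>K\<close>-th derivative on are unrestricted, as in the product topology.\<close>

definition jet_box :: "'n::finite jet \<Rightarrow> nat \<Rightarrow> real \<Rightarrow> 'n jet set" where
  "jet_box p0 K e = {q. \<bar>fst q - fst p0\<bar> < e \<and> (\<forall>k<K. \<forall>i. \<bar>snd q k $ i - snd p0 k $ i\<bar> < e)}"

lemma open_jet_box: "open (jet_box p0 K e)"
proof -
  have "jet_box p0 K e = {q. \<bar>fst q - fst p0\<bar> < e} \<inter>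
      (\<Inter>k\<in>{..<K}. \<Inter>i\<in>UNIV. {q. \<bar>snd q k $ i - snd p0 k $ i\<bar> < e})"
    by (auto simp: jet_box_def)
  moreover have "open {q :: 'a jet. \<bar>fst q - fst p0\<bar> < e}"
    by (intro open_Collect_less continuous_intros)
  moreover have "open {q :: 'a jet. \<bar>snd q k $ i - snd p0 k $ i\<bar> < e}" for k i
    by (intro open_Collect_less continuous_intros)
  ultimately show ?thesis by (auto intro!: open_Int open_INT)
qed

text \<open>A basic open set of the product topology restricts finitely many levels only, so one
  \<open>K\<close> and the minimum of finitely many radii suffice.\<close>

lemma jet_box_exists:
  fixes W :: "'n::finite jet set"
  assumes "open W" "p0 \<in> W"
  shows "\<exists>K e. 0 < e \<and> jet_box p0 K e \<subseteq> W"
proof -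
  obtain A B where AB: "open A" "open B" "p0 \<in> A \<times> B" "A \<times> B \<subseteq> W"
    using assms open_prod_elim by metis
  have "openin (product_topology (\<lambda>_::nat. euclidean :: (real ^ 'n) topology) UNIV) B"
    using AB(2) by (simp add: open_fun_def)
  then obtain X where X: "snd p0 \<in> (\<Pi>\<^sub>E i\<in>UNIV. X i)" "\<And>i. open (X i)"
      "finite {i. X i \<noteq> UNIV}" "(\<Pi>\<^sub>E i\<in>UNIV. X i) \<subseteq> B"
    using product_topology_open_contains_basis[of "\<lambda>_. euclidean" UNIV B "snd p0"] AB(3)
    by (auto simp: mem_Times_iff)
  obtain e0 where e0: "e0 > 0" "\<And>x. \<bar>x - fst p0\<bar> < e0 \<Longrightarrow> x \<in> A"
    using AB(1,3) unfolding open_dist by (metis dist_real_def mem_Times_iff)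
  have "\<exists>e>0. \<forall>y. (\<forall>i. \<bar>y $ i - snd p0 k $ i\<bar> < e) \<longrightarrow> y \<in> X k" for k
  proof -
    obtain e where e: "e > 0" "\<And>y. dist y (snd p0 k) < e \<Longrightarrow> y \<in> X k"
      using X(1,2) unfolding open_dist by (metis PiE_mem UNIV_I)
    \<comment> \<open>The Euclidean norm is at most the sum of the \<open>CARD('n)\<close> absolute
      components, hence the division of the radius.\<close>
    have "y \<in> X k" if "\<forall>i. \<bar>y $ i - snd p0 k $ i\<bar> < e / CARD('n)" for y
    proof (rule e(2))
      have "dist y (snd p0 k) \<le> (\<Sum>i\<in>UNIV. \<bar>(y - snd p0 k) $ i\<bar>)"
        unfolding dist_norm by (rule norm_le_l1_cart)
      also have "\<dots> < (\<Sum>i\<in>(UNIV::'n set). e / CARD('n))"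
        using that by (intro sum_strict_mono) auto
      also have "\<dots> = e" by simp
      finally show "dist y (snd p0 k) < e" .
    qed
    then show ?thesis using e(1) by (intro exI[of _ "e / CARD('n)"]) auto
  qed
  then obtain r where r: "\<And>k. r k > 0" "\<And>k y. (\<forall>i. \<bar>y $ i - snd p0 k $ i\<bar> < r k) \<Longrightarrow> y \<in> X k"
    by metis
  define F where "F = {i. X i \<noteq> UNIV}"
  obtain K where K: "\<And>k. k \<in> F \<Longrightarrow> k < K"
    using X(3) F_def finite_nat_set_iff_bounded by auto
  define e where "e = Min (insert e0 (r ` F))"
  have fin: "finite (insert e0 (r ` F))" using X(3) by (simp add: F_def)
  have e: "e > 0" unfolding e_def using fin e0(1) r(1) by (subst Min_gr_iff) auto
  have le: "e \<le> e0" "\<And>k. k \<in> F \<Longrightarrow> e \<le> r k"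
    unfolding e_def using fin by (auto intro: Min_le)
  have "jet_box p0 K e \<subseteq> A \<times> B"
  proof
    fix q assume q: "q \<in> jet_box p0 K e"
    have "fst q \<in> A" using q le(1) by (intro e0(2)) (auto simp: jet_box_def)
    moreover have "snd q k \<in> X k" for k
    proof (cases "k \<in> F")
      case True
      then have "\<forall>i. \<bar>snd q k $ i - snd p0 k $ i\<bar> < r k"
        using q le(2)[OF True] K[OF True] unfolding jet_box_def by (auto intro: less_le_trans)
      then show ?thesis by (rule r(2))
    qed (simp add: F_def)
    ultimately show "q \<in> A \<times> B" using X(4) by (auto simp: mem_Times_iff)
  qed
  then show ?thesis using e AB(4) by blast
qed

lemma jet_box_center: "0 < e \<Longrightarrow> p0 \<in> jet_box p0 K e"
  by (simp add: jet_box_def)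

lemma jet_box_move_segment:
  assumes "p \<in> jet_box p0 K e" "jet_move d t p \<in> jet_box p0 K e" "s \<in> closed_segment 0 t"
  shows "jet_move d s p \<in> jet_box p0 K e"
proof -
  have s: "(0 \<le> s \<and> s \<le> t) \<or> (t \<le> s \<and> s \<le> 0)"
    using assms(3) by (auto simp: closed_segment_eq_real_ivl split: if_splits)
  have 1: "\<bar>a + s - b\<bar> < e" if "\<bar>a - b\<bar> < e" "\<bar>a + t - b\<bar> < e" for a b
    using that s by linarith
  have 2: "\<bar>fst p + (if d = None then s else 0) - fst p0\<bar> < e"
    using assms(1,2) 1[of "fst p" "fst p0"] by (cases d) (simp_all add: jet_box_def fst_jet_move)
  have 3: "\<bar>snd p k $ i + (if d = Some (k, i) then s else 0) - snd p0 k $ i\<bar> < e" if k: "k < K" for k i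
  proof -
    have "\<bar>snd p k $ i - snd p0 k $ i\<bar> < e"
      "\<bar>snd p k $ i + (if d = Some (k, i) then t else 0) - snd p0 k $ i\<bar> < e"
      using assms(1,2) k unfolding jet_box_def jet_coord_move mem_Collect_eq by simp_all
    then show ?thesis using 1[of "snd p k $ i" "snd p0 k $ i"] by (cases "d = Some (k, i)") simp_all
  qed
  show ?thesis
    using 2 3 by (simp add: jet_box_def jet_coord_move fst_jet_move)
qed

lemma jet_linear_along:
  assumes "jet_diff_on W f"
    and "\<And>s. s \<in> closed_segment 0 t \<Longrightarrow> jet_move d s p \<in> W \<and> jet_deriv d f (jet_move d s p) = c"
  shows "f (jet_move d t p) = f p + t * c"
proof -
  have D: "((\<lambda>s. f (jet_move d s p) - s * c) has_real_derivative 0) (at s within closed_segment 0 t)"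
    if s: "s \<in> closed_segment 0 t" for s
  proof -
    have "((\<lambda>s. f (jet_move d s p)) has_real_derivative c) (at s)"
      using jet_diff_on_shift[where f = f and p = p and d = d and t = s and W = W] assms(1) assms(2)[OF s]
        by simp
    then have "((\<lambda>s. f (jet_move d s p) - s * c) has_real_derivative c - 1 * c) (at s)"
      by (intro DERIV_diff DERIV_cmult_right DERIV_ident)
    then show ?thesis by (simp add: has_field_derivative_at_within)
  qed
  obtain k where k: "\<And>s. s \<in> closed_segment 0 t \<Longrightarrow> f (jet_move d s p) - s * c = k"
    using has_field_derivative_zero_constant[OF convex_closed_segment D] by blast
  show ?thesis using k[of 0] k[of t] by simp
qed

lemma jet_const_along:
  assumes "jet_diff_on (jet_box p0 K e) f" "\<And>q. q \<in> jet_box p0 K e \<Longrightarrow> jet_deriv d f q = 0"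
    and "p \<in> jet_box p0 K e" "jet_move d t p \<in> jet_box p0 K e"
  shows "f (jet_move d t p) = f p"
proof -
  have "f (jet_move d t p) = f p + t * 0"
    by (rule jet_linear_along[where f = f, OF assms(1)])
      (use jet_box_move_segment[OF assms(3,4)] assms(2) in blast)
  then show ?thesis by simp
qed

text \<open>In a box two jets that differ at level \<open>n\<close> only can be joined inside the
  box by moving one component at a time, and the function is constant along each of these
  segments.\<close>

lemma jet_order_reduce:
  fixes f :: "'n::finite jet \<Rightarrow> real"
  assumes f: "jet_diff_on (jet_box p0 K e) f" "jet_order (jet_box p0 K e) (Suc n) f"
    and z: "\<And>q i. q \<in> jet_box p0 K e \<Longrightarrow> jet_deriv (Some (n, i)) f q = 0"
  shows "jet_order (jet_box p0 K e) n f"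
  unfolding jet_order_def
proof (intro ballI impI)
  fix p q :: "'n jet"
  assume p: "p \<in> jet_box p0 K e" and q: "q \<in> jet_box p0 K e"
    and e: "fst p = fst q" "\<forall>k<n. snd p k = snd q k"
  \<comment> \<open>Interpolates between the two jets at level \<open>n\<close>: components in
    \<open>I\<close> come from \<open>q\<close>, the others from \<open>p\<close>. Each such jet
    lies in the box because the box is a condition on single components.\<close>
  define r where "r I = (fst p, (snd p)(n := (\<chi> i. if i \<in> I then snd q n $ i else snd p n $ i)))" for I
  have r: "r I \<in> jet_box p0 K e" for I
    using p q by (auto simp: r_def jet_box_def)
  have "f (r I) = f p" if "finite I" for I
    using that
  proof induction
    case empty
    have "r {} = p" by (auto simp: r_def prod_eq_iff vec_eq_iff)
    then show ?case by simp
  next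
    case (insert i I)
    have step: "r (insert i I) = jet_move (Some (n, i)) (snd q n $ i - snd p n $ i) (r I)"
      using insert.hyps by (auto simp: r_def jet_move_def fun_eq_iff vec_eq_iff axis_def)
    show ?case
      using jet_const_along[where f = f, OF f(1) z r[of I], of i "snd q n $ i - snd p n $ i"] r[of "insert i I"]
        insert.IH step by simp
  qed
  then have "f p = f (r UNIV)" by simp
  also have "\<dots> = f q"
    by (rule jet_orderD[OF f(2) r q]) (use e in \<open>auto simp: r_def less_Suc_eq\<close>)
  finally show "f p = f q" .
qed

text \<open>The first level that the function itself does not see enters its total derivative
  affinely, with the partial derivatives at the level below as coefficients. Finite differences in
  this level replace a comparison of coefficients.\<close>

lemma total_deriv_move:
  assumes W: "open W" and f: "jet_order W (Suc n) f"
    and p: "p \<in> W" "jet_move (Some (Suc n, i)) s p \<in> W"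
  shows "total_deriv f (jet_move (Some (Suc n, i)) s p) = total_deriv f p + s * jet_deriv (Some (n, i)) f p"
proof -
  let ?r = "jet_move (Some (Suc n, i)) s p"
  have d: "jet_deriv d f ?r = jet_deriv d f p" for d
    by (rule jet_order_move[OF jet_order_deriv[OF W f] p]) simp
  have "(\<Sum>k<Suc n. \<Sum>j\<in>UNIV. snd ?r (Suc k) $ j * jet_deriv (Some (k, j)) f p)
      = (\<Sum>k<Suc n. \<Sum>j\<in>UNIV. snd p (Suc k) $ j * jet_deriv (Some (k, j)) f p)
        + (\<Sum>k<Suc n. \<Sum>j\<in>UNIV. if j = i then (if k = n then s * jet_deriv (Some (k, j)) f p else 0) else 0)"
    unfolding sum.distrib[symmetric]
    by (intro sum.cong HOL.refl) (auto simp: jet_coord_move algebra_simps)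
  also have "(\<Sum>k<Suc n. \<Sum>j\<in>UNIV. if j = i then (if k = n then s * jet_deriv (Some (k, j)) f p else 0) else 0)
      = s * jet_deriv (Some (n, i)) f p"
    by (simp add: sum.delta)
  finally show ?thesis
    unfolding total_deriv_finite[OF W f p(1)] total_deriv_finite[OF W f p(2)] d by simp
qed

lemma small_jet_move:
  assumes "open W" "p \<in> W"
  obtains s where "s \<noteq> 0" "jet_move d s p \<in> W"
proof -
  have "eventually (\<lambda>s. s \<noteq> 0 \<and> jet_move d s p \<in> W) (at 0)"
    unfolding eventually_at_filter
    by (rule eventually_mono[OF eventually_jet_move_in[OF assms, of d]]) simp
  then have "\<exists>s. s \<noteq> 0 \<and> jet_move d s p \<in> W"
    by (rule eventually_happens'[OF at_neq_bot])
  then show ?thesis using that by blast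
qed

text \<open>If the total derivative vanishes, so does its coefficient at the first unseen level;
  hence the order drops until only x remains, and then the x-derivative vanishes too.\<close>

lemma total_deriv_kernel:
  assumes "jet_diff_on (jet_box p0 K e) f" "jet_order (jet_box p0 K e) n f"
    and "\<And>q. q \<in> jet_box p0 K e \<Longrightarrow> total_deriv f q = 0"
    and "p \<in> jet_box p0 K e" "q \<in> jet_box p0 K e"
  shows "f p = f q"
  using assms(2)
proof (induction n)
  case 0
  have D: "jet_deriv None f r = 0" if "r \<in> jet_box p0 K e" for r
    using assms(3)[OF that] total_deriv_finite[OF open_jet_box 0 that] by simp
  let ?r = "jet_move None (fst q - fst p) p"
  have r: "?r \<in> jet_box p0 K e"
    using assms(4,5) by (simp add: jet_box_def jet_move_def)
  have 1: "f ?r = f p"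
    using assms(1) D assms(4) r by (rule jet_const_along)
  have 2: "f ?r = f q"
    by (rule jet_orderD[OF 0 r assms(5)]) (simp_all add: fst_jet_move)
  show ?case using 1 2 by (rule trans[OF sym])
next
  case (Suc n)
  have z: "jet_deriv (Some (n, i)) f r = 0" if r: "r \<in> jet_box p0 K e" for r i
  proof -
    obtain s where s: "s \<noteq> 0" "jet_move (Some (Suc n, i)) s r \<in> jet_box p0 K e"
      using small_jet_move[OF open_jet_box r] by blast
    show ?thesis
      using total_deriv_move[OF open_jet_box Suc.prems r s(2)] s(1)
      unfolding assms(3)[OF r] assms(3)[OF s(2)] by simp
  qed
  have "jet_order (jet_box p0 K e) n f"
    using assms(1) Suc.prems z by (rule jet_order_reduce)
  then show ?case by (rule Suc.IH)
qed

section \<open>Brackets at constant fields\<close>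

definition const_jet :: "real ^ 'n::finite \<Rightarrow> real \<Rightarrow> 'n jet" where
  "const_jet u x = (x, \<lambda>k. if k = 0 then u else 0)"

lemma deriv_shift_0: "deriv (\<lambda>s. F (x + s)) 0 = deriv F x" for F :: "real \<Rightarrow> real"
  unfolding deriv_def using DERIV_shift[of F _ 0 x] by (simp add: add.commute)

lemma jet_deriv_None: "jet_deriv None f (x, w) = deriv (\<lambda>x. f (x, w)) x"
  unfolding jet_deriv_def jet_move_def using deriv_shift_0[of "\<lambda>x. f (x, w)" x] by simp

text \<open>At a constant field all factors \<open>snd p (Suc k)\<close> vanish, and the total
  derivative is the plain derivative along x. As the result again concerns constant jets, the rule
  iterates.\<close>

lemma total_deriv_const_jet: "total_deriv f (const_jet u x) = deriv (\<lambda>x. f (const_jet u x)) x"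
  by (simp add: total_deriv_jet_deriv const_jet_def jet_deriv_None)

lemma total_deriv_pow_const_jet:
  "(total_deriv ^^ k) f (const_jet u x) = (deriv ^^ k) (\<lambda>x. f (const_jet u x)) x"
proof (induction k arbitrary: x)
  case (Suc k)
  then show ?case by (simp add: total_deriv_const_jet)
qed simp

lemma jet_at_const: "jet_at (\<lambda>_. u) x = const_jet u x"
proof -
  have "((\<lambda>v y. vector_derivative v (at y)) ^^ k) (\<lambda>_::real. u) = (if k = 0 then (\<lambda>_. u) else (\<lambda>_. 0))" for k
    by (induction k) auto
  then show ?thesis by (auto simp: jet_at_def const_jet_def fun_eq_iff)
qed

lemma Ck_on_const: "Ck_on k S (\<lambda>_. c)"
  by (induction k arbitrary: c) auto

lemma periodic_field_const: "u \<in> U \<Longrightarrow> periodic_field U (\<lambda>_. u)"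
  by (simp add: periodic_field_def smooth_on_def Ck_on_const)

definition linear_density :: "(nat \<Rightarrow> real \<Rightarrow> real) \<Rightarrow> 'n::finite \<Rightarrow> 'n jet \<Rightarrow> real" where
  "linear_density A i p = A 0 (fst p) * snd p 0 $ i"

text \<open>A smooth function together with its chosen derivatives of all orders, so that
  computations refer to \<open>A n\<close> instead of iterated \<open>deriv\<close>.\<close>

definition derivative_sequence :: "(nat \<Rightarrow> real \<Rightarrow> real) \<Rightarrow> bool" where
  "derivative_sequence A \<longleftrightarrow> (\<forall>n x. (A n has_real_derivative A (Suc n) x) (at x))"

lemma derivative_sequenceD: "derivative_sequence A \<Longrightarrow> (A n has_real_derivative A (Suc n) x) (at x)"
  by (simp add: derivative_sequence_def)

lemma open_jet_over: "open U \<Longrightarrow> open {p :: 'n::finite jet. snd p k \<in> U}"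
  using open_vimage[OF _ continuous_on_jet_snd[of UNIV k], of U] unfolding vimage_def .

lemma local_density_linear:
  assumes "open U" "derivative_sequence A" "\<And>x. A 0 (x + 1) = A 0 x"
  shows "local_density U (linear_density A i)"
proof -
  let ?W = "{p :: 'a jet. snd p 0 \<in> U}"
  have "jet_smooth ?W 1 (\<lambda>p. A 0 (fst p) * snd p 0 $ i)"
  proof (intro jet_smooth_mult jet_smooth_coord open_jet_over assms(1))
    show "jet_smooth ?W 1 (\<lambda>p. A 0 (fst p))"
      unfolding jet_smooth_def
      by (simp add: jet_Ck_on_fst[where A = A, OF derivative_sequenceD[OF assms(2)]] jet_order_def)
  qed auto
  then have "differential_function ?W (linear_density A i)"
    unfolding linear_density_def[abs_def] by (rule jet_smooth_differential_function)
  then show ?thesis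
    unfolding local_density_def by (simp add: linear_density_def assms(3))
qed

lemma euler_linear_density:
  "euler j (linear_density A i) = (\<lambda>p. if j = i then A 0 (fst p) else 0)"
proof
  fix p
  have d: "jet_deriv (Some (k, l)) (linear_density A i) =
    (\<lambda>p. if k = 0 \<and> l = i then A 0 (fst p) else 0)" for k l
  proof
    fix p
    show "jet_deriv (Some (k, l)) (linear_density A i) p = (if k = 0 \<and> l = i then A 0 (fst p) else 0)"
      unfolding linear_density_def[abs_def]
      by (rule jet_deriv_eqI) (auto simp: jet_coord_move fst_jet_move intro!: derivative_eq_intros)
  qed
  have "euler j (linear_density A i) p = (\<Sum>k\<in>{0}. (-1) ^ k * (total_deriv ^^ k)
    (jet_deriv (Some (k, j)) (linear_density A i)) p)"
    unfolding euler_def jet_du_eq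
    by (rule suminf_finite) (auto simp: d)
  then show "euler j (linear_density A i) p = (if j = i then A 0 (fst p) else 0)"
    by (simp add: d)
qed

lemma total_deriv_fst:
  assumes "derivative_sequence A"
  shows "total_deriv (\<lambda>p. if P then A n (fst p) else 0) = (\<lambda>p. if P then A (Suc n) (fst p) else 0)"
proof (cases P)
  case True
  have "jet_deriv d (\<lambda>p. A n (fst p)) p = (if d = None then A (Suc n) (fst p) else 0)"
    for d :: "(nat \<times> 'a) option" and p
  proof (rule jet_deriv_eqI)
    have "((\<lambda>s. A n (fst p + s)) has_real_derivative A (Suc n) (fst p)) (at 0)"
      using derivative_sequenceD[OF assms, of n "fst p"] DERIV_shift[of "A n" _ 0 "fst p"] by
        (simp add: add.commute)
    then show "((\<lambda>s. A n (fst (jet_move d s p))) has_real_derivative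
      (if d = None then A (Suc n) (fst p) else 0)) (at 0)"
      by (auto simp: fst_jet_move)
  qed
  then show ?thesis using True by (auto simp: total_deriv_jet_deriv)
qed simp

lemma inner_op_fst:
  "inner_op 0 g c (\<lambda>j. (\<lambda>p. if j = m then B (fst p) else 0)) i p =
     g (snd p 0) $ i $ m * total_deriv (\<lambda>p. B (fst p)) p
     + (\<Sum>k\<in>UNIV. c (snd p 0) $ i $ m $ k * snd p 1 $ k) * B (fst p)"
proof -
  have "inner_op 0 g c (\<lambda>j. (\<lambda>p. if j = m then B (fst p) else 0)) i p =
    (\<Sum>j\<in>UNIV. if j = m then g (snd p 0) $ i $ m * total_deriv (\<lambda>p. B (fst p)) p
     + (\<Sum>k\<in>UNIV. c (snd p 0) $ i $ m $ k * snd p 1 $ k) * B (fst p) else 0)"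
    unfolding inner_op_def by (intro sum.cong) auto
  then show ?thesis by simp
qed

section \<open>The operator applied to functions of x, and brackets of linear densities\<close>

definition dir_deriv :: "(real ^ 'n::finite \<Rightarrow> 'b::real_normed_vector) \<Rightarrow> 'n \<Rightarrow> real ^ 'n \<Rightarrow> 'b" where
  "dir_deriv f l u = frechet_derivative f (at u) (axis l 1)"

lemma has_vector_derivative_dir:
  assumes "f differentiable (at u)"
  shows "((\<lambda>s. f (u + s *\<^sub>R axis l 1)) has_vector_derivative dir_deriv f l u) (at 0)"
proof -
  have f: "(f has_derivative frechet_derivative f (at u)) (at u)"
    using assms frechet_derivative_works by blast
  have "((\<lambda>s. f (u + s *\<^sub>R axis l 1)) has_derivative (\<lambda>s. frechet_derivative f (at u) (s *\<^sub>R axis l 1))) (at 0)"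
    by (rule has_derivative_compose[where f = "\<lambda>s. u + s *\<^sub>R axis l 1"])
      (use f in \<open>auto intro!: derivative_eq_intros\<close>)
  then show ?thesis
    unfolding has_vector_derivative_def dir_deriv_def
    by (simp add: linear_scale[OF has_derivative_linear[OF f]])
qed

lemma DERIV_vec_nth:
  "(f has_vector_derivative D) F \<Longrightarrow> ((\<lambda>s. f s $ i) has_vector_derivative D $ i) F"
  using bounded_linear.has_vector_derivative[OF bounded_linear_vec_nth] by blast

lemma DERIV_dir1:
  fixes f :: "real ^ 'n::finite \<Rightarrow> real ^ 'm::finite"
  assumes "f differentiable (at u)"
  shows "((\<lambda>s. f (u + s *\<^sub>R axis l 1) $ i) has_real_derivative dir_deriv f l u $ i) (at 0)"
  using DERIV_vec_nth[OF has_vector_derivative_dir[OF assms]]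
  by (simp add: has_real_derivative_iff_has_vector_derivative)

lemma DERIV_dir2:
  fixes f :: "real ^ 'n::finite \<Rightarrow> real ^ 'm::finite ^ 'k::finite"
  assumes "f differentiable (at u)"
  shows "((\<lambda>s. f (u + s *\<^sub>R axis l 1) $ i $ j) has_real_derivative dir_deriv f l u $ i $ j) (at 0)"
  using DERIV_vec_nth[OF DERIV_vec_nth[OF has_vector_derivative_dir[OF assms]]]
  by (simp add: has_real_derivative_iff_has_vector_derivative)

lemma DERIV_dir3:
  fixes f :: "real ^ 'n::finite \<Rightarrow> real ^ 'm::finite ^ 'k::finite ^ 'l::finite"
  assumes "f differentiable (at u)"
  shows "((\<lambda>s. f (u + s *\<^sub>R axis l 1) $ i $ j $ k) has_real_derivative dir_deriv f l u $ i $ j $ k) (at 0)"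
  using DERIV_vec_nth[OF DERIV_vec_nth[OF DERIV_vec_nth[OF has_vector_derivative_dir[OF assms]]]]
  by (simp add: has_real_derivative_iff_has_vector_derivative)

lemma sum_axis:
  fixes v :: "real ^ 'n::finite"
  shows "(\<Sum>k\<in>UNIV. a k * (v + s *\<^sub>R axis l 1) $ k) = (\<Sum>k\<in>UNIV. a k * v $ k) + s * a l"
proof -
  have "a k * (v + s *\<^sub>R axis l 1) $ k = a k * v $ k + (if k = l then s * a l else 0)" for k
    by (simp add: axis_def algebra_simps)
  then show ?thesis by (simp add: sum.distrib)
qed

text \<open>For an argument with single component C(x) at place \<open>m\<close> the operator gives
  D(\<open>g\<^sup>i\<^sup>m\<close> C'' +
  \<open>c\<^sup>i\<^sup>m\<^sub>k u\<^sup>k\<^sub>x\<close> C'). The summands collect the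
  contributions of x, of the field and of its first derivative to this outer D.\<close>

lemma third_order_op_fst:
  fixes g :: "real ^ 'n::finite \<Rightarrow> real ^ 'n ^ 'n"
  assumes "open U" "\<And>u. u \<in> U \<Longrightarrow> g differentiable (at u)" "\<And>u. u \<in> U \<Longrightarrow> c differentiable (at u)"
    and C: "derivative_sequence C" and p: "snd p 0 \<in> U"
  shows "third_order_op g c (\<lambda>j p. if j = m then C 0 (fst p) else 0) i p =
     g (snd p 0) $ i $ m * C 3 (fst p) + (\<Sum>k\<in>UNIV. c (snd p 0) $ i $ m $ k * snd p 1 $ k) * C 2 (fst p)
     + (\<Sum>l\<in>UNIV. snd p 1 $ l * (dir_deriv g l (snd p 0) $ i $ m * C 2 (fst p)
           + (\<Sum>k\<in>UNIV. dir_deriv c l (snd p 0) $ i $ m $ k * snd p 1 $ k) * C 1 (fst p)))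
     + (\<Sum>l\<in>UNIV. snd p 2 $ l * (c (snd p 0) $ i $ m $ l * C 1 (fst p)))"
proof -
  define F where "F p = g (snd p 0) $ i $ m * C 2 (fst p)
     + (\<Sum>k\<in>UNIV. c (snd p 0) $ i $ m $ k * snd p 1 $ k) * C 1 (fst p)" for p :: "'n jet"
  let ?W = "{p :: 'n jet. snd p 0 \<in> U}"
  have t: "total_deriv (\<lambda>p :: 'n jet. C 1 (fst p)) = (\<lambda>p. C 2 (fst p))"
    using total_deriv_fst[where 'a = 'n, OF C, of True 1] by (simp add: numeral_2_eq_2)
  have u: "total_deriv (\<lambda>p :: 'n jet. if j = m then C 0 (fst p) else 0) =
    (\<lambda>p. if j = m then C 1 (fst p) else 0)" for j
    using total_deriv_fst[where 'a = 'n, OF C, of "j = m" 0] by (simp cong: if_cong)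
  have "inner_op 0 g c (\<lambda>j. total_deriv (\<lambda>p. if j = m then C 0 (fst p) else 0)) i = F"
    unfolding F_def[abs_def] u by (rule ext) (simp only: inner_op_fst[of g c m "C 1"] t)
  then have 1: "third_order_op g c (\<lambda>j p. if j = m then C 0 (fst p) else 0) i p = total_deriv F p"
    by (simp add: third_order_op_def)
  have W: "open ?W" "p \<in> ?W" using open_jet_over[OF assms(1)] p by auto
  have "jet_order ?W 2 F"
    by (auto simp: jet_order_def F_def)
  note 2 = total_deriv_finite[OF W(1) this W(2)]
  have CD: "((\<lambda>s. C n (fst p + s)) has_real_derivative C (Suc n) (fst p)) (at 0)" for n
    using derivative_sequenceD[OF C, of n "fst p"] DERIV_shift[of "C n" _ 0 "fst p"] by (simp add: add.commute)
  have "((\<lambda>s. g (snd p 0) $ i $ m * C 2 (fst p + s) + (\<Sum>k\<in>UNIV. c (snd p 0) $ i $ m $ k * snd p 1 $ k) * C 1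
    (fst p + s))
    has_real_derivative g (snd p 0) $ i $ m * C (Suc 2) (fst p)
      + (\<Sum>k\<in>UNIV. c (snd p 0) $ i $ m $ k * snd p 1 $ k) * C (Suc 1) (fst p)) (at 0)"
    by (intro DERIV_add DERIV_cmult CD)
  then have 3: "jet_deriv None F p = g (snd p 0) $ i $ m * C 3 (fst p)
      + (\<Sum>k\<in>UNIV. c (snd p 0) $ i $ m $ k * snd p 1 $ k) * C 2 (fst p)"
    by (intro jet_deriv_eqI) (simp add: F_def jet_move_def numeral_3_eq_3 numeral_2_eq_2)
  have "((\<lambda>s. g (snd p 0 + s *\<^sub>R axis l 1) $ i $ m * C 2 (fst p)
        + (\<Sum>k\<in>UNIV. c (snd p 0 + s *\<^sub>R axis l 1) $ i $ m $ k * snd p 1 $ k) * C 1 (fst p))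
    has_real_derivative dir_deriv g l (snd p 0) $ i $ m * C 2 (fst p)
           + (\<Sum>k\<in>UNIV. dir_deriv c l (snd p 0) $ i $ m $ k * snd p 1 $ k) * C 1 (fst p)) (at 0)" for l
    by (intro DERIV_add DERIV_cmult_right DERIV_sum DERIV_dir2 DERIV_dir3 assms(2,3) p)
  then have 4: "jet_deriv (Some (0, l)) F p = dir_deriv g l (snd p 0) $ i $ m * C 2 (fst p)
           + (\<Sum>k\<in>UNIV. dir_deriv c l (snd p 0) $ i $ m $ k * snd p 1 $ k) * C 1 (fst p)" for l
    by (intro jet_deriv_eqI) (simp add: F_def jet_move_def)
  have 5: "jet_deriv (Some (1, l)) F p = c (snd p 0) $ i $ m $ l * C 1 (fst p)" for l
  proof -
    note s = sum_axis[of "\<lambda>k. c (snd p 0) $ i $ m $ k" "snd p 1" _ l]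
    have "((\<lambda>s. F (jet_move (Some (1, l)) s p)) = (\<lambda>s. g (snd p 0) $ i $ m * C 2 (fst p)
       + ((\<Sum>k\<in>UNIV. c (snd p 0) $ i $ m $ k * snd p 1 $ k) + s * c (snd p 0) $ i $ m $ l) * C 1 (fst p)))"
      unfolding s[symmetric] by (rule ext) (simp add: F_def jet_move_def)
    moreover have "(\<dots> has_real_derivative c (snd p 0) $ i $ m $ l * C 1 (fst p)) (at 0)"
      by (auto intro!: derivative_eq_intros)
    ultimately show ?thesis by (intro jet_deriv_eqI) simp
  qed
  show ?thesis unfolding 1 2 3
    by (simp add: 4 5[simplified] numeral_2_eq_2)
qed

lemma const_jet_simps [simp]:
  "fst (const_jet u x) = x" "snd (const_jet u x) 0 = u" "snd (const_jet u x) (Suc k) = 0"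
  "k \<noteq> 0 \<Longrightarrow> snd (const_jet u x) k = 0"
  by (simp_all add: const_jet_def)

text \<open>The value found in \<open>third_order_op_fst\<close>, named so that it can be evaluated
  on jets that differ from a constant jet at level 0, 1 or 2 only. These are the directions in which
  the Euler operator differentiates it.\<close>

definition third_order_explicit :: "(real ^ 'n::finite \<Rightarrow> real ^ 'n ^ 'n) \<Rightarrow> (real ^ 'n \<Rightarrow> real ^ 'n ^ 'n ^ 'n) \<Rightarrow>
    (nat \<Rightarrow> real \<Rightarrow> real) \<Rightarrow> 'n \<Rightarrow> 'n \<Rightarrow> 'n jet \<Rightarrow> real" where
  "third_order_explicit g c C i m p =
     g (snd p 0) $ i $ m * C 3 (fst p) + (\<Sum>k\<in>UNIV. c (snd p 0) $ i $ m $ k * snd p 1 $ k) * C 2 (fst p)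
     + (\<Sum>l\<in>UNIV. snd p 1 $ l * (dir_deriv g l (snd p 0) $ i $ m * C 2 (fst p)
           + (\<Sum>k\<in>UNIV. dir_deriv c l (snd p 0) $ i $ m $ k * snd p 1 $ k) * C 1 (fst p)))
     + (\<Sum>l\<in>UNIV. snd p 2 $ l * (c (snd p 0) $ i $ m $ l * C 1 (fst p)))"

lemma third_order_explicit_const_jet: "third_order_explicit g c C i m (const_jet u x) = g u $ i $ m * C 3 x"
  by (simp add: third_order_explicit_def)

lemma sum_axis_0:
  fixes a :: "'n::finite \<Rightarrow> real"
  shows "(\<Sum>k\<in>UNIV. a k * (s *\<^sub>R axis l (1::real)) $ k) = s * a l"
    and "(\<Sum>k\<in>UNIV. (s *\<^sub>R axis l (1::real)) $ k * a k) = s * a l"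
  using sum_axis[of a 0 s l] by (simp_all add: mult.commute)

lemma const_jet_move:
  "snd (jet_move (Some (k, l)) s (const_jet u x)) j =
     (if j = 0 then u else 0) + (if j = k then s *\<^sub>R axis l 1 else 0)"
  "fst (jet_move (Some (k, l)) s (const_jet u x)) = x"
  by (auto simp: jet_move_def const_jet_def)

lemma third_order_explicit_move_0:
  "third_order_explicit g c C i m (jet_move (Some (0, l)) s (const_jet u x)) = g
    (u + s *\<^sub>R axis l 1) $ i $ m * C 3 x"
  by (simp add: third_order_explicit_def const_jet_move)

lemma third_order_explicit_move_1:
  "third_order_explicit g c C i m (jet_move (Some (1, l)) s (const_jet u x)) =
     g u $ i $ m * C 3 x + s * (c u $ i $ m $ l * C 2 x) + s * (dir_deriv g l u $ i $ m * C 2 x)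
     + s * s * (dir_deriv c l u $ i $ m $ l * C 1 x)"
  by (simp add: third_order_explicit_def const_jet_move sum_axis_0 del: vector_scaleR_component)
    (simp add: algebra_simps)

lemma third_order_explicit_move_2:
  "third_order_explicit g c C i m (jet_move (Some (2, l)) s (const_jet u x)) =
     g u $ i $ m * C 3 x + s * (c u $ i $ m $ l * C 1 x)"
  by (simp add: third_order_explicit_def const_jet_move sum_axis_0 del: vector_scaleR_component)

lemma bracket_linear_density:
  fixes g :: "real ^ 'n::finite \<Rightarrow> real ^ 'n ^ 'n"
  assumes "open U" "\<And>u. u \<in> U \<Longrightarrow> g differentiable (at u)" "\<And>u. u \<in> U \<Longrightarrow> c differentiable (at u)"
    and "derivative_sequence C" "snd p 0 \<in> U"
  shows "bracket g c f (linear_density C m) p = (\<Sum>i\<in>UNIV. euler i f p * third_order_explicit g c C i m p)"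
proof -
  have "third_order_op g c (\<lambda>j p. if j = m then C 0 (fst p) else 0) i p
    = third_order_explicit g c C i m p" for i
    unfolding third_order_explicit_def using assms by (rule third_order_op_fst)
  then show ?thesis unfolding bracket_def euler_linear_density by simp
qed

text \<open>The density is A (g B''' + ...) and has jet levels 0, 1, 2, so three terms of the Euler
  operator occur: A dg B''' - ((c + dg) A B'')' + (c A B')''. The terms with undifferentiated A
  cancel, and the stated two remain.\<close>

lemma euler_bracket_linear_density:
  fixes g :: "real ^ 'n::finite \<Rightarrow> real ^ 'n ^ 'n"
  assumes U: "open U" "\<And>u. u \<in> U \<Longrightarrow> g differentiable (at u)" "\<And>u. u \<in> U \<Longrightarrow> c differentiable (at u)"
    and A: "derivative_sequence A" and B: "derivative_sequence B" and u: "u \<in> U"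
  shows "euler l (bracket g c (linear_density A i) (linear_density B j)) (const_jet u x) =
     c u $ i $ j $ l * (A 2 x * B 1 x) - (dir_deriv g l u $ i $ j - c u $ i $ j $ l) * (A 1 x * B 2 x)"
proof -
  let ?W = "{p :: 'n jet. snd p 0 \<in> U}"
  let ?F = "bracket g c (linear_density A i) (linear_density B j)"
  have W: "open ?W" "const_jet u x \<in> ?W" for x using open_jet_over[OF U(1)] u by auto
  have F: "?F p = A 0 (fst p) * third_order_explicit g c B i j p" if "p \<in> ?W" for p
  proof -
    have "?F p = (\<Sum>k\<in>UNIV. if k = i then A 0 (fst p) * third_order_explicit g c B i j p else 0)"
      unfolding bracket_linear_density[OF U B, of p, simplified, OF that[simplified]]
      by (intro sum.cong) (auto simp: euler_linear_density)
    then show ?thesis by simp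
  qed
  have o: "jet_order ?W 3 ?F"
    unfolding jet_order_def
  proof (intro ballI impI)
    fix p q :: "'n jet"
    assume pq: "p \<in> ?W" "q \<in> ?W" "fst p = fst q" "\<forall>k<3. snd p k = snd q k"
    then have "snd p 0 = snd q 0" "snd p 1 = snd q 1" "snd p 2 = snd q 2" by auto
    then show "?F p = ?F q" unfolding F[OF pq(1)] F[OF pq(2)] third_order_explicit_def pq(3) by simp
  qed
  have J: "jet_deriv d ?F (const_jet u x) = jet_deriv d (\<lambda>p. A 0 (fst p) * third_order_explicit g c B i j p)
    (const_jet u x)" for d x
    by (rule jet_deriv_cong[OF W F])
  have D0: "jet_deriv (Some (0, l)) ?F (const_jet u x) = A 0 x * (dir_deriv g l u $ i $ j * B 3 x)" for x
    unfolding J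
    by (rule jet_deriv_eqI, unfold third_order_explicit_move_0 const_jet_move)
      (intro DERIV_cmult DERIV_cmult_right DERIV_dir2 U u)
  have D1: "jet_deriv (Some (1, l)) ?F (const_jet u x) = (c u $ i $ j $ l + dir_deriv g l u $ i $ j) *
    (A 0 x * B 2 x)" for x
    unfolding J
    by (rule jet_deriv_eqI, unfold third_order_explicit_move_1 const_jet_move)
      (auto intro!: derivative_eq_intros simp: algebra_simps)
  have D2: "jet_deriv (Some (2, l)) ?F (const_jet u x) = c u $ i $ j $ l * (A 0 x * B 1 x)" for x
    unfolding J
    by (rule jet_deriv_eqI, unfold third_order_explicit_move_2 const_jet_move)
      (auto intro!: derivative_eq_intros simp: algebra_simps)
  note d = derivative_sequenceD[OF A, simplified] derivative_sequenceD[OF B, simplified]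
  have d1: "deriv (\<lambda>x. r * (A n x * B m x)) = (\<lambda>x. r * (A (Suc n) x * B m x + A n x * B (Suc m) x))" for r n m
    by (rule ext, rule DERIV_imp_deriv) (auto intro!: derivative_eq_intros d simp: algebra_simps)
  have d2: "deriv (\<lambda>x. r * (A 1 x * B 1 x + A 0 x * B 2 x)) =
      (\<lambda>x. r * (A 2 x * B 1 x + 2 * (A 1 x * B 2 x) + A 0 x * B 3 x))" for r
    by (rule ext, rule DERIV_imp_deriv)
      (auto intro!: derivative_eq_intros d simp: algebra_simps numeral_2_eq_2 numeral_3_eq_3)
  have "euler l ?F (const_jet u x) = (\<Sum>k<3. (-1) ^ k * (deriv ^^ k)
    (\<lambda>x. jet_deriv (Some (k, l)) ?F (const_jet u x)) x)"
    unfolding euler_finite[OF W(1) o W(2)] total_deriv_pow_const_jet ..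
  also have "\<dots> = A 0 x * (dir_deriv g l u $ i $ j * B 3 x)
      - deriv (\<lambda>x. (c u $ i $ j $ l + dir_deriv g l u $ i $ j) * (A 0 x * B 2 x)) x
      + deriv (deriv (\<lambda>x. c u $ i $ j $ l * (A 0 x * B 1 x))) x"
    using D1 D2 by (simp add: numeral_3_eq_3 D0 numeral_2_eq_2)
  also have "deriv (\<lambda>x. c u $ i $ j $ l * (A 0 x * B 1 x)) =
    (\<lambda>x. c u $ i $ j $ l * (A 1 x * B 1 x + A 0 x * B 2 x))"
    unfolding d1 by (simp add: numeral_2_eq_2)
  finally show ?thesis unfolding d1 d2
    by (simp add: algebra_simps numeral_3_eq_3 numeral_2_eq_2)
qed

text \<open>At a constant field the outer operator reduces to g C''', so that the derivatives of c
  contribute nothing and only first derivatives of g remain.\<close>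

lemma bracket_bracket_linear_density:
  fixes g :: "real ^ 'n::finite \<Rightarrow> real ^ 'n ^ 'n"
  assumes U: "open U" "\<And>u. u \<in> U \<Longrightarrow> g differentiable (at u)" "\<And>u. u \<in> U \<Longrightarrow> c differentiable (at u)"
    and A: "derivative_sequence A" and B: "derivative_sequence B" and C: "derivative_sequence C" and u: "u \<in> U"
  shows "bracket g c (bracket g c (linear_density A i) (linear_density B j)) (linear_density C m)
    (const_jet u x) =
     (\<Sum>l\<in>UNIV. c u $ i $ j $ l * g u $ l $ m) * (A 2 x * B 1 x * C 3 x)
     - (\<Sum>l\<in>UNIV. (dir_deriv g l u $ i $ j - c u $ i $ j $ l) * g u $ l $ m) * (A 1 x * B 2 x * C 3 x)"
proof -
  have "bracket g c (bracket g c (linear_density A i) (linear_density B j)) (linear_density C m)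
    (const_jet u x) =
     (\<Sum>l\<in>UNIV. (c u $ i $ j $ l * (A 2 x * B 1 x) - (dir_deriv g l u $ i $ j - c u $ i $ j $ l) *
       (A 1 x * B 2 x))
        * (g u $ l $ m * C 3 x))"
    by (subst bracket_linear_density[OF U C])
      (simp_all add: u euler_bracket_linear_density[OF U A B u] third_order_explicit_const_jet)
  also have "\<dots> = (\<Sum>l\<in>UNIV. c u $ i $ j $ l * g u $ l $ m * (A 2 x * B 1 x * C 3 x)
      - (dir_deriv g l u $ i $ j - c u $ i $ j $ l) * g u $ l $ m * (A 1 x * B 2 x * C 3 x))"
    by (rule sum.cong[OF HOL.refl]) algebra
  finally show ?thesis by (simp add: sum_subtractf sum_distrib_right)
qed

section \<open>Trigonometric test functions and their resonance integrals\<close>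

text \<open>\<open>harmonic k n\<close> is the \<open>n\<close>-th derivative of \<open>cos (2 \<pi> k x)\<close>.\<close>

definition harmonic :: "nat \<Rightarrow> nat \<Rightarrow> real \<Rightarrow> real" where
  "harmonic k n x = (2 * pi * real k) ^ n * cos (2 * pi * real k * x + real n * (pi / 2))"

lemma derivative_sequence_harmonic: "derivative_sequence (harmonic k)"
  unfolding derivative_sequence_def harmonic_def[abs_def]
proof (intro allI)
  fix n x
  have "cos (2 * pi * real k * x + real (Suc n) * (pi / 2)) = - sin (2 * pi * real k * x + real n * (pi / 2))"
  proof -
    have "2 * pi * real k * x + real (Suc n) * (pi / 2) = (2 * pi * real k * x + real n * (pi / 2)) + pi / 2"
      by (simp add: field_simps)
    then show ?thesis by (simp only: cos_add cos_pi_half sin_pi_half)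
  qed
  then show "((\<lambda>x. (2 * pi * real k) ^ n * cos (2 * pi * real k * x + real n * (pi / 2))) has_real_derivative
     (2 * pi * real k) ^ Suc n * cos (2 * pi * real k * x + real (Suc n) * (pi / 2))) (at x)"
    by (auto intro!: derivative_eq_intros simp del: of_nat_Suc)
qed

lemma harmonic_periodic: "harmonic k 0 (x + 1) = harmonic k 0 x"
proof -
  have "cos (2 * pi * real k * x + 2 * pi * real k) = cos (2 * pi * real k * x)"
    using sin_cos_eq_iff[of "2 * pi * real k * x + 2 * pi * real k" "2 * pi * real k * x"]
    by (auto intro!: exI[of _ "int k"])
  then show ?thesis by (simp add: harmonic_def algebra_simps)
qed

lemma harmonic_simps:
  "harmonic k 1 x = - (2 * pi * real k) * sin (2 * pi * real k * x)"
  "harmonic k 2 x = - ((2 * pi * real k) ^ 2 * cos (2 * pi * real k * x))"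
  "harmonic k 3 x = (2 * pi * real k) ^ 3 * sin (2 * pi * real k * x)"
proof -
  have 3: "cos (y + pi / 2 * 3) = sin y" for y :: real
    using cos_add[of "y + pi" "pi / 2"] by (simp add: algebra_simps)
  show "harmonic k 1 x = - (2 * pi * real k) * sin (2 * pi * real k * x)"
    by (simp add: harmonic_def cos_add)
  show "harmonic k 2 x = - ((2 * pi * real k) ^ 2 * cos (2 * pi * real k * x))"
    by (simp add: harmonic_def)
  show "harmonic k 3 x = (2 * pi * real k) ^ 3 * sin (2 * pi * real k * x)"
    using 3[of "2 * pi * real k * x"] by (simp add: harmonic_def mult.commute)
qed

lemma has_integral_cos_period:
  assumes "k \<noteq> 0"
  shows "((\<lambda>x. cos (2 * pi * real_of_int k * x)) has_integral 0) {0..1}"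
proof -
  let ?F = "\<lambda>x. sin (2 * pi * real_of_int k * x) / (2 * pi * real_of_int k)"
  have "((\<lambda>x. cos (2 * pi * real_of_int k * x)) has_integral ?F 1 - ?F 0) {0..1}"
    by (rule fundamental_theorem_of_calculus)
      (use assms in \<open>auto intro!: derivative_eq_intros simp flip:
        has_real_derivative_iff_has_vector_derivative\<close>)
  moreover have "sin (2 * pi * real_of_int k) = 0"
    by (simp add: sin_zero_iff_int2)
  ultimately show ?thesis by simp
qed

text \<open>The third frequency is the sum of the first two. This resonance makes the product a
  constant 1/4 plus cosines of nonzero frequency, whose integrals over a period vanish.\<close>

lemma has_integral_cos_sin_sin:
  assumes "0 < k1" "0 < k2"
  shows "((\<lambda>x. cos (2 * pi * real k1 * x) * sin (2 * pi * real k2 * x) * sin (2 * pi * real (k1 + k2) * x))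
    has_integral 1 / 4) {0..1}"
proof -
  let ?C = "\<lambda>k x. cos (2 * pi * real_of_int k * x)"
  have "((\<lambda>x. 1 / 4 + (?C (2 * int k1) x * (1 / 4) - ?C (2 * int k2) x * (1 / 4) - ?C
    (2 * (int k1 + int k2)) x * (1 / 4)))
      has_integral 1 / 4 + (0 * (1 / 4) - 0 * (1 / 4) - 0 * (1 / 4))) {0..1}"
    using assms has_integral_const_real[of "1 / 4 :: real" 0 1]
    by (intro has_integral_add has_integral_diff has_integral_mult_left has_integral_cos_period) auto
  moreover have "cos (2 * pi * real k1 * x) * sin (2 * pi * real k2 * x) * sin (2 * pi * real (k1 + k2) * x)
     = 1 / 4 + (?C (2 * int k1) x * (1 / 4) - ?C (2 * int k2) x * (1 / 4) - ?C (2 * (int k1 + int k2)) x *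
       (1 / 4))" for x
  proof -
    define a b where "a = 2 * pi * real k1 * x" and "b = 2 * pi * real k2 * x"
    have 1: "2 * pi * real (k1 + k2) * x = a + b" "2 * pi * real_of_int (2 * int k1) * x = 2 * a"
      "2 * pi * real_of_int (2 * int k2) * x = 2 * b" "2 * pi * real_of_int (2 * (int k1 + int k2)) * x
        = 2 * a + 2 * b"
      by (simp_all add: a_def b_def algebra_simps)
    have ss: "sin a ^ 2 = 1 - cos a ^ 2" "sin b ^ 2 = 1 - cos b ^ 2"
      by (simp_all add: sin_squared_eq)
    have "cos a * sin b * (sin a * cos b + cos a * sin b) =
      1 / 4 + ((cos a ^ 2 - sin a ^ 2) * (1 / 4) - (cos b ^ 2 - sin b ^ 2) * (1 / 4)
        - ((cos a ^ 2 - sin a ^ 2) * (cos b ^ 2 - sin b ^ 2) - (2 * sin a * cos a) * (2 * sin b * cos b)) *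
          (1 / 4))"
      using ss by algebra
    then show ?thesis
      unfolding 1 a_def[symmetric] b_def[symmetric] sin_add cos_add[of "2 * a"] cos_double sin_double .
  qed
  ultimately show ?thesis by simp
qed

lemma has_integral_sin_sin_cos:
  assumes "0 < k1" "0 < k2"
  shows "((\<lambda>x. sin (2 * pi * real k1 * x) * sin (2 * pi * real k2 * x) * cos (2 * pi * real (k1 + k2) * x))
    has_integral - (1 / 4)) {0..1}"
proof -
  let ?f = "\<lambda>x. cos (2 * pi * real k1 * x) * sin (2 * pi * real k2 * x) * sin (2 * pi * real (k1 + k2) * x)"
  \<comment> \<open>With a, b the two arguments, sin a cos (a + b) = cos a sin (a + b) - sin b, so
    the integrand is the previous one minus sin^2 b, of mean 1/2.\<close>
  have "((\<lambda>x. ?f x - (1 / 2 - cos (2 * pi * real_of_int (2 * int k2) * x) * (1 / 2)))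
      has_integral 1 / 4 - (1 / 2 - 0 * (1 / 2))) {0..1}"
    using assms has_integral_const_real[of "1 / 2 :: real" 0 1]
    by (intro has_integral_diff has_integral_mult_left has_integral_cos_period has_integral_cos_sin_sin) auto
  moreover have "sin (2 * pi * real k1 * x) * sin (2 * pi * real k2 * x) * cos (2 * pi * real (k1 + k2) * x)
     = ?f x - (1 / 2 - cos (2 * pi * real_of_int (2 * int k2) * x) * (1 / 2))" for x
  proof -
    define a b where "a = 2 * pi * real k1 * x" and "b = 2 * pi * real k2 * x"
    have 1: "2 * pi * real (k1 + k2) * x = a + b" "2 * pi * real_of_int (2 * int k2) * x = 2 * b"
      by (simp_all add: a_def b_def algebra_simps)
    have ss: "sin a ^ 2 = 1 - cos a ^ 2" "sin b ^ 2 = 1 - cos b ^ 2"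
      by (simp_all add: sin_squared_eq)
    have "sin a * sin b * (cos a * cos b - sin a * sin b) =
      cos a * sin b * (sin a * cos b + cos a * sin b) - (1 / 2 - (cos b ^ 2 - sin b ^ 2) * (1 / 2))"
      using ss by algebra
    then show ?thesis
      unfolding 1 a_def[symmetric] b_def[symmetric] cos_add sin_add cos_double .
  qed
  ultimately show ?thesis by simp
qed

section \<open>The Jacobi identity at constant fields\<close>

text \<open>The digits in the name are the orders of differentiation; they add up to the exponent 6
  of 2 pi, and the two minus signs of orders 1 and 2 cancel.\<close>

lemma has_integral_harmonic_213:
  assumes "((\<lambda>x. cos (2 * pi * real a * x) * sin (2 * pi * real b * x) * sin (2 * pi * real d * x))
    has_integral r) {0..1}"
  shows "((\<lambda>x. harmonic a 2 x * harmonic b 1 x * harmonic d 3 x) has_integral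
    ((2 * pi) ^ 6 * (real a ^ 2 * real b * real d ^ 3)) * r) {0..1}"
  by (rule has_integral_eq[OF _ has_integral_mult_right[OF assms]]) (simp only: harmonic_simps, algebra)

lemma has_integral_harmonic_123:
  assumes "((\<lambda>x. sin (2 * pi * real a * x) * cos (2 * pi * real b * x) * sin (2 * pi * real d * x))
    has_integral r) {0..1}"
  shows "((\<lambda>x. harmonic a 1 x * harmonic b 2 x * harmonic d 3 x) has_integral
    ((2 * pi) ^ 6 * (real a * real b ^ 2 * real d ^ 3)) * r) {0..1}"
  by (rule has_integral_eq[OF _ has_integral_mult_right[OF assms]]) (simp only: harmonic_simps, algebra)

lemma functional_bracket_bracket_harmonic:
  fixes g :: "real ^ 'n::finite \<Rightarrow> real ^ 'n ^ 'n"
  assumes U: "open U" "\<And>u. u \<in> U \<Longrightarrow> g differentiable (at u)" "\<And>u. u \<in> U \<Longrightarrow> c differentiable (at u)"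
    and u: "u \<in> U"
    and r: "((\<lambda>x. cos (2 * pi * real a * x) * sin (2 * pi * real b * x) * sin (2 * pi * real d * x))
      has_integral r) {0..1}"
    and s: "((\<lambda>x. sin (2 * pi * real a * x) * cos (2 * pi * real b * x) * sin (2 * pi * real d * x))
      has_integral s) {0..1}"
  shows "functional (bracket g c (bracket g c (linear_density (harmonic a) i) (linear_density (harmonic b) j))
       (linear_density (harmonic d) m)) (\<lambda>_. u) =
     (\<Sum>l\<in>UNIV. c u $ i $ j $ l * g u $ l $ m) * (((2 * pi) ^ 6 * (real a ^ 2 * real b * real d ^ 3)) * r)
     - (\<Sum>l\<in>UNIV. (dir_deriv g l u $ i $ j - c u $ i $ j $ l) * g u $ l $ m)
        * (((2 * pi) ^ 6 * (real a * real b ^ 2 * real d ^ 3)) * s)"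
proof -
  have "bracket g c (bracket g c (linear_density (harmonic a) i) (linear_density (harmonic b) j))
       (linear_density (harmonic d) m) (const_jet u x) =
     (\<Sum>l\<in>UNIV. c u $ i $ j $ l * g u $ l $ m) * (harmonic a 2 x * harmonic b 1 x * harmonic d 3 x)
     - (\<Sum>l\<in>UNIV. (dir_deriv g l u $ i $ j - c u $ i $ j $ l) * g u $ l $ m)
        * (harmonic a 1 x * harmonic b 2 x * harmonic d 3 x)" for x
    using U derivative_sequence_harmonic derivative_sequence_harmonic derivative_sequence_harmonic u by
      (rule bracket_bracket_linear_density)
  then show ?thesis
    unfolding functional_def jet_at_const
    by (simp only:) (intro integral_unique has_integral_diff has_integral_mult_right
      has_integral_harmonic_213[OF r] has_integral_harmonic_123[OF s])
qed

text \<open>The Jacobi identity for the densities \<open>u\<^sup>i cos (2 \<pi> k\<^sub>1 x)\<close>, \<open>u\<^sup>j cos (2 \<pi> k\<^sub>2 x)\<close> and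
  \<open>u\<^sup>m cos (2 \<pi> (k\<^sub>1 + k\<^sub>2) x)\<close> at the constant field \<open>u\<close>, where only first derivatives of the
  coefficients survive.\<close>

lemma jacobi_at_constant_field:
  fixes g :: "real ^ 'n::finite \<Rightarrow> real ^ 'n ^ 'n"
  assumes U: "open U" "\<And>u. u \<in> U \<Longrightarrow> g differentiable (at u)" "\<And>u. u \<in> U \<Longrightarrow> c differentiable (at u)"
    and u: "u \<in> U" and H: "hamiltonian_operator U g c"
    and T: "\<And>i j m. T i j m = (\<Sum>l\<in>UNIV. c u $ i $ j $ l * g u $ l $ m)"
    and S: "\<And>i j m. S i j m = (\<Sum>l\<in>UNIV. (dir_deriv g l u $ i $ j - c u $ i $ j $ l) * g u $ l $ m)"
    and k: "0 < k1" "0 < k2" and x: "x = real k1" and y: "y = real k2"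
  shows "x * (x + y) ^ 2 * T i j m - y * (x + y) ^ 2 * S i j m + y * x ^ 2 * T j m i
     + (x + y) * x ^ 2 * S j m i - (x + y) * y ^ 2 * T m i j - x * y ^ 2 * S m i j = 0"
proof -
  let ?A = "linear_density (harmonic k1) i" and ?B = "linear_density (harmonic k2) j"
    and ?C = "linear_density (harmonic (k1 + k2)) m"
  let ?br = "bracket g c"
  note ld = local_density_linear[OF U(1) derivative_sequence_harmonic harmonic_periodic]
  have "functional (?br (?br ?A ?B) ?C) (\<lambda>_. u) + functional (?br (?br ?B ?C) ?A) (\<lambda>_. u)
      + functional (?br (?br ?C ?A) ?B) (\<lambda>_. u) = 0"
    using H ld periodic_field_const[OF u] unfolding hamiltonian_operator_def by blast
  moreover
  \<comment> \<open>In each cyclic term the cosine sits on the factor of derivative order 2. The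
    integral is -1/4 when that factor has the frequency \<open>k1 + k2\<close>, and 1/4
    otherwise.\<close>
  note css = has_integral_cos_sin_sin[OF k] has_integral_cos_sin_sin[OF k(2,1)]
    and ssc = has_integral_sin_sin_cos[OF k]
  have "functional (?br (?br ?A ?B) ?C) (\<lambda>_. u) =
     T i j m * (((2 * pi) ^ 6 * (real k1 ^ 2 * real k2 * real (k1 + k2) ^ 3)) * (1 / 4))
     - S i j m * (((2 * pi) ^ 6 * (real k1 * real k2 ^ 2 * real (k1 + k2) ^ 3)) * (1 / 4))"
    unfolding T S
    by (rule functional_bracket_bracket_harmonic[OF U u])
      (use css in \<open>simp_all add: mult_ac add_ac\<close>)
  moreover have "functional (?br (?br ?B ?C) ?A) (\<lambda>_. u) =
     T j m i * (((2 * pi) ^ 6 * (real k2 ^ 2 * real (k1 + k2) * real k1 ^ 3)) * (1 / 4))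
     - S j m i * (((2 * pi) ^ 6 * (real k2 * real (k1 + k2) ^ 2 * real k1 ^ 3)) * - (1 / 4))"
    unfolding T S
    by (rule functional_bracket_bracket_harmonic[OF U u])
      (use css ssc in \<open>simp_all add: mult_ac add_ac\<close>)
  moreover have "functional (?br (?br ?C ?A) ?B) (\<lambda>_. u) =
     T m i j * (((2 * pi) ^ 6 * (real (k1 + k2) ^ 2 * real k1 * real k2 ^ 3)) * - (1 / 4))
     - S m i j * (((2 * pi) ^ 6 * (real (k1 + k2) * real k1 ^ 2 * real k2 ^ 3)) * (1 / 4))"
    unfolding T S
    by (rule functional_bracket_bracket_harmonic[OF U u])
      (use css ssc in \<open>simp_all add: mult_ac add_ac\<close>)
  ultimately have "((2 * pi) ^ 6 * (x * y * (x + y)) * (1 / 4)) *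
    (x * (x + y) ^ 2 * T i j m - y * (x + y) ^ 2 * S i j m + y * x ^ 2 * T j m i
     + (x + y) * x ^ 2 * S j m i - (x + y) * y ^ 2 * T m i j - x * y ^ 2 * S m i j) = 0"
    unfolding x y of_nat_add by algebra
  moreover have "(2 * pi) ^ 6 * (x * y * (x + y)) * (1 / 4) \<noteq> 0"
    using k unfolding x y by simp
  ultimately show ?thesis by simp
qed

text \<open>The Jacobi identity is a binary cubic form in the frequencies x, y. Four pairwise
  non-proportional frequency pairs force its four coefficients to vanish. Those of x^3 and y^3
  express S by T; the coefficient of x^2 y then becomes the cyclic sum of T.\<close>

lemma jacobi_relations:
  fixes g :: "real ^ 'n::finite \<Rightarrow> real ^ 'n ^ 'n"
  assumes U: "open U" "\<And>u. u \<in> U \<Longrightarrow> g differentiable (at u)" "\<And>u. u \<in> U \<Longrightarrow> c differentiable (at u)"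
    and u: "u \<in> U" and H: "hamiltonian_operator U g c"
    and T: "\<And>i j m. T i j m = (\<Sum>l\<in>UNIV. c u $ i $ j $ l * g u $ l $ m)"
  shows "(\<Sum>l\<in>UNIV. dir_deriv g l u $ i $ j * g u $ l $ m) = T i j m - T m i j"
    and "T i j m + T j m i + T m i j = 0"
proof -
  define S where "S i j m = (\<Sum>l\<in>UNIV. (dir_deriv g l u $ i $ j - c u $ i $ j $ l) * g u $ l $ m)" for i j m
  note J = jacobi_at_constant_field[OF U u H T S_def]
  have 1: "4 * T i j m - 4 * S i j m + T j m i + 2 * S j m i - 2 * T m i j - S m i j = 0" for i j m
    using J[of 1 1 1 1 i j m] by simp
  have 2: "9 * T i j m - 18 * S i j m + 2 * T j m i + 3 * S j m i - 12 * T m i j - 4 * S m i j = 0" for i j m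
    using J[of 1 2 1 2 i j m] by simp
  have 3: "18 * T i j m - 9 * S i j m + 4 * T j m i + 12 * S j m i - 3 * T m i j - 2 * S m i j = 0" for i j m
    using J[of 2 1 2 1 i j m] by simp
  have 4: "16 * T i j m - 48 * S i j m + 3 * T j m i + 4 * S j m i - 36 * T m i j - 9 * S m i j = 0" for i j m
    using J[of 1 3 1 3 i j m] by simp
  \<comment> \<open>This is the vanishing coefficient of y^3.\<close>
  have 5: "S i j m = - T m i j" 
    using 1[of i j m] 2[of i j m] 3[of i j m] 4[of i j m] by linarith
  show "(\<Sum>l\<in>UNIV. dir_deriv g l u $ i $ j * g u $ l $ m) = T i j m - T m i j"
    using 5 by (simp add: S_def T left_diff_distrib sum_subtractf)
  show "T i j m + T j m i + T m i j = 0"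
    using 1[of i j m] 2[of i j m] 3[of i j m] 4[of i j m] by linarith
qed

lemma cramer_2:
  fixes X Y :: real
  assumes "X * a + Y * b = p" "X * b + Y * d = q"
  shows "X * (a * d - b ^ 2) = p * d - q * b" "Y * (a * d - b ^ 2) = q * a - p * b"
proof -
  show "X * (a * d - b ^ 2) = p * d - q * b" unfolding assms[symmetric] by algebra
  show "Y * (a * d - b ^ 2) = q * a - p * b" unfolding assms[symmetric] by algebra
qed

text \<open>With \<open>\<epsilon>\<close> skew and \<open>\<epsilon>\<^sub>1\<^sub>2 = 1\<close>: \<open>c\<^sup>i\<^sup>m\<^sub>l = C\<^sup>m g\<^sup>i\<^sup>k \<epsilon>\<^sub>k\<^sub>l\<close>, which is \<open>c\<^sub>m\<^sub>p\<^sub>k = - c\<^sub>m\<^sub>k\<^sub>p\<close> for two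
  components, and \<open>g\<^sup>i\<^sup>j\<^sub>,\<^sub>l = c\<^sup>i\<^sup>j\<^sub>l + c\<^sup>j\<^sup>i\<^sub>l\<close>.\<close>

definition monge_at :: "(real ^ 2 \<Rightarrow> real ^ 2 ^ 2) \<Rightarrow> (real ^ 2 \<Rightarrow> real ^ 2 ^ 2 ^ 2) \<Rightarrow> real ^ 2 \<Rightarrow>
  (2 \<Rightarrow> real) \<Rightarrow> bool" where
  "monge_at g c u C \<longleftrightarrow>
    (\<forall>i. c u $ 1 $ i $ 1 = - C i * g u $ 1 $ 2 \<and> c u $ 1 $ i $ 2 = C i * g u $ 1 $ 1 \<and>
      c u $ 2 $ i $ 1 = - C i * g u $ 2 $ 2 \<and> c u $ 2 $ i $ 2 = C i * g u $ 1 $ 2) \<and>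
    dir_deriv g 1 u $ 1 $ 1 = - 2 * C 1 * g u $ 1 $ 2 \<and> dir_deriv g 2 u $ 1 $ 1 = 2 * C 1 * g u $ 1 $ 1 \<and>
    dir_deriv g 1 u $ 1 $ 2 = - C 1 * g u $ 2 $ 2 - C 2 * g u $ 1 $ 2 \<and> dir_deriv g 2 u $ 1 $ 2
      = C 1 * g u $ 1 $ 2 + C 2 * g u $ 1 $ 1 \<and>
    dir_deriv g 1 u $ 2 $ 2 = - 2 * C 2 * g u $ 2 $ 2 \<and> dir_deriv g 2 u $ 2 $ 2 = 2 * C 2 * g u $ 1 $ 2"

text \<open>For \<open>T i j m\<close>, the tensor c with its last index raised by g, the cyclic
  relation and the symmetry of g in the derivative relation make T skew in its outer indices. For
  two components such a T is determined by \<open>T 1 i 2\<close>, and lowering the last index again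
  by Cramer's rule gives the stated form.\<close>

lemma monge_structure:
  fixes g :: "real ^ 2 \<Rightarrow> real ^ 2 ^ 2" and c :: "real ^ 2 \<Rightarrow> real ^ 2 ^ 2 ^ 2"
  assumes U: "open U" "\<And>u. u \<in> U \<Longrightarrow> g differentiable (at u)" "\<And>u. u \<in> U \<Longrightarrow> c differentiable (at u)"
    and g: "nondegenerate_metric U g" and u: "u \<in> U" and H: "hamiltonian_operator U g c"
    and D: "\<And>u. D u = g u $ 1 $ 1 * g u $ 2 $ 2 - g u $ 1 $ 2 ^ 2"
  shows "\<exists>C. monge_at g c u C"
proof -
  have sym: "g v $ 2 $ 1 = g v $ 1 $ 2" if "v \<in> U" for v
  proof -
    have "transpose (g v) = g v" using g that by (auto simp: nondegenerate_metric_def)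
    then have "transpose (g v) $ 1 $ 2 = g v $ 1 $ 2" by simp
    then show ?thesis by (simp add: transpose_def)
  qed
  have D0: "D u \<noteq> 0"
    using g u sym[OF u] by (auto simp: nondegenerate_metric_def det_2 D power2_eq_square)
  have dsym: "dir_deriv g l u $ 2 $ 1 = dir_deriv g l u $ 1 $ 2" for l
  proof -
    have "open ((\<lambda>s. u + s *\<^sub>R axis l 1) -` U)" for l :: 2
      by (rule open_vimage[OF U(1)]) (auto intro!: continuous_intros)
    then have "eventually (\<lambda>s. u + s *\<^sub>R axis l 1 \<in> U) (nhds 0)"
      unfolding eventually_nhds using u by (intro exI[of _ "(\<lambda>s. u + s *\<^sub>R axis l 1) -` U"]) simp
    then have "eventually (\<lambda>s. g (u + s *\<^sub>R axis l 1) $ 1 $ 2 = g (u + s *\<^sub>R axis l 1) $ 2 $ 1) (nhds 0)"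
      by eventually_elim (simp add: sym)
    then have "((\<lambda>s. g (u + s *\<^sub>R axis l 1) $ 2 $ 1) has_real_derivative dir_deriv g l u $ 1 $ 2) (at 0)"
      using DERIV_dir2[OF U(2)[OF u], of l 1 2] by (subst (asm) DERIV_cong_ev) auto
    from DERIV_unique[OF this DERIV_dir2[OF U(2)[OF u], of l 2 1]] show ?thesis by simp
  qed
  define T where "T i j m = (\<Sum>l\<in>UNIV. c u $ i $ j $ l * g u $ l $ m)" for i j m
  note R = jacobi_relations[OF U u H T_def]
  have G: "dir_deriv g 1 u $ i $ j * g u $ 1 $ m + dir_deriv g 2 u $ i $ j * g u $ 2 $ m = T i j m
    - T m i j" for i j m
    using R(1)[of i j m] by (simp add: sum_2)
  have TD: "T i j m = c u $ i $ j $ 1 * g u $ 1 $ m + c u $ i $ j $ 2 * g u $ 2 $ m" for i j m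
    by (simp add: T_def sum_2)
  have T0: "T 1 1 1 = 0" "T 2 2 2 = 0" using R(2)[of 1 1 1] R(2)[of 2 2 2] by simp_all
  have "T 1 2 1 - T 1 1 2 = T 2 1 1 - T 1 2 1" "T 1 2 2 - T 2 1 2 = T 2 1 2 - T 2 2 1"
    using G[of 1 2 1] G[of 2 1 1] G[of 1 2 2] G[of 2 1 2] by (simp_all add: dsym)
  then have T1: "T 1 2 1 = 0" "T 2 1 2 = 0" "T 2 1 1 = - T 1 1 2" "T 2 2 1 = - T 1 2 2"
    using R(2)[of 1 1 2] R(2)[of 2 2 1] by simp_all
  \<comment> \<open>Skewness in the outer indices means \<open>T i j m\<close> = \<open>C j\<close>
    D times the skew symbol in i, m.\<close>
  define C where "C i = T 1 i 2 / D u" for i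
  have C: "T 1 1 2 = C 1 * D u" "T 1 2 2 = C 2 * D u" using D0 by (simp_all add: C_def)
  have inv: "X = (p * g u $ 2 $ 2 - q * g u $ 1 $ 2) / D u \<and> Y = (q * g u $ 1 $ 1 - p * g u $ 1 $ 2) / D u"
    if "X * g u $ 1 $ 1 + Y * g u $ 1 $ 2 = p" "X * g u $ 1 $ 2 + Y * g u $ 2 $ 2 = q" for X Y p q
    using cramer_2[OF that] D0 unfolding D by (simp add: nonzero_eq_divide_eq)
  have c: "c u $ i $ j $ 1 = (T i j 1 * g u $ 2 $ 2 - T i j 2 * g u $ 1 $ 2) / D u"
    "c u $ i $ j $ 2 = (T i j 2 * g u $ 1 $ 1 - T i j 1 * g u $ 1 $ 2) / D u" for i j
    using inv[of "c u $ i $ j $ 1" "c u $ i $ j $ 2" "T i j 1" "T i j 2"] by (auto simp: TD sym[OF u])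
  have d: "dir_deriv g 1 u $ i $ j = ((T i j 1 - T 1 i j) * g u $ 2 $ 2 -
    (T i j 2 - T 2 i j) * g u $ 1 $ 2) / D u"
    "dir_deriv g 2 u $ i $ j = ((T i j 2 - T 2 i j) * g u $ 1 $ 1 -
      (T i j 1 - T 1 i j) * g u $ 1 $ 2) / D u" for i j
    using inv[of "dir_deriv g 1 u $ i $ j" "dir_deriv g 2 u $ i $ j" "T i j 1 - T 1 i j" "T i j 2 - T 2 i j"]
      G[of i j 1] G[of i j 2] by (auto simp: sym[OF u])
  show ?thesis
    unfolding monge_at_def forall_2 c d T0 T1 C
    by (rule exI[of _ C], intro conjI; use D0 in \<open>simp add: C field_simps\<close>)
qed

section \<open>Reduction of the order of the variational derivative\<close>

lemma jet_Ck_on_subset: "jet_Ck_on m W f \<Longrightarrow> W' \<subseteq> W \<Longrightarrow> jet_Ck_on m W' f"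
proof (induction m arbitrary: f)
  case 0
  then show ?case using continuous_on_subset by auto
next
  case (Suc m)
  have "continuous_on W f" "jet_diff_on W f" "\<And>d. jet_Ck_on m W (jet_deriv d f)"
    using Suc.prems(1) unfolding jet_Ck_on_Suc by simp_all
  then show ?case unfolding jet_Ck_on_Suc
    using Suc.prems(2) Suc.IH by (simp add: continuous_on_subset jet_diff_on_def subset_eq)
qed

lemma jet_smooth_subset: "jet_smooth W n f \<Longrightarrow> W' \<subseteq> W \<Longrightarrow> jet_smooth W' n f"
  unfolding jet_smooth_def using jet_Ck_on_subset[of _ W f W'] jet_order_subset[of W n f W'] by simp

lemma jet_diff_on_over:
  fixes F :: "real ^ 'n::finite \<Rightarrow> real"
  assumes "\<And>p. p \<in> W \<Longrightarrow> snd p k \<in> U"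
    and F: "\<And>u l. u \<in> U \<Longrightarrow> ((\<lambda>s. F (u + s *\<^sub>R axis l 1)) has_real_derivative F' l u) (at 0)"
  shows "jet_diff_on W (\<lambda>p. F (snd p k))"
proof (rule jet_diff_onI)
  fix p d assume p: "p \<in> W"
  show "((\<lambda>s. F (snd (jet_move d s p) k)) has_real_derivative
      (case d of None \<Rightarrow> 0 | Some (j, l) \<Rightarrow> if j = k then F' l (snd p k) else 0)) (at 0)"
  proof (cases d)
    case None
    then show ?thesis by (simp add: jet_move_def)
  next
    case (Some jl)
    obtain j l where "jl = (j, l)" by (rule prod.exhaust)
    with Some show ?thesis
      using F[OF assms(1)[OF p], of l] by (cases "j = k") (simp_all add: jet_move_def)
  qed
qed

lemma jet_diff_on_const: "jet_diff_on W (\<lambda>_. c)"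
  by (simp add: jet_diff_on_def)

lemma jet_diff_on_sum:
  assumes "\<And>i. i \<in> I \<Longrightarrow> jet_diff_on W (f i)"
  shows "jet_diff_on W (\<lambda>p. \<Sum>i\<in>I. f i p)"
  using assms
  by (induction I rule: infinite_finite_induct) (simp_all add: jet_diff_on_add jet_diff_on_const)

lemma total_deriv_add:
  assumes W: "open W" and f: "jet_order W n f" "jet_diff_on W f" and g: "jet_order W n g" "jet_diff_on W g"
    and p: "p \<in> W"
  shows "total_deriv (\<lambda>p. f p + g p) p = total_deriv f p + total_deriv g p"
proof -
  have o: "jet_order W n (\<lambda>p. f p + g p)"
    using f(1) g(1) unfolding jet_order_def by metis
  show ?thesis
    unfolding total_deriv_finite[OF W f(1) p] total_deriv_finite[OF W g(1) p] total_deriv_finite[OF W o p]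
      jet_deriv_add[OF f(2) g(2) p]
    by (simp add: distrib_left sum.distrib)
qed

lemma det_nonzero_kernel:
  fixes A :: "real ^ 'n::finite ^ 'n"
  assumes "det A \<noteq> 0" "\<And>i. (\<Sum>j\<in>UNIV. A $ i $ j * x j) = 0"
  shows "x j = 0"
proof -
  have "A *v (\<chi> j. x j) = 0"
    using assms(2) by (simp add: matrix_vector_mult_def vec_eq_iff)
  moreover obtain B where "B ** A = mat 1"
    using assms(1) invertible_det_nz[of A] unfolding invertible_def by blast
  ultimately have "(\<chi> j. x j) = 0"
    using matrix_vector_mul_assoc[of B A "\<chi> j. x j"] by simp
  then have "(\<chi> j. x j) $ j = 0 $ j" by (rule arg_cong)
  then show ?thesis by simp
qed

text \<open>For \<open>\<psi> = \<delta>H/\<delta>b\<close>, the Hamiltonian property is that the total derivative of this function vanishes.\<close>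

definition flux_jet :: "(real ^ 'n::finite \<Rightarrow> real ^ 'n) \<Rightarrow> (real ^ 'n \<Rightarrow> real ^ 'n ^ 'n) \<Rightarrow>
    (real ^ 'n \<Rightarrow> real ^ 'n ^ 'n ^ 'n) \<Rightarrow> ('n \<Rightarrow> 'n jet \<Rightarrow> real) \<Rightarrow> 'n \<Rightarrow> 'n jet \<Rightarrow> real" where
  "flux_jet V g c \<psi> i p = V (snd p 1) $ i + inner_op 1 g c \<psi> i p"

lemma inner_op_1:
  "inner_op 1 g c \<psi> i p = (\<Sum>j\<in>UNIV. g (snd p 1) $ i $ j * total_deriv (\<psi> j) p
      + (\<Sum>k\<in>UNIV. c (snd p 1) $ i $ j $ k * snd p 2 $ k) * \<psi> j p)"
  by (simp add: inner_op_def numeral_2_eq_2)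

text \<open>The function has vanishing total derivative in a box, so
  \<open>total_deriv_kernel\<close> applies. Its order is \<open>Suc n\<close> because it contains
  the total derivative of \<open>\<psi>\<close>, while \<open>2 \<le> n\<close> accounts for the
  level 2 in \<open>inner_op\<close>.\<close>

lemma flux_jet_constant:
  fixes g :: "real ^ 'n::finite \<Rightarrow> real ^ 'n ^ 'n"
  assumes B: "B = jet_box p0 K e" and U: "\<And>p. p \<in> B \<Longrightarrow> snd p 1 \<in> U"
    and V: "\<And>u. u \<in> U \<Longrightarrow> V differentiable (at u)"
    and g: "\<And>u. u \<in> U \<Longrightarrow> g differentiable (at u)" and c: "\<And>u. u \<in> U \<Longrightarrow> c differentiable (at u)"
    and psi: "\<And>j. jet_smooth B n (\<psi> j)" and n: "2 \<le> n"
    and eq: "\<And>p i. p \<in> B \<Longrightarrow> total_deriv (\<lambda>q. V (snd q 1) $ i) p = - total_deriv (inner_op 1 g c \<psi> i) p"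
    and pq: "p \<in> B" "q \<in> B"
  shows "flux_jet V g c \<psi> i p = flux_jet V g c \<psi> i q"
proof -
  have oB: "open B" unfolding B by (rule open_jet_box)
  have dV: "jet_diff_on B (\<lambda>p. V (snd p 1) $ i)"
    by (rule jet_diff_on_over[where U = U and F' = "\<lambda>l u. dir_deriv V l u $ i"])
      (rule U DERIV_dir1[OF V], assumption)+
  have dg: "jet_diff_on B (\<lambda>p. g (snd p 1) $ i $ j)" for j
    by (rule jet_diff_on_over[where U = U and F' = "\<lambda>l u. dir_deriv g l u $ i $ j"])
      (rule U DERIV_dir2[OF g], assumption)+
  have dc: "jet_diff_on B (\<lambda>p. c (snd p 1) $ i $ j $ k)" for j k
    by (rule jet_diff_on_over[where U = U and F' = "\<lambda>l u. dir_deriv c l u $ i $ j $ k"])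
      (rule U DERIV_dir3[OF c], assumption)+
  note dT = jet_smooth_imp_diff[OF jet_smooth_total_deriv[OF oB psi]]
  have dk: "jet_diff_on B (\<lambda>p. snd p 2 $ k)" for k
    by (rule jet_smooth_imp_diff[OF jet_smooth_coord[of _ "Suc 2"]]) simp
  have dI: "jet_diff_on B (inner_op 1 g c \<psi> i)"
    unfolding inner_op_1[abs_def]
    by (intro jet_diff_on_sum jet_diff_on_add jet_diff_on_mult dg dc dT dk jet_smooth_imp_diff[OF psi])
  have oV: "jet_order B (Suc n) (\<lambda>p. V (snd p 1) $ i)"
    using n by (simp add: jet_order_def)
  have oI: "jet_order B (Suc n) (inner_op 1 g c \<psi> i)"
    unfolding jet_order_def
  proof (intro ballI impI)
    fix p q assume p: "p \<in> B" and q: "q \<in> B" and a: "fst p = fst q" "\<forall>k<Suc n. snd p k = snd q k"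
    have "total_deriv (\<psi> j) p = total_deriv (\<psi> j) q" for j
      by (rule jet_orderD[OF conjunct2[OF jet_smooth_total_deriv[OF oB psi, unfolded jet_smooth_def]] p q a(1)])
        (use a(2) in simp)
    moreover have "\<psi> j p = \<psi> j q" for j
      by (rule jet_orderD[OF conjunct2[OF psi[unfolded jet_smooth_def]] p q a(1)]) (use a(2) in simp)
    moreover have "snd p 1 = snd q 1" "snd p 2 = snd q 2" using a(2) n by simp_all
    ultimately show "inner_op 1 g c \<psi> i p = inner_op 1 g c \<psi> i q"
      unfolding inner_op_1 by simp
  qed
  have z: "total_deriv (flux_jet V g c \<psi> i) r = 0" if "r \<in> jet_box p0 K e" for r
    using total_deriv_add[OF oB oV dV oI dI, of r] eq[of r i] that
    unfolding flux_jet_def[abs_def] B by simp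
  have "jet_diff_on B (flux_jet V g c \<psi> i)"
    unfolding flux_jet_def[abs_def] by (rule jet_diff_on_add[OF dV dI])
  moreover have "jet_order B (Suc n) (flux_jet V g c \<psi> i)"
    using oV oI unfolding flux_jet_def[abs_def] jet_order_def by metis
  ultimately show ?thesis
    using total_deriv_kernel[of p0 K e "flux_jet V g c \<psi> i" "Suc n" p q] z pq unfolding B by simp
qed

text \<open>A dependence on the highest derivative would make \<open>g\<^sup>i\<^sup>j D \<psi>\<^sub>j\<close> depend on the next one.\<close>

lemma potential_order_2:
  fixes g :: "real ^ 'n::finite \<Rightarrow> real ^ 'n ^ 'n"
  assumes B: "B = jet_box p0 K e" and det: "\<And>p. p \<in> B \<Longrightarrow> det (g (snd p 1)) \<noteq> 0"
    and psi: "\<And>j. jet_smooth B (2 + n) (\<psi> j)"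
    and eq: "\<And>p i. p \<in> B \<Longrightarrow> flux_jet V g c \<psi> i p = k i"
  shows "jet_smooth B 2 (\<psi> j)"
  using psi
proof (induction n arbitrary: j)
  case (Suc n)
  have oB: "open B" unfolding B by (rule open_jet_box)
  have o: "jet_order B (Suc (2 + n)) (\<psi> j)" for j
    using Suc.prems[of j] unfolding jet_smooth_def by simp
  have z: "jet_deriv (Some (2 + n, l)) (\<psi> j) q = 0" if q: "q \<in> B" for q l j
  proof -
    obtain s where s: "s \<noteq> 0" "jet_move (Some (Suc (2 + n), l)) s q \<in> B"
      using small_jet_move[OF oB q] by blast
    let ?r = "jet_move (Some (Suc (2 + n), l)) s q"
    have r: "snd ?r 1 = snd q 1" "snd ?r 2 = snd q 2"
      by (simp_all add: jet_move_def)
    have "\<psi> j ?r = \<psi> j q" for j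
      by (rule jet_order_move[OF o q s(2)]) simp
    \<comment> \<open>The moved level is at least 3. Hence V, g, c, the first derivatives of the
      field and the functions \<open>\<psi> j\<close> are unchanged, and the difference of the two
      fluxes comes from the total derivatives alone.\<close>
    then have "(\<Sum>j\<in>UNIV. g (snd q 1) $ i $ j * (s * jet_deriv (Some (2 + n, l)) (\<psi> j) q))
      = flux_jet V g c \<psi> i ?r - flux_jet V g c \<psi> i q" for i
      unfolding flux_jet_def inner_op_1 r total_deriv_move[OF oB o q s(2)]
      by (simp add: sum.distrib algebra_simps)
    then have "s * jet_deriv (Some (2 + n, l)) (\<psi> j) q = 0" for j
      using eq[OF q] eq[OF s(2)] det_nonzero_kernel[OF det[OF q], of "\<lambda>j. s * jet_deriv (Some (2 + n, l))
        (\<psi> j) q"]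
      by simp
    then show ?thesis using s(1) by simp
  qed
  have "jet_smooth B (2 + n) (\<psi> j)" for j
  proof -
    have "jet_order B (2 + n) (\<psi> j)"
      unfolding B
      by (rule jet_order_reduce) (use z o jet_smooth_imp_diff[OF Suc.prems] in \<open>simp_all add: B\<close>)
    then show ?thesis using Suc.prems unfolding jet_smooth_def by simp
  qed
  then show ?case by (rule Suc.IH)
qed simp

text \<open>Now \<open>\<psi>\<close> depends on x, the potentials and u = \<open>snd p 1\<close>
  only, so the constant flux is affine in the derivative of u, which is \<open>snd p 2\<close>. Its
  linear coefficients and its constant term give the two equations.\<close>

lemma potential_equations:
  fixes g :: "real ^ 'n::finite \<Rightarrow> real ^ 'n ^ 'n"
  assumes oB: "open B" and psi: "\<And>j. jet_smooth B 2 (\<psi> j)"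
    and eq: "\<And>p i. p \<in> B \<Longrightarrow> flux_jet V g c \<psi> i p = k i" and p: "p \<in> B"
  shows "(\<Sum>j\<in>UNIV. g (snd p 1) $ i $ j * jet_deriv (Some (1, l)) (\<psi> j) p + c (snd p 1) $ i $ j $ l * \<psi> j p) = 0"
    and "V (snd p 1) $ i + (\<Sum>j\<in>UNIV. g (snd p 1) $ i $ j *
       (jet_deriv None (\<psi> j) p + (\<Sum>l\<in>UNIV. snd p 1 $ l * jet_deriv (Some (0, l)) (\<psi> j) p))) = k i"
proof -
  have o: "jet_order B 2 (\<psi> j)" for j using psi[of j] by (simp add: jet_smooth_def)
  show 1: "(\<Sum>j\<in>UNIV. g (snd p 1) $ i $ j * jet_deriv (Some (1, l)) (\<psi> j) p + c
    (snd p 1) $ i $ j $ l * \<psi> j p) = 0" for i l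
  proof -
    \<comment> \<open>The difference quotient in level 2 isolates one linear coefficient.\<close>
    obtain s where s: "s \<noteq> 0" "jet_move (Some (2, l)) s p \<in> B"
      using small_jet_move[OF oB p] by blast
    let ?r = "jet_move (Some (2, l)) s p"
    have r: "snd ?r 1 = snd p 1" "snd ?r 2 = snd p 2 + s *\<^sub>R axis l 1"
      by (simp_all add: jet_move_def)
    have "\<psi> j ?r = \<psi> j p" for j
      by (rule jet_order_move[OF o p s(2)]) simp
    moreover have "total_deriv (\<psi> j) ?r = total_deriv (\<psi> j) p + s * jet_deriv (Some (1, l)) (\<psi> j) p" for j
      using total_deriv_move[of B 1 "\<psi> j" p l s] oB o p s(2) by (simp add: numeral_2_eq_2)
    ultimately have "s * (\<Sum>j\<in>UNIV. g (snd p 1) $ i $ j * jet_deriv (Some (1, l)) (\<psi> j) p + c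
      (snd p 1) $ i $ j $ l * \<psi> j p)
      = flux_jet V g c \<psi> i ?r - flux_jet V g c \<psi> i p"
      unfolding flux_jet_def inner_op_1 r sum_axis
      by (simp add: sum.distrib algebra_simps sum_distrib_left del: vector_add_component)
    then show ?thesis using eq[OF p, of i] eq[OF s(2), of i] s(1) by simp
  qed
  have "flux_jet V g c \<psi> i p = V (snd p 1) $ i + (\<Sum>j\<in>UNIV. g (snd p 1) $ i $ j *
       (jet_deriv None (\<psi> j) p + (\<Sum>l\<in>UNIV. snd p 1 $ l * jet_deriv (Some (0, l)) (\<psi> j) p)))
     + (\<Sum>j\<in>UNIV. \<Sum>l\<in>UNIV. snd p 2 $ l * (g (snd p 1) $ i $ j * jet_deriv (Some (1, l)) (\<psi> j) p + c
       (snd p 1) $ i $ j $ l * \<psi> j p))"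
    unfolding flux_jet_def inner_op_1 total_deriv_finite[OF oB o p]
    by (simp add: numeral_2_eq_2 sum.distrib algebra_simps sum_distrib_left)
  also have "(\<Sum>j\<in>UNIV. \<Sum>l\<in>UNIV. snd p 2 $ l * (g (snd p 1) $ i $ j * jet_deriv (Some (1, l)) (\<psi> j) p + c
    (snd p 1) $ i $ j $ l * \<psi> j p))
    = (\<Sum>l\<in>UNIV. snd p 2 $ l * (\<Sum>j\<in>UNIV. g (snd p 1) $ i $ j * jet_deriv (Some (1, l)) (\<psi> j) p + c
      (snd p 1) $ i $ j $ l * \<psi> j p))"
    unfolding sum_distrib_left by (rule sum.swap)
  also have "\<dots> = 0" unfolding 1 by simp
  finally show "V (snd p 1) $ i + (\<Sum>j\<in>UNIV. g (snd p 1) $ i $ j *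
       (jet_deriv None (\<psi> j) p + (\<Sum>l\<in>UNIV. snd p 1 $ l * jet_deriv (Some (0, l)) (\<psi> j) p))) = k i"
    using eq[OF p, of i] by simp
qed

section \<open>The variational derivative for two components\<close>

text \<open>Changes u and nothing else: the dependent variables are the potentials, so u sits at
  level 1.\<close>

definition jet_set1 :: "real ^ 'n::finite \<Rightarrow> 'n jet \<Rightarrow> 'n jet" where
  "jet_set1 v r = (fst r, (snd r)(1 := v))"

lemma jet_set1_simps [simp]:
  "fst (jet_set1 v r) = fst r" "snd (jet_set1 v r) 1 = v" "snd (jet_set1 v r) (Suc 0) = v"
  by (simp_all add: jet_set1_def)

lemma jet_set1_id: "snd r 1 = v \<Longrightarrow> jet_set1 v r = r"
  by (cases r) (auto simp: jet_set1_def)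

lemma jet_move_set1:
  "jet_move (Some (1, i)) t (jet_set1 v r) = jet_set1 (v + t *\<^sub>R axis i 1) r"
  "jet_move (Some (Suc 0, i)) t (jet_set1 v r) = jet_set1 (v + t *\<^sub>R axis i 1) r"
  "jet_move (Some (0, i)) t (jet_set1 v r) = jet_set1 v (jet_move (Some (0, i)) t r)"
  "jet_move None t (jet_set1 v r) = jet_set1 v (jet_move None t r)"
  by (simp_all add: jet_move_def jet_set1_def fun_upd_twist)

text \<open>The coefficient of the second derivatives of the potentials in the flux gives
  \<open>\<partial>\<psi>\<^sub>j / \<partial>u\<^sup>l = A \<epsilon>\<^sub>j\<^sub>l\<close> with \<open>A = - C\<^sup>m \<psi>\<^sub>m\<close>. As \<open>\<psi>\<^sub>1\<close> does not depend on \<open>u\<^sup>1\<close> and \<open>\<psi>\<^sub>2\<close> not on \<open>u\<^sup>2\<close>,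
  \<open>A\<close> does not depend on \<open>u\<close>, so that \<open>\<psi>\<close> is affine in \<open>u\<close>.\<close>

locale planar_potential =
  fixes p0 :: "2 jet" and K :: nat and e :: real and \<psi> :: "2 \<Rightarrow> 2 jet \<Rightarrow> real" and C :: "real ^ 2 \<Rightarrow> 2 \<Rightarrow> real"
    and B :: "2 jet set" and p :: "real ^ 2"
  defines "B \<equiv> jet_box p0 K e" and "p \<equiv> snd p0 1"
  assumes e: "0 < e" and psi: "\<And>j. jet_smooth B 2 (\<psi> j)"
    and d1: "\<And>q. q \<in> B \<Longrightarrow> jet_deriv (Some (1, 1)) (\<psi> 1) q = 0"
    and d2: "\<And>q. q \<in> B \<Longrightarrow> jet_deriv (Some (1, 2)) (\<psi> 2) q = 0"
    and a1: "\<And>q. q \<in> B \<Longrightarrow> jet_deriv (Some (1, 2)) (\<psi> 1) q = - (C (snd q 1) 1 * \<psi> 1 q + C (snd q 1) 2 * \<psi> 2 q)"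
    and a2: "\<And>q. q \<in> B \<Longrightarrow> jet_deriv (Some (1, 1)) (\<psi> 2) q = C (snd q 1) 1 * \<psi> 1 q + C (snd q 1) 2 * \<psi> 2 q"
begin

definition near :: "real ^ 2 \<Rightarrow> bool" where
  "near v \<longleftrightarrow> (\<forall>i. \<bar>v $ i - p $ i\<bar> < e)"

definition A :: "2 jet \<Rightarrow> real" where
  "A q = - (C (snd q 1) 1 * \<psi> 1 q + C (snd q 1) 2 * \<psi> 2 q)"

lemma oB: "open B" unfolding B_def by (rule open_jet_box)

lemma near_p: "near p" using e by (simp add: near_def)

lemma set1_in: "r \<in> B \<Longrightarrow> near v \<Longrightarrow> jet_set1 v r \<in> B"
  by (simp add: B_def jet_box_def near_def p_def jet_set1_def)

lemma move_in: "r \<in> B \<Longrightarrow> near (v + t *\<^sub>R axis i 1) \<Longrightarrow> jet_move (Some (1, i)) t (jet_set1 v r) \<in> B"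
  unfolding jet_move_set1 by (rule set1_in)

lemma eventually_near:
  assumes "near v"
  shows "eventually (\<lambda>s. near (v + s *\<^sub>R axis i 1)) (nhds 0)"
proof -
  have "open (\<Inter>i\<in>UNIV. {v :: real ^ 2. \<bar>v $ i - p $ i\<bar> < e})"
    by (intro open_INT finite ballI open_Collect_less continuous_intros)
  also have "(\<Inter>i\<in>UNIV. {v :: real ^ 2. \<bar>v $ i - p $ i\<bar> < e}) = {v. near v}"
    by (auto simp: near_def)
  finally have "open ((\<lambda>s. v + s *\<^sub>R axis i 1) -` {v. near v})"
    by (rule open_vimage) (auto intro!: continuous_intros)
  then show ?thesis
    using assms unfolding eventually_nhds
    by (intro exI[of _ "(\<lambda>s. v + s *\<^sub>R axis i 1) -` {v. near v}"]) simp
qed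

lemma diff: "jet_diff_on B (\<psi> j)" by (rule jet_smooth_imp_diff[OF psi])

lemma psi_const:
  assumes z: "\<And>q. q \<in> B \<Longrightarrow> jet_deriv (Some (1, i)) (\<psi> j) q = 0"
    and r: "r \<in> B" and v: "near v" "near (v + t *\<^sub>R axis i 1)"
  shows "\<psi> j (jet_set1 (v + t *\<^sub>R axis i 1) r) = \<psi> j (jet_set1 v r)"
proof -
  have "\<psi> j (jet_move (Some (1, i)) t (jet_set1 v r)) = \<psi> j (jet_set1 v r)"
    using diff[unfolded B_def] z[unfolded B_def] set1_in[OF r v(1), unfolded B_def]
      move_in[OF r v(2), unfolded B_def]
    by (rule jet_const_along)
  then show ?thesis by (simp only: jet_move_set1)
qed

lemma deriv_const:
  assumes z: "\<And>q. q \<in> B \<Longrightarrow> jet_deriv (Some (1, i)) (\<psi> j) q = 0"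
    and r: "r \<in> B" and v: "near v" "near (v + t *\<^sub>R axis i 1)"
  shows "jet_deriv (Some (1, l)) (\<psi> j) (jet_set1 (v + t *\<^sub>R axis i 1) r)
       = jet_deriv (Some (1, l)) (\<psi> j) (jet_set1 v r)"
  unfolding jet_deriv_def
proof (rule deriv_cong_ev)
  show "\<forall>\<^sub>F s in nhds 0. \<psi> j (jet_move (Some (1, l)) s (jet_set1 (v + t *\<^sub>R axis i 1) r))
      = \<psi> j (jet_move (Some (1, l)) s (jet_set1 v r))"
    using eventually_near[OF v(1), of l] eventually_near[OF v(2), of l]
  proof eventually_elim
    case (elim s)
    have eq: "(v + t *\<^sub>R axis i 1) + s *\<^sub>R axis l 1 = (v + s *\<^sub>R axis l 1) + t *\<^sub>R axis i (1::real)"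
      by (simp add: algebra_simps)
    show ?case
      using psi_const[OF z r elim(1) elim(2)[unfolded eq]] unfolding jet_move_set1 eq .
  qed
qed simp

lemma A_const:
  assumes "r \<in> B" "near v" "near (v + t *\<^sub>R axis i 1)"
  shows "A (jet_set1 (v + t *\<^sub>R axis i 1) r) = A (jet_set1 v r)"
proof -
  have A: "A q = jet_deriv (Some (1, 2)) (\<psi> 1) q" "A q = - jet_deriv (Some (1, 1)) (\<psi> 2) q" if "q \<in> B" for q
    using a1[OF that] a2[OF that] by (simp_all add: A_def)
  note * = set1_in[OF assms(1,2)] set1_in[OF assms(1,3)]
  consider "i = 1" | "i = 2" using exhaust_2 by blast
  then show ?thesis
  proof cases
    case 1
    show ?thesis
      unfolding A(1)[OF *(1)] A(1)[OF *(2)] using d1 assms unfolding 1 by (rule deriv_const)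
  next
    case 2
    show ?thesis
      unfolding A(2)[OF *(1)] A(2)[OF *(2)] neg_equal_iff_equal using d2 assms unfolding 2 by (rule deriv_const)
  qed
qed

lemma near_segment:
  assumes "near v" "near (v + t *\<^sub>R axis i 1)" "s \<in> closed_segment 0 t"
  shows "near (v + s *\<^sub>R axis i 1)"
  unfolding near_def
proof
  fix j
  have s: "(0 \<le> s \<and> s \<le> t) \<or> (t \<le> s \<and> s \<le> 0)"
    using assms(3) by (auto simp: closed_segment_eq_real_ivl split: if_splits)
  have "\<bar>v $ j - p $ j\<bar> < e" "\<bar>(v + t *\<^sub>R axis i 1) $ j - p $ j\<bar> < e"
    using assms(1,2) by (simp_all add: near_def)
  then show "\<bar>(v + s *\<^sub>R axis i 1) $ j - p $ j\<bar> < e"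
    using s by (cases "j = i") (simp_all add: axis_def, linarith)
qed

lemma psi_linear:
  assumes z: "\<And>q. q \<in> B \<Longrightarrow> jet_deriv (Some (1, i)) (\<psi> j) q = k * A q"
    and r: "r \<in> B" and v: "near v" "near (v + t *\<^sub>R axis i 1)"
  shows "\<psi> j (jet_set1 (v + t *\<^sub>R axis i 1) r) = \<psi> j (jet_set1 v r) + t * (k * A (jet_set1 v r))"
proof -
  have "\<psi> j (jet_move (Some (1, i)) t (jet_set1 v r)) = \<psi> j (jet_set1 v r) + t * (k * A (jet_set1 v r))"
  proof (rule jet_linear_along[OF diff])
    fix s assume s: "s \<in> closed_segment 0 t"
    note n = near_segment[OF v s]
    show "jet_move (Some (1, i)) s (jet_set1 v r) \<in> B \<and>
       jet_deriv (Some (1, i)) (\<psi> j) (jet_move (Some (1, i)) s (jet_set1 v r)) = k * A (jet_set1 v r)"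
      using set1_in[OF r n] z[OF set1_in[OF r n]] A_const[OF r v(1) n] by (simp add: jet_move_set1)
  qed
  then show ?thesis by (simp only: jet_move_set1)
qed

text \<open>The affine dependence on u, integrated from the centre \<open>p\<close> of the box along
  coordinate segments.\<close>

lemma psi_values:
  assumes r: "r \<in> B" "snd r 1 = p" and v: "near v"
  shows "\<psi> 1 (jet_set1 v r) = \<psi> 1 r + (v $ 2 - p $ 2) * A r"
    and "\<psi> 2 (jet_set1 v r) = \<psi> 2 r - (v $ 1 - p $ 1) * A r"
    and "A (jet_set1 v r) = A r"
proof -
  let ?t = "v - p"
  \<comment> \<open>Two paths from \<open>p\<close> to \<open>v\<close> through different corners.
    For each component the last segment is the one along which that component is constant, so only
    the first contributes.\<close>
  have v1: "v = (p + ?t $ 1 *\<^sub>R axis 1 1) + ?t $ 2 *\<^sub>R axis 2 1"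
    by (simp add: vec_eq_iff forall_2 axis_def)
  have v2: "v = (p + ?t $ 2 *\<^sub>R axis 2 1) + ?t $ 1 *\<^sub>R axis 1 1"
    by (simp add: vec_eq_iff forall_2 axis_def)
  have n: "near (p + ?t $ i *\<^sub>R axis i 1)" for i
    using v e by (auto simp: near_def axis_def)
  note rp = jet_set1_id[OF r(2)]
  have nv: "near ((p + ?t $ 1 *\<^sub>R axis 1 1) + ?t $ 2 *\<^sub>R axis 2 1)" "near
    ((p + ?t $ 2 *\<^sub>R axis 2 1) + ?t $ 1 *\<^sub>R axis 1 1)"
    using v v1 v2 by simp_all
  have "\<psi> 1 (jet_set1 v r) = \<psi> 1 (jet_set1 (p + ?t $ 2 *\<^sub>R axis 2 1) r)"
    using psi_const[OF d1 r(1) n[of 2] nv(2)] v2 by simp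
  also have "\<dots> = \<psi> 1 r + ?t $ 2 * (1 * A r)"
    using psi_linear[of 2 1 1, OF _ r(1) near_p n[of 2]] a1 by (simp add: rp A_def)
  finally show "\<psi> 1 (jet_set1 v r) = \<psi> 1 r + (v $ 2 - p $ 2) * A r" by simp
  have "\<psi> 2 (jet_set1 v r) = \<psi> 2 (jet_set1 (p + ?t $ 1 *\<^sub>R axis 1 1) r)"
    using psi_const[OF d2 r(1) n[of 1] nv(1)] v1 by simp
  also have "\<dots> = \<psi> 2 r + ?t $ 1 * (- 1 * A r)"
    using psi_linear[of 1 2 "- 1", OF _ r(1) near_p n[of 1]] a2 by (simp add: rp A_def)
  finally show "\<psi> 2 (jet_set1 v r) = \<psi> 2 r - (v $ 1 - p $ 1) * A r" by simp
  have "A (jet_set1 v r) = A (jet_set1 (p + ?t $ 2 *\<^sub>R axis 2 1) r)"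
    using A_const[OF r(1) n[of 2] nv(2)] v2 by simp
  also have "\<dots> = A r"
    using A_const[OF r(1) near_p n[of 2]] by (simp add: rp)
  finally show "A (jet_set1 v r) = A r" .
qed

lemma p0_in: "p0 \<in> B" using e unfolding B_def by (rule jet_box_center)

text \<open>The directions x and \<open>b\<^sup>l\<close>, that is all directions other than u on
  which \<open>\<psi>\<close> may depend; moving along them commutes with replacing u.\<close>

definition slow :: "2 option \<Rightarrow> (nat \<times> 2) option" where
  "slow d = (case d of None \<Rightarrow> None | Some l \<Rightarrow> Some (0, l))"

lemma slow_move: "jet_move (slow d) s (jet_set1 v r) = jet_set1 v (jet_move (slow d) s r)"
  "snd (jet_move (slow d) s r) 1 = snd r 1"
  by (cases d; simp add: slow_def jet_move_set1; simp add: jet_move_def)+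

definition \<alpha> :: "2 option \<Rightarrow> real" where
  "\<alpha> d = - (C p 1 * jet_deriv (slow d) (\<psi> 1) p0 + C p 2 * jet_deriv (slow d) (\<psi> 2) p0)"

text \<open>Differentiates the identities of \<open>psi_values\<close> along a slow direction at the
  base jet. As \<open>A\<close> does not depend on u, its derivative can be computed at
  \<open>p\<close> or at \<open>v\<close>; the third equation compares the two.\<close>

lemma slow_derivs:
  assumes v: "near v"
  shows "jet_deriv (slow d) (\<psi> 1) (jet_set1 v p0) = jet_deriv (slow d) (\<psi> 1) p0 + \<alpha> d * (v $ 2 - p $ 2)"
    and "jet_deriv (slow d) (\<psi> 2) (jet_set1 v p0) = jet_deriv (slow d) (\<psi> 2) p0 - \<alpha> d * (v $ 1 - p $ 1)"
    and "\<alpha> d = - (C v 1 * jet_deriv (slow d) (\<psi> 1) (jet_set1 v p0) + C v 2 * jet_deriv (slow d) (\<psi> 2)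
      (jet_set1 v p0))"
proof -
  note D = jet_diff_onD[OF diff p0_in, of _ "slow d"]
  note Dv = jet_diff_onD[OF diff set1_in[OF p0_in v], of _ "slow d", unfolded slow_move]
  have ev: "eventually (\<lambda>s. jet_move (slow d) s p0 \<in> B) (nhds 0)"
    by (rule eventually_jet_move_in[OF oB p0_in])
  have s1: "snd (jet_move (slow d) s p0) 1 = p" for s
    unfolding slow_move(2) by (simp add: p_def)
  have DA: "((\<lambda>s. A (jet_move (slow d) s p0)) has_real_derivative \<alpha> d) (at 0)"
    unfolding A_def s1 \<alpha>_def by (intro DERIV_minus DERIV_add DERIV_cmult D)
  have DAv: "((\<lambda>s. A (jet_set1 v (jet_move (slow d) s p0))) has_real_derivative
     - (C v 1 * jet_deriv (slow d) (\<psi> 1) (jet_set1 v p0) + C v 2 * jet_deriv (slow d) (\<psi> 2)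
       (jet_set1 v p0))) (at 0)"
    unfolding A_def jet_set1_simps by (intro DERIV_minus DERIV_add DERIV_cmult Dv)
  have 1: "\<forall>\<^sub>F s in nhds 0. \<psi> 1 (jet_set1 v (jet_move (slow d) s p0))
      = \<psi> 1 (jet_move (slow d) s p0) + (v $ 2 - p $ 2) * A (jet_move (slow d) s p0)"
    using ev by eventually_elim (rule psi_values[OF _ s1 v])
  have 2: "\<forall>\<^sub>F s in nhds 0. \<psi> 2 (jet_set1 v (jet_move (slow d) s p0))
      = \<psi> 2 (jet_move (slow d) s p0) - (v $ 1 - p $ 1) * A (jet_move (slow d) s p0)"
    using ev by eventually_elim (rule psi_values[OF _ s1 v])
  have 3: "\<forall>\<^sub>F s in nhds 0. A (jet_set1 v (jet_move (slow d) s p0)) = A (jet_move (slow d) s p0)"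
    using ev by eventually_elim (rule psi_values[OF _ s1 v])
  show "jet_deriv (slow d) (\<psi> 1) (jet_set1 v p0) = jet_deriv (slow d) (\<psi> 1) p0 + \<alpha> d * (v $ 2 - p $ 2)"
    using DERIV_unique[OF Dv iffD2[OF DERIV_cong_ev[OF HOL.refl 1 HOL.refl] DERIV_add[OF D DERIV_cmult[OF DA]]]]
    by (simp add: mult.commute)
  show "jet_deriv (slow d) (\<psi> 2) (jet_set1 v p0) = jet_deriv (slow d) (\<psi> 2) p0 - \<alpha> d * (v $ 1 - p $ 1)"
    using DERIV_unique[OF Dv iffD2[OF DERIV_cong_ev[OF HOL.refl 2 HOL.refl]
      DERIV_diff[OF D DERIV_cmult[OF DA]]]]
    by (simp add: mult.commute)
  show "\<alpha> d = - (C v 1 * jet_deriv (slow d) (\<psi> 1) (jet_set1 v p0) + C v 2 * jet_deriv (slow d) (\<psi> 2)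
    (jet_set1 v p0))"
    by (rule DERIV_unique[OF iffD2[OF DERIV_cong_ev[OF HOL.refl 3 HOL.refl] DA, THEN DERIV_cong] DAv]) simp
qed

end

text \<open>The derivative of the \<open>j\<close>-th component of the variational derivative in the direction \<open>d\<close>
  (\<open>None\<close> for \<open>x\<close>, \<open>Some l\<close> for \<open>b\<^sup>l\<close>) is, as a function of \<open>u\<close>, the restriction to
  \<open>(1, 0, p\<^sub>2 - u\<^sub>2)\<close>, \<open>(0, 1, u\<^sub>1 - p\<^sub>1)\<close> of the constant covector \<open>(f d 1, f d 2, - \<alpha> d)\<close>.\<close>

definition flux_expansion :: "(real ^ 2) set \<Rightarrow> (real ^ 2 \<Rightarrow> real ^ 2) \<Rightarrow> (real ^ 2 \<Rightarrow> real ^ 2 ^ 2) \<Rightarrow>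
    (real ^ 2 \<Rightarrow> 2 \<Rightarrow> real) \<Rightarrow> real ^ 2 \<Rightarrow> real \<Rightarrow> (2 \<Rightarrow> real) \<Rightarrow> (2 option \<Rightarrow> 2 \<Rightarrow> real) \<Rightarrow>
    (2 option \<Rightarrow> real) \<Rightarrow> bool" where
  "flux_expansion U V g C p e k f \<alpha> \<longleftrightarrow> 0 < e \<and>
    (\<forall>u. (\<forall>i. \<bar>u $ i - p $ i\<bar> < e) \<longrightarrow> u \<in> U \<and>
      (\<forall>d. \<alpha> d = - (C u 1 * (f d 1 + \<alpha> d * (u $ 2 - p $ 2)) + C u 2 * (f d 2 - \<alpha> d * (u $ 1 - p $ 1)))) \<and>
      (\<forall>i. V u $ i
       + g u $ i $ 1 * (f None 1 + \<alpha> None * (u $ 2 - p $ 2)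
           + u $ 1 * (f (Some 1) 1 + \<alpha> (Some 1) * (u $ 2 - p $ 2)) + u $ 2 *
             (f (Some 2) 1 + \<alpha> (Some 2) * (u $ 2 - p $ 2)))
       + g u $ i $ 2 * (f None 2 - \<alpha> None * (u $ 1 - p $ 1)
           + u $ 1 * (f (Some 1) 2 - \<alpha> (Some 1) * (u $ 1 - p $ 1)) + u $ 2 *
             (f (Some 2) 2 - \<alpha> (Some 2) * (u $ 1 - p $ 1)))
       = k i))"

text \<open>Lifts \<open>p\<close> to a jet of \<open>W\<close>, restricts to a box around it,
  reduces the variational derivative to functions of x, b, u, and evaluates the remaining flux
  equation on the jets over points u near \<open>p\<close> that share all other levels.\<close>

lemma hamiltonian_flux_structure:
  fixes g :: "real ^ 2 \<Rightarrow> real ^ 2 ^ 2" and c :: "real ^ 2 \<Rightarrow> real ^ 2 ^ 2 ^ 2"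
  assumes V: "\<And>u. u \<in> U \<Longrightarrow> V differentiable (at u)"
    and g: "\<And>u. u \<in> U \<Longrightarrow> g differentiable (at u)" and c: "\<And>u. u \<in> U \<Longrightarrow> c differentiable (at u)"
    and nd: "nondegenerate_metric U g" and H: "hamiltonian_with U g c V W h" and p: "p \<in> U"
    and M: "\<And>u. u \<in> U \<Longrightarrow> monge_at g c u (C u)"
  shows "\<exists>e k f \<alpha>. flux_expansion U V g C p e k f \<alpha>"
proof -
  have W: "open W" "(\<lambda>p. snd p 1) ` W = U" "differential_function W h"
    and eq: "\<And>q i. q \<in> W \<Longrightarrow> total_deriv (\<lambda>q. V (snd q 1) $ i) q = - total_deriv
      (inner_op 1 g c (\<lambda>j. euler j h) i) q"
    using H unfolding hamiltonian_with_def by blast+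
  obtain p0 where p0: "p0 \<in> W" "snd p0 1 = p" using W(2) p by blast
  obtain K e where Ke: "0 < e" "jet_box p0 K e \<subseteq> W" using jet_box_exists[OF W(1) p0(1)] by blast
  obtain n where n: "jet_smooth W n h" using differential_function_smooth[OF W(3)] by blast
  define \<psi> where "\<psi> j = euler j h" for j
  define B where "B = jet_box p0 K e"
  have BU: "snd q 1 \<in> U" if "q \<in> B" for q using W(2) Ke(2) that B_def by blast
  have oB: "open B" unfolding B_def by (rule open_jet_box)
  have psi0: "jet_smooth B (2 + (n + n)) (\<psi> j)" for j
    unfolding \<psi>_def
    by (rule jet_smooth_mono[OF jet_smooth_subset[OF jet_smooth_euler[OF W(1) n]]]) (use Ke B_def in auto)
  define k where "k i = flux_jet V g c \<psi> i p0" for i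
  have p0B: "p0 \<in> B" unfolding B_def by (rule jet_box_center[OF Ke(1)])
  have flux: "flux_jet V g c \<psi> i q = k i" if "q \<in> B" for q i
    unfolding k_def
    by (rule flux_jet_constant[OF B_def BU V g c psi0 _ _ that p0B])
      (use eq Ke B_def in \<open>auto simp: \<psi>_def[abs_def]\<close>)
  have det: "det (g (snd q 1)) \<noteq> 0" and sym: "g (snd q 1) $ 2 $ 1 = g (snd q 1) $ 1 $ 2" if "q \<in> B" for q
  proof -
    have t: "transpose (g (snd q 1)) = g (snd q 1)" and d: "det (g (snd q 1)) \<noteq> 0"
      using nd BU[OF that] by (auto simp: nondegenerate_metric_def)
    show "det (g (snd q 1)) \<noteq> 0" by fact
    have "transpose (g (snd q 1)) $ 1 $ 2 = g (snd q 1) $ 1 $ 2" using t by simp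
    then show "g (snd q 1) $ 2 $ 1 = g (snd q 1) $ 1 $ 2" by (simp add: transpose_def)
  qed
  have psi: "jet_smooth B 2 (\<psi> j)" for j
    using B_def det psi0 flux by (rule potential_order_2)
  have pe1: "(\<Sum>j\<in>UNIV. g (snd q 1) $ i $ j * jet_deriv (Some (1, l)) (\<psi> j) q + c
    (snd q 1) $ i $ j $ l * \<psi> j q) = 0"
    if "q \<in> B" for q i l
    using oB psi flux that by (rule potential_equations)
  have pe2: "V (snd q 1) $ i + (\<Sum>j\<in>UNIV. g (snd q 1) $ i $ j *
       (jet_deriv None (\<psi> j) q + (\<Sum>l\<in>UNIV. snd q 1 $ l * jet_deriv (Some (0, l)) (\<psi> j) q))) = k i"
    if "q \<in> B" for q i
    using oB psi flux that by (rule potential_equations)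
  define a where "a q = C (snd q 1) 1 * \<psi> 1 q + C (snd q 1) 2 * \<psi> 2 q" for q
  have kernel: "x = 0 \<and> y = 0"
    if "q \<in> B" "g (snd q 1) $ 1 $ 1 * x + g (snd q 1) $ 1 $ 2 * y = 0" "g (snd q 1) $ 1 $ 2 * x + g
      (snd q 1) $ 2 $ 2 * y = 0" for q x y
  proof -
    have "(\<Sum>j\<in>UNIV. g (snd q 1) $ i $ j * (if j = 1 then x else y)) = 0" for i
      using that exhaust_2[of i] sym[OF that(1)] by (auto simp: sum_2 simp del: One_nat_def)
    from det_nonzero_kernel[OF det[OF that(1)] this, of 1] det_nonzero_kernel[OF det[OF that(1)] this, of 2]
    show ?thesis by simp
  qed
  \<comment> \<open>With the special form of c the linear coefficients factor through g: for l = 1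
    they are g applied to (\<open>\<psi>\<^sub>1\<^sub>,\<^sub>1\<close>,
    \<open>\<psi>\<^sub>2\<^sub>,\<^sub>1\<close> - a), for l = 2 to
    (\<open>\<psi>\<^sub>1\<^sub>,\<^sub>2\<close> + a,
    \<open>\<psi>\<^sub>2\<^sub>,\<^sub>2\<close>). Since g is invertible, these vectors
    vanish.\<close>
  have D: "jet_deriv (Some (1, 1)) (\<psi> 1) q = 0 \<and> jet_deriv (Some (1, 1)) (\<psi> 2) q - a q = 0"
    "jet_deriv (Some (1, 2)) (\<psi> 1) q + a q = 0 \<and> jet_deriv (Some (1, 2)) (\<psi> 2) q = 0" if q: "q \<in> B" for q
  proof -
    note c = M[OF BU[OF q], unfolded monge_at_def, THEN conjunct1, THEN spec]
    note c = c[THEN conjunct1] c[THEN conjunct2, THEN conjunct1]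
      c[THEN conjunct2, THEN conjunct2, THEN conjunct1]
      c[THEN conjunct2, THEN conjunct2, THEN conjunct2]
    show "jet_deriv (Some (1, 1)) (\<psi> 1) q = 0 \<and> jet_deriv (Some (1, 1)) (\<psi> 2) q - a q = 0"
      by (rule kernel[OF q]) (use pe1[OF q, of 1 1] pe1[OF q, of 2 1] in
        \<open>simp_all add: sum_2 c[unfolded One_nat_def] sym[OF q, unfolded One_nat_def] a_def algebra_simps\<close>)
    show "jet_deriv (Some (1, 2)) (\<psi> 1) q + a q = 0 \<and> jet_deriv (Some (1, 2)) (\<psi> 2) q = 0"
      by (rule kernel[OF q]) (use pe1[OF q, of 1 2] pe1[OF q, of 2 2] in
        \<open>simp_all add: sum_2 c[unfolded One_nat_def] sym[OF q, unfolded One_nat_def] a_def algebra_simps\<close>)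
  qed
  have D3: "jet_deriv (Some (1, 2)) (\<psi> 1) q = - (C (snd q 1) 1 * \<psi> 1 q + C (snd q 1) 2 * \<psi> 2 q)" if
    "q \<in> B" for q
    using D(2)[OF that] unfolding a_def by linarith
  interpret P: planar_potential p0 K e \<psi> C B "snd p0 1"
    by unfold_locales (use Ke(1) psi D D3 in \<open>simp_all add: B_def a_def\<close>)
  define f where "f d j = jet_deriv (P.slow d) (\<psi> j) p0" for d j
  have near: "P.near u \<longleftrightarrow> (\<forall>i. \<bar>u $ i - p $ i\<bar> < e)" for u
    by (simp add: P.near_def p0(2)[simplified])
  show ?thesis
    unfolding flux_expansion_def
  proof (rule exI[of _ e], rule exI[of _ k], rule exI[of _ f], rule exI[of _ P.\<alpha>], intro conjI allI impI)
    show "0 < e" by (rule Ke(1))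
  next
    fix u :: "real ^ 2" and d i
    assume "\<forall>i. \<bar>u $ i - p $ i\<bar> < e"
    then have u: "P.near u" by (simp add: near)
    have q: "jet_set1 u p0 \<in> B" by (rule P.set1_in[OF p0B u])
    show "u \<in> U" using BU[OF q] by simp
    show "P.\<alpha> d = - (C u 1 * (f d 1 + P.\<alpha> d * (u $ 2 - p $ 2)) + C u 2 * (f d 2 - P.\<alpha> d * (u $ 1 - p $ 1)))"
      using P.slow_derivs(3)[OF u, of d] unfolding P.slow_derivs(1,2)[OF u] f_def p0(2) .
    have s: "P.slow None = None" "P.slow (Some l) = Some (0, l)" for l by (simp_all add: P.slow_def)
    show "V u $ i
       + g u $ i $ 1 * (f None 1 + P.\<alpha> None * (u $ 2 - p $ 2)
           + u $ 1 * (f (Some 1) 1 + P.\<alpha> (Some 1) * (u $ 2 - p $ 2)) + u $ 2 *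
             (f (Some 2) 1 + P.\<alpha> (Some 2) * (u $ 2 - p $ 2)))
       + g u $ i $ 2 * (f None 2 - P.\<alpha> None * (u $ 1 - p $ 1)
           + u $ 1 * (f (Some 1) 2 - P.\<alpha> (Some 1) * (u $ 1 - p $ 1)) + u $ 2 *
             (f (Some 2) 2 - P.\<alpha> (Some 2) * (u $ 1 - p $ 1)))
       = k i"
      using pe2[OF q, of i]
      unfolding P.slow_derivs(1,2)[OF u, of None, unfolded s] P.slow_derivs(1,2)[OF u, of "Some 1", unfolded s]
        P.slow_derivs(1,2)[OF u, of "Some 2", unfolded s] sum_2 f_def s jet_set1_simps p0(2)
      by (simp only: add.assoc)
  qed
qed

section \<open>Quadratic metrics\<close>

lemma DERIV_zero_const:
  fixes f :: "real \<Rightarrow> real"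
  assumes "\<And>t. \<bar>t\<bar> < e \<Longrightarrow> (f has_real_derivative 0) (at t)" "\<bar>a\<bar> < e"
  shows "f a = f 0"
proof -
  have "(f has_real_derivative 0) (at t within {-e<..<e})" if "t \<in> {-e<..<e}" for t
    using assms(1)[of t] that by (auto intro: has_field_derivative_at_within)
  then obtain k where "\<And>t. t \<in> {-e<..<e} \<Longrightarrow> f t = k"
    using has_field_derivative_zero_constant[of "{-e<..<e}" f] by (metis convex_real_interval(8))
  from this[of a] this[of 0] show ?thesis using assms(2) by (simp add: abs_less_iff)
qed

text \<open>E does not depend on x, hence neither does its y-derivative -2 \<open>c1\<close>;
  likewise \<open>c2\<close> does not depend on y. Integrating F first along x or first along y and
  comparing separates the variables, so \<open>c1\<close> and \<open>c2\<close> are affine with a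
  common slope up to sign.\<close>

lemma monge_quadratic:
  fixes E F G c1 c2 :: "real \<Rightarrow> real \<Rightarrow> real"
  assumes e: "0 < e"
    and Ex: "\<And>x y. \<bar>x\<bar> < e \<Longrightarrow> \<bar>y\<bar> < e \<Longrightarrow> ((\<lambda>x. E x y) has_real_derivative 0) (at x)"
    and Ey: "\<And>x y. \<bar>x\<bar> < e \<Longrightarrow> \<bar>y\<bar> < e \<Longrightarrow> ((\<lambda>y. E x y) has_real_derivative - 2 * c1 x y) (at y)"
    and Fx: "\<And>x y. \<bar>x\<bar> < e \<Longrightarrow> \<bar>y\<bar> < e \<Longrightarrow> ((\<lambda>x. F x y) has_real_derivative c1 x y) (at x)"
    and Fy: "\<And>x y. \<bar>x\<bar> < e \<Longrightarrow> \<bar>y\<bar> < e \<Longrightarrow> ((\<lambda>y. F x y) has_real_derivative - c2 x y) (at y)"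
    and Gx: "\<And>x y. \<bar>x\<bar> < e \<Longrightarrow> \<bar>y\<bar> < e \<Longrightarrow> ((\<lambda>x. G x y) has_real_derivative 2 * c2 x y) (at x)"
    and Gy: "\<And>x y. \<bar>x\<bar> < e \<Longrightarrow> \<bar>y\<bar> < e \<Longrightarrow> ((\<lambda>y. G x y) has_real_derivative 0) (at y)"
  shows "\<exists>\<kappa>. \<forall>x y. \<bar>x\<bar> < e \<longrightarrow> \<bar>y\<bar> < e \<longrightarrow>
    c1 x y = c1 0 0 - \<kappa> * y \<and> c2 x y = c2 0 0 + \<kappa> * x \<and>
    E x y = E 0 0 - 2 * c1 0 0 * y + \<kappa> * y ^ 2 \<and>
    F x y = F 0 0 + c1 0 0 * x - c2 0 0 * y - \<kappa> * x * y \<and>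
    G x y = G 0 0 + 2 * c2 0 0 * x + \<kappa> * x ^ 2"
proof -
  have ev: "eventually (\<lambda>t. \<bar>t\<bar> < e) (nhds t0)" if "\<bar>t0\<bar> < e" for t0 :: real
  proof -
    have "open {t :: real. \<bar>t\<bar> < e}" by (intro open_Collect_less continuous_intros)
    then show ?thesis using that unfolding eventually_nhds by (intro exI[of _ "{t. \<bar>t\<bar> < e}"]) simp
  qed
  have E0: "E x y = E 0 y" if "\<bar>x\<bar> < e" "\<bar>y\<bar> < e" for x y
    using DERIV_zero_const[OF Ex[OF _ that(2)] that(1)] .
  have G0: "G x y = G x 0" if "\<bar>x\<bar> < e" "\<bar>y\<bar> < e" for x y
    using DERIV_zero_const[OF Gy[OF that(1)] that(2)] .
  have c1: "c1 x y = c1 0 y" if x: "\<bar>x\<bar> < e" and y: "\<bar>y\<bar> < e" for x y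
  proof -
    have "\<forall>\<^sub>F t in nhds y. E x t = E 0 t"
      using ev[OF y] by eventually_elim (rule E0[OF x])
    from DERIV_unique[OF Ey[OF x y] iffD2[OF DERIV_cong_ev[OF HOL.refl this HOL.refl] Ey[of 0 y]]]
    show ?thesis using y e by simp
  qed
  have c2: "c2 x y = c2 x 0" if x: "\<bar>x\<bar> < e" and y: "\<bar>y\<bar> < e" for x y
  proof -
    have "\<forall>\<^sub>F t in nhds x. G t y = G t 0"
      using ev[OF x] by eventually_elim (rule G0[OF _ y])
    from DERIV_unique[OF Gx[OF x y] iffD2[OF DERIV_cong_ev[OF HOL.refl this HOL.refl] Gx[of x 0]]]
    show ?thesis using x e by simp
  qed
  have Fx': "F x y = F 0 y + x * c1 0 y" if x: "\<bar>x\<bar> < e" and y: "\<bar>y\<bar> < e" for x y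
  proof -
    have "((\<lambda>x. F x y - x * c1 0 y) has_real_derivative 0) (at t)" if "\<bar>t\<bar> < e" for t
      using DERIV_diff[OF Fx[OF that y] DERIV_cmult_right[OF DERIV_ident, of "c1 0 y"]] c1[OF that y] by simp
    from DERIV_zero_const[OF this x] show ?thesis by simp
  qed
  have Fy': "F x y = F x 0 - y * c2 x 0" if x: "\<bar>x\<bar> < e" and y: "\<bar>y\<bar> < e" for x y
  proof -
    have "((\<lambda>y. F x y + y * c2 x 0) has_real_derivative 0) (at t)" if "\<bar>t\<bar> < e" for t
      using DERIV_add[OF Fy[OF x that] DERIV_cmult_right[OF DERIV_ident, of "c2 x 0"]] c2[OF x that] by simp
    from DERIV_zero_const[OF this y] show ?thesis by simp
  qed
  \<comment> \<open>F at (x, y), reached from the origin along the two sides of a rectangle in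
    either order.\<close>
  have rel: "x * (c1 0 y - c1 0 0) = - y * (c2 x 0 - c2 0 0)" if x: "\<bar>x\<bar> < e" and y: "\<bar>y\<bar> < e" for x y
    using Fx'[OF x y] Fy'[OF x y] Fx'[OF x, of 0] Fy'[of 0 y] x y e by (simp add: algebra_simps)
  \<comment> \<open>A fixed nonzero probe point: inserting it for one variable in \<open>rel\<close>
    shows that the other function is affine.\<close>
  define r where "r = e / 2"
  have r: "\<bar>r\<bar> < e" "r \<noteq> 0" using e by (simp_all add: r_def)
  define \<kappa> where "\<kappa> = - (c1 0 r - c1 0 0) / r"
  have c1r: "c1 0 r - c1 0 0 = - \<kappa> * r" using r by (simp add: \<kappa>_def)
  have k2: "c2 x 0 = c2 0 0 + \<kappa> * x" if "\<bar>x\<bar> < e" for x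
  proof -
    have "r * c2 x 0 = r * (c2 0 0 + \<kappa> * x)"
      using rel[OF that r(1)] unfolding c1r by (simp add: algebra_simps)
    then show ?thesis using r(2) by simp
  qed
  have k1: "c1 0 y = c1 0 0 - \<kappa> * y" if "\<bar>y\<bar> < e" for y
  proof -
    have "r * c1 0 y = r * (c1 0 0 - \<kappa> * y)"
      using rel[OF r(1) that] unfolding k2[OF r(1)] by (simp add: algebra_simps)
    then show ?thesis using r(2) by simp
  qed
  have C1: "c1 x y = c1 0 0 - \<kappa> * y" and C2: "c2 x y = c2 0 0 + \<kappa> * x" if "\<bar>x\<bar> < e" "\<bar>y\<bar> < e" for x y
    using c1[OF that] c2[OF that] k1[OF that(2)] k2[OF that(1)] by simp_all
  have Eq: "E x y = E 0 0 - 2 * c1 0 0 * y + \<kappa> * y ^ 2" if x: "\<bar>x\<bar> < e" and y: "\<bar>y\<bar> < e" for x y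
  proof -
    have "((\<lambda>y. E 0 y + 2 * c1 0 0 * y - \<kappa> * y ^ 2) has_real_derivative 0) (at t)" if "\<bar>t\<bar> < e" for t
    proof -
      have "((\<lambda>y. E 0 y + 2 * c1 0 0 * y - \<kappa> * y ^ 2) has_real_derivative - 2 * c1 0 t + 2 * c1 0 0 * 1
        - \<kappa> * (2 * t)) (at t)"
        using that e by (intro DERIV_diff DERIV_add Ey DERIV_cmult DERIV_ident)
          (auto intro!: derivative_eq_intros)
      then show ?thesis using k1[OF that] by (simp add: algebra_simps)
    qed
    from DERIV_zero_const[OF this y] show ?thesis using E0[OF x y] by simp
  qed
  have Gq: "G x y = G 0 0 + 2 * c2 0 0 * x + \<kappa> * x ^ 2" if x: "\<bar>x\<bar> < e" and y: "\<bar>y\<bar> < e" for x y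
  proof -
    have "((\<lambda>x. G x 0 - 2 * c2 0 0 * x - \<kappa> * x ^ 2) has_real_derivative 0) (at t)" if "\<bar>t\<bar> < e" for t
    proof -
      have "((\<lambda>x. G x 0 - 2 * c2 0 0 * x - \<kappa> * x ^ 2) has_real_derivative 2 * c2 t 0 - 2 * c2 0 0 * 1 - \<kappa> *
        (2 * t)) (at t)"
        using that e by (intro DERIV_diff Gx DERIV_cmult DERIV_ident) (auto intro!: derivative_eq_intros)
      then show ?thesis using k2[OF that] by (simp add: algebra_simps)
    qed
    from DERIV_zero_const[OF this x] show ?thesis using G0[OF x y] by simp
  qed
  have Fq: "F x y = F 0 0 + c1 0 0 * x - c2 0 0 * y - \<kappa> * x * y" if x: "\<bar>x\<bar> < e" and y: "\<bar>y\<bar> < e" for x y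
    using Fx'[OF x y] Fy'[of 0 y] k1[OF y] e y by (simp add: algebra_simps)
  show ?thesis by (rule exI[of _ \<kappa>], intro allI impI conjI) (rule C1 C2 Eq Fq Gq; assumption)+
qed

text \<open>Let \<open>Q\<close> be the symmetric matrix with rows \<open>(E0, F0, a)\<close>, \<open>(F0, G0, b)\<close>, \<open>(a, b, \<kappa>)\<close>. Then
  \<open>E, F, G\<close> are the coefficients of \<open>Q\<close> on the vectors \<open>(1, 0, -y)\<close>, \<open>(0, 1, x)\<close>, and the right-hand
  side is the product of the covector \<open>(f1, f2, -\<alpha>)\<close>, the adjugate of \<open>Q\<close> and \<open>(-y, x, -1)\<close>.\<close>

lemma annihilator_identity:
  fixes E0 F0 G0 a b \<kappa> x y f1 f2 \<alpha> :: real
  assumes "E = E0 - 2 * a * y + \<kappa> * y ^ 2" "F = F0 + a * x - b * y - \<kappa> * x * y" "G = G0 + 2 * b * x + \<kappa> * x ^ 2"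
  shows "\<alpha> * (E * G - F ^ 2) + ((a - \<kappa> * y) * G - (b + \<kappa> * x) * F) * (f1 + \<alpha> * y)
      + ((b + \<kappa> * x) * E - (a - \<kappa> * y) * F) * (f2 - \<alpha> * x)
    = - ((F0 * b - G0 * a) * f1 + (a * F0 - E0 * b) * f2 - (E0 * G0 - F0 ^ 2) * \<alpha>)
      - ((G0 * \<kappa> - b ^ 2) * f1 + (a * b - F0 * \<kappa>) * f2 - (F0 * b - G0 * a) * \<alpha>) * y
      + ((a * b - F0 * \<kappa>) * f1 + (E0 * \<kappa> - a ^ 2) * f2 - (a * F0 - E0 * b) * \<alpha>) * x"
  unfolding assms by algebra

text \<open>The hypotheses say that adj(Q) kills (f1, f2, -\<open>\<alpha>\<close>), and D is det Q.
  Multiplication by Q gives D times the covector.\<close>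

lemma adjugate_kernel:
  fixes E0 F0 G0 a b \<kappa> f1 f2 \<alpha> :: real
  assumes "(F0 * b - G0 * a) * f1 + (a * F0 - E0 * b) * f2 - (E0 * G0 - F0 ^ 2) * \<alpha> = 0"
    "(G0 * \<kappa> - b ^ 2) * f1 + (a * b - F0 * \<kappa>) * f2 - (F0 * b - G0 * a) * \<alpha> = 0"
    "(a * b - F0 * \<kappa>) * f1 + (E0 * \<kappa> - a ^ 2) * f2 - (a * F0 - E0 * b) * \<alpha> = 0"
    "D = a * (F0 * b - G0 * a) + b * (a * F0 - E0 * b) + \<kappa> * (E0 * G0 - F0 ^ 2)" "D \<noteq> 0"
  shows "f1 = 0" "f2 = 0" "\<alpha> = 0"
proof -
  have "D * f1 = E0 * ((G0 * \<kappa> - b ^ 2) * f1 + (a * b - F0 * \<kappa>) * f2 - (F0 * b - G0 * a) * \<alpha>)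
     + F0 * ((a * b - F0 * \<kappa>) * f1 + (E0 * \<kappa> - a ^ 2) * f2 - (a * F0 - E0 * b) * \<alpha>)
     + a * ((F0 * b - G0 * a) * f1 + (a * F0 - E0 * b) * f2 - (E0 * G0 - F0 ^ 2) * \<alpha>)"
    unfolding assms(4) by algebra
  then show "f1 = 0" unfolding assms(1-3) using assms(5) by simp
  have "D * f2 = F0 * ((G0 * \<kappa> - b ^ 2) * f1 + (a * b - F0 * \<kappa>) * f2 - (F0 * b - G0 * a) * \<alpha>)
     + G0 * ((a * b - F0 * \<kappa>) * f1 + (E0 * \<kappa> - a ^ 2) * f2 - (a * F0 - E0 * b) * \<alpha>)
     + b * ((F0 * b - G0 * a) * f1 + (a * F0 - E0 * b) * f2 - (E0 * G0 - F0 ^ 2) * \<alpha>)"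
    unfolding assms(4) by algebra
  then show "f2 = 0" unfolding assms(1-3) using assms(5) by simp
  have "- D * \<alpha> = a * ((G0 * \<kappa> - b ^ 2) * f1 + (a * b - F0 * \<kappa>) * f2 - (F0 * b - G0 * a) * \<alpha>)
     + b * ((a * b - F0 * \<kappa>) * f1 + (E0 * \<kappa> - a ^ 2) * f2 - (a * F0 - E0 * b) * \<alpha>)
     + \<kappa> * ((F0 * b - G0 * a) * f1 + (a * F0 - E0 * b) * f2 - (E0 * G0 - F0 ^ 2) * \<alpha>)"
    unfolding assms(4) by algebra
  then show "\<alpha> = 0" unfolding assms(1-3) using assms(5) by simp
qed

text \<open>Here \<open>(C1, C2, -1)\<close> spans the kernel of the degenerate form \<open>Q\<close>, and \<open>(Z1, Z2, x Z2 - y Z1)\<close> are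
  Pluecker coordinates of a line of the congruence; \<open>Q\<close> times these coordinates is affine in \<open>x, y\<close>.\<close>

lemma complex_equations:
  fixes E0 F0 G0 C1 C2 x y Z1 Z2 z h1 h2 :: real
  assumes a: "a = E0 * C1 + F0 * C2" and b: "b = F0 * C1 + G0 * C2" and k: "\<kappa> = a * C1 + b * C2"
    and z: "z = x * Z2 - y * Z1"
    and E: "E = E0 - 2 * a * y + \<kappa> * y ^ 2" and F: "F = F0 + a * x - b * y - \<kappa> * x * y" and G: "G = G0
      + 2 * b * x + \<kappa> * x ^ 2"
    and 1: "E * Z1 + F * Z2 + (h1 - (C1 * h1 + C2 * h2) * y) = 0"
    and 2: "F * Z1 + G * Z2 + (h2 + (C1 * h1 + C2 * h2) * x) = 0"
    and n: "1 - C1 * y + C2 * x \<noteq> 0"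
  shows "E0 * (Z1 + C1 * z) + F0 * (Z2 + C2 * z) = - h1" "F0 * (Z1 + C1 * z) + G0 * (Z2 + C2 * z) = - h2"
proof -
  define R1 where "R1 = E0 * (Z1 + C1 * z) + F0 * (Z2 + C2 * z) + h1"
  define R2 where "R2 = F0 * (Z1 + C1 * z) + G0 * (Z2 + C2 * z) + h2"
  \<comment> \<open>The contraction of the two residuals with the kernel vector. The flux equations
    say that the residuals are y s and -x s; contracting these again gives a scalar equation for s
    alone.\<close>
  define s where "s = C1 * R1 + C2 * R2"
  have "E * Z1 + F * Z2 + (h1 - (C1 * h1 + C2 * h2) * y) = R1 - y * s"
    unfolding s_def R1_def R2_def E F k a b z by algebra
  then have R1: "R1 = y * s" using 1 by simp
  have "F * Z1 + G * Z2 + (h2 + (C1 * h1 + C2 * h2) * x) = R2 + x * s"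
    unfolding s_def R1_def R2_def G F k a b z by algebra
  then have R2: "R2 = - x * s" using 2 by simp
  have "s = C1 * (y * s) + C2 * (- x * s)" using s_def unfolding R1 R2 .
  then have "(1 - C1 * y + C2 * x) * s = 0" by (simp add: algebra_simps)
  then have "s = 0" using n by simp
  then have "R1 = 0" "R2 = 0" using R1 R2 by simp_all
  then show "E0 * (Z1 + C1 * z) + F0 * (Z2 + C2 * z) = - h1" "F0 * (Z1 + C1 * z) + G0 * (Z2 + C2 * z) = - h2"
    unfolding R1_def R2_def by linarith+
qed

section \<open>The congruence is linear\<close>

text \<open>Either all covectors \<open>(f d 1, f d 2, - \<alpha> d)\<close> vanish, and the flux is constant, or \<open>Q\<close> is
  degenerate, and its kernel is annihilated by these covectors.\<close>

lemma linear_congruence_local: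
  fixes Z1 Z2 E F G H L :: "real \<Rightarrow> real \<Rightarrow> real" and f :: "2 option \<Rightarrow> 2 \<Rightarrow> real" and \<alpha> :: "2 option \<Rightarrow> real"
  assumes e: "0 < e"
    and E: "\<And>x y. \<bar>x\<bar> < e \<Longrightarrow> \<bar>y\<bar> < e \<Longrightarrow> E x y = E0 - 2 * a * y + \<kappa> * y ^ 2"
    and F: "\<And>x y. \<bar>x\<bar> < e \<Longrightarrow> \<bar>y\<bar> < e \<Longrightarrow> F x y = F0 + a * x - b * y - \<kappa> * x * y"
    and G: "\<And>x y. \<bar>x\<bar> < e \<Longrightarrow> \<bar>y\<bar> < e \<Longrightarrow> G x y = G0 + 2 * b * x + \<kappa> * x ^ 2"
    and nd: "\<And>x y. \<bar>x\<bar> < e \<Longrightarrow> \<bar>y\<bar> < e \<Longrightarrow> E x y * G x y - F x y ^ 2 \<noteq> 0"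
    and c1: "\<And>x y. \<bar>x\<bar> < e \<Longrightarrow> \<bar>y\<bar> < e \<Longrightarrow> E x y * H x y + F x y * L x y = a - \<kappa> * y"
    and c2: "\<And>x y. \<bar>x\<bar> < e \<Longrightarrow> \<bar>y\<bar> < e \<Longrightarrow> F x y * H x y + G x y * L x y = b + \<kappa> * x"
    and al: "\<And>d x y. \<bar>x\<bar> < e \<Longrightarrow> \<bar>y\<bar> < e \<Longrightarrow>
      \<alpha> d = - (H x y * (f d 1 + \<alpha> d * y) + L x y * (f d 2 - \<alpha> d * x))"
    and V1: "\<And>x y. \<bar>x\<bar> < e \<Longrightarrow> \<bar>y\<bar> < e \<Longrightarrow> E x y * Z1 x y + F x y * Z2 x y + (f None 1 + \<alpha> None * y
           + (P + x) * (f (Some 1) 1 + \<alpha> (Some 1) * y) + (R + y) * (f (Some 2) 1 + \<alpha> (Some 2) * y)) = 0"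
    and V2: "\<And>x y. \<bar>x\<bar> < e \<Longrightarrow> \<bar>y\<bar> < e \<Longrightarrow> F x y * Z1 x y + G x y * Z2 x y + (f None 2 - \<alpha> None * x
           + (P + x) * (f (Some 1) 2 - \<alpha> (Some 1) * x) + (R + y) * (f (Some 2) 2 - \<alpha> (Some 2) * x)) = 0"
  shows "\<exists>e' t1 t2 m11 m12 m21 m22. 0 < e' \<and> e' \<le> e \<and> (\<forall>x y. \<bar>x\<bar> < e' \<longrightarrow> \<bar>y\<bar> < e' \<longrightarrow>
     (Z1 x y - Z1 0 0) + t1 * (x * (Z2 x y - Z2 0 0) - y * (Z1 x y - Z1 0 0)) = m11 * x + m12 * y \<and>
     (Z2 x y - Z2 0 0) + t2 * (x * (Z2 x y - Z2 0 0) - y * (Z1 x y - Z1 0 0)) = m21 * x + m22 * y)"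
proof -
  have z0: "\<bar>0::real\<bar> < e" using e by simp
  have E00: "E 0 0 = E0" "F 0 0 = F0" "G 0 0 = G0" using E[OF z0 z0] F[OF z0 z0] G[OF z0 z0] by simp_all
  define \<Delta> where "\<Delta> = E0 * G0 - F0 ^ 2"
  have \<Delta>: "\<Delta> \<noteq> 0" using nd[OF z0 z0] by (simp add: E00 \<Delta>_def)
  define D where "D = a * (F0 * b - G0 * a) + b * (a * F0 - E0 * b) + \<kappa> * (E0 * G0 - F0 ^ 2)"
  define m1 where "m1 d = (G0 * \<kappa> - b ^ 2) * f d 1 + (a * b - F0 * \<kappa>) * f d 2 - (F0 * b - G0 * a) * \<alpha> d" for d
  define m2 where "m2 d = (a * b - F0 * \<kappa>) * f d 1 + (E0 * \<kappa> - a ^ 2) * f d 2 - (a * F0 - E0 * b) * \<alpha> d" for d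
  define m3 where "m3 d = (F0 * b - G0 * a) * f d 1 + (a * F0 - E0 * b) * f d 2 -
    (E0 * G0 - F0 ^ 2) * \<alpha> d" for d
  have m: "- m3 d - m1 d * y + m2 d * x = 0" if xy: "\<bar>x\<bar> < e" "\<bar>y\<bar> < e" for d x y
  proof -
    have 1: "(a - \<kappa> * y) * G x y - (b + \<kappa> * x) * F x y = (E x y * G x y - F x y ^ 2) * H x y"
      unfolding c1[OF xy, symmetric] c2[OF xy, symmetric] by algebra
    have 2: "(b + \<kappa> * x) * E x y - (a - \<kappa> * y) * F x y = (E x y * G x y - F x y ^ 2) * L x y"
      unfolding c1[OF xy, symmetric] c2[OF xy, symmetric] by algebra
    have "- m3 d - m1 d * y + m2 d * x = \<alpha> d * (E x y * G x y - F x y ^ 2)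
        + ((a - \<kappa> * y) * G x y - (b + \<kappa> * x) * F x y) * (f d 1 + \<alpha> d * y)
        + ((b + \<kappa> * x) * E x y - (a - \<kappa> * y) * F x y) * (f d 2 - \<alpha> d * x)"
      unfolding m1_def m2_def m3_def by (rule annihilator_identity[OF E F G, OF xy xy xy, symmetric])
    also have "\<dots> = (E x y * G x y - F x y ^ 2) * (\<alpha> d + (H x y * (f d 1 + \<alpha> d * y) + L x y *
      (f d 2 - \<alpha> d * x)))"
      unfolding 1 2 by algebra
    also have "\<dots> = 0" using al[OF xy, of d] by simp
    finally show ?thesis .
  qed
  \<comment> \<open>An affine function vanishing on the whole box has zero coefficients; it is read
    off at the origin and at one point on each axis.\<close>
  have m3: "m3 d = 0" for d using m[OF z0 z0, of d] by simp
  have h: "\<bar>e / 2\<bar> < e" using e by simp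
  have m1: "m1 d = 0" for d using m[OF z0 h, of d] m3[of d] e by simp
  have m2: "m2 d = 0" for d using m[OF h z0, of d] m3[of d] e by simp
  show ?thesis
  proof (cases "D = 0")
    case False
    have f0: "f d 1 = 0" "f d 2 = 0" "\<alpha> d = 0" for d
      using adjugate_kernel[OF m3[unfolded m3_def] m1[unfolded m1_def] m2[unfolded m2_def] D_def False]
        by blast+
    have Z: "Z1 x y = 0 \<and> Z2 x y = 0" if xy: "\<bar>x\<bar> < e" "\<bar>y\<bar> < e" for x y
    proof -
      have "Z1 x y * E x y + Z2 x y * F x y = 0" "Z1 x y * F x y + Z2 x y * G x y = 0"
        using V1[OF xy] V2[OF xy] by (simp_all add: f0 mult.commute)
      from cramer_2[OF this] show ?thesis using nd[OF xy] by simp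
    qed
    show ?thesis
      by (rule exI[of _ e], (rule exI[of _ 0])+) (use Z e in auto)
  next
    case True
    \<comment> \<open>Cramer's rule for the kernel vector (K1, K2, -1) of Q: the first two rows of Q
      have the nonzero minor \<open>\<Delta>\<close>, and the third row then holds because det Q =
      0.\<close>
    define K1 where "K1 = (a * G0 - b * F0) / \<Delta>"
    define K2 where "K2 = (b * E0 - a * F0) / \<Delta>"
    have K: "K1 * \<Delta> = a * G0 - b * F0" "K2 * \<Delta> = b * E0 - a * F0"
      using \<Delta> by (simp_all add: K1_def K2_def)
    have cancel: "s = t" if "s * \<Delta> = t * \<Delta>" for s t using that \<Delta> by simp
    have a: "a = E0 * K1 + F0 * K2"
    proof (rule cancel)
      have "(E0 * K1 + F0 * K2) * \<Delta> = E0 * (K1 * \<Delta>) + F0 * (K2 * \<Delta>)" by algebra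
      then show "a * \<Delta> = (E0 * K1 + F0 * K2) * \<Delta>" unfolding K unfolding \<Delta>_def by algebra
    qed
    have b: "b = F0 * K1 + G0 * K2"
    proof (rule cancel)
      have "(F0 * K1 + G0 * K2) * \<Delta> = F0 * (K1 * \<Delta>) + G0 * (K2 * \<Delta>)" by algebra
      then show "b * \<Delta> = (F0 * K1 + G0 * K2) * \<Delta>" unfolding K unfolding \<Delta>_def by algebra
    qed
    have k: "\<kappa> = a * K1 + b * K2"
    proof (rule cancel)
      have "(a * K1 + b * K2) * \<Delta> = a * (K1 * \<Delta>) + b * (K2 * \<Delta>)" by algebra
      also have "\<dots> = \<kappa> * \<Delta> - D" unfolding K unfolding \<Delta>_def D_def by algebra
      finally show "\<kappa> * \<Delta> = (a * K1 + b * K2) * \<Delta>" using True by linarith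
    qed
    have al0: "\<alpha> d = - (K1 * f d 1 + K2 * f d 2)" for d
    proof (rule cancel)
      have "- (K1 * f d 1 + K2 * f d 2) * \<Delta> = - ((K1 * \<Delta>) * f d 1 + (K2 * \<Delta>) * f d 2)" by algebra
      also have "\<dots> = m3 d + \<alpha> d * \<Delta>" unfolding K unfolding m3_def \<Delta>_def by algebra
      finally show "\<alpha> d * \<Delta> = - (K1 * f d 1 + K2 * f d 2) * \<Delta>" using m3[of d] by linarith
    qed
    define h where "h i x y = f None i + (P + x) * f (Some 1) i + (R + y) * f (Some 2) i" for i x y
    \<comment> \<open>Small enough that \<open>\<bar>K1 * y\<bar> + \<bar>K2 * x\<bar>\<close> stays
      below 1, which keeps the factor cancelled in \<open>complex_equations\<close> away from
      0.\<close>
    define e' where "e' = min e (1 / (1 + \<bar>K1\<bar> + \<bar>K2\<bar>))"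
    have pos: "0 < 1 + \<bar>K1\<bar> + \<bar>K2\<bar>" by linarith
    have e': "0 < e'" "e' \<le> e" using e pos by (simp_all add: e'_def)
    \<comment> \<open>Cramer's rule again: after cancellation the equations have the constant matrix
      (E0, F0; F0, G0) and a right-hand side affine in x, y.\<close>
    define n11 where "n11 = (f (Some 1) 2 * F0 - f (Some 1) 1 * G0) / \<Delta>"
    define n12 where "n12 = (f (Some 2) 2 * F0 - f (Some 2) 1 * G0) / \<Delta>"
    define n21 where "n21 = (f (Some 1) 1 * F0 - f (Some 1) 2 * E0) / \<Delta>"
    define n22 where "n22 = (f (Some 2) 1 * F0 - f (Some 2) 2 * E0) / \<Delta>"
    have N: "n11 * \<Delta> = f (Some 1) 2 * F0 - f (Some 1) 1 * G0" "n12 * \<Delta> = f (Some 2) 2 * F0 - f (Some 2) 1 * G0"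
      "n21 * \<Delta> = f (Some 1) 1 * F0 - f (Some 1) 2 * E0" "n22 * \<Delta> = f (Some 2) 1 * F0 - f (Some 2) 2 * E0"
      using \<Delta> by (simp_all add: n11_def n12_def n21_def n22_def)
    have W: "(Z1 x y + K1 * (x * Z2 x y - y * Z1 x y)) * \<Delta> = - h 1 x y * G0 - - h 2 x y * F0 \<and>
        (Z2 x y + K2 * (x * Z2 x y - y * Z1 x y)) * \<Delta> = - h 2 x y * E0 - - h 1 x y * F0"
      if xy: "\<bar>x\<bar> < e'" "\<bar>y\<bar> < e'" for x y
    proof -
      have xy': "\<bar>x\<bar> < e" "\<bar>y\<bar> < e" using xy e'(2) by linarith+
      have "\<bar>K1 * y\<bar> + \<bar>K2 * x\<bar> \<le> \<bar>K1\<bar> * e' + \<bar>K2\<bar> * e'"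
        unfolding abs_mult using xy by (intro add_mono mult_left_mono) auto
      also have "\<dots> = (\<bar>K1\<bar> + \<bar>K2\<bar>) * e'" by algebra
      also have "\<dots> \<le> (\<bar>K1\<bar> + \<bar>K2\<bar>) * (1 / (1 + \<bar>K1\<bar> + \<bar>K2\<bar>))"
        by (intro mult_left_mono) (auto simp: e'_def)
      also have "\<dots> < 1" using pos by (simp add: divide_less_eq)
      finally have n: "1 - K1 * y + K2 * x \<noteq> 0" by linarith
      have h1: "E x y * Z1 x y + F x y * Z2 x y + (h 1 x y - (K1 * h 1 x y + K2 * h 2 x y) * y) = 0"
        using V1[OF xy'] unfolding al0 h_def by (simp add: algebra_simps)
      have h2: "F x y * Z1 x y + G x y * Z2 x y + (h 2 x y + (K1 * h 1 x y + K2 * h 2 x y) * x) = 0"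
        using V2[OF xy'] unfolding al0 h_def by (simp add: algebra_simps)
      note ce = complex_equations[OF a b k HOL.refl E[OF xy'] F[OF xy'] G[OF xy'] h1 h2 n]
      show ?thesis
        using cramer_2[of "Z1 x y + K1 * (x * Z2 x y - y * Z1 x y)" E0 "Z2 x y + K2 *
          (x * Z2 x y - y * Z1 x y)" F0 "- h 1 x y" G0 "- h 2 x y"] ce
        unfolding \<Delta>_def by (simp add: mult.commute)
    qed
    have h0: "h i x y = h i 0 0 + x * f (Some 1) i + y * f (Some 2) i" for i x y
      by (simp add: h_def algebra_simps)
    have W0: "Z1 0 0 * \<Delta> = - h 1 0 0 * G0 - - h 2 0 0 * F0" "Z2 0 0 * \<Delta> = - h 2 0 0 * E0 - - h 1 0 0 * F0"
      using W[of 0 0] e' by simp_all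
    have Wn: "Z1 x y + K1 * (x * Z2 x y - y * Z1 x y) = Z1 0 0 + n11 * x + n12 * y \<and>
       Z2 x y + K2 * (x * Z2 x y - y * Z1 x y) = Z2 0 0 + n21 * x + n22 * y"
      (is "?l1 = ?r1 \<and> ?l2 = ?r2") if xy: "\<bar>x\<bar> < e'" "\<bar>y\<bar> < e'" for x y
    proof (intro conjI; rule cancel)
      have "?r1 * \<Delta> = Z1 0 0 * \<Delta> + n11 * \<Delta> * x + n12 * \<Delta> * y" by algebra
      then have A: "?r1 * \<Delta> = - h 1 0 0 * G0 - - h 2 0 0 * F0
          + (f (Some 1) 2 * F0 - f (Some 1) 1 * G0) * x + (f (Some 2) 2 * F0 - f (Some 2) 1 * G0) * y"
        unfolding N W0 .
      show "?l1 * \<Delta> = ?r1 * \<Delta>"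
        unfolding A conjunct1[OF W[OF xy]] h0[of _ x y] by algebra
      have "?r2 * \<Delta> = Z2 0 0 * \<Delta> + n21 * \<Delta> * x + n22 * \<Delta> * y" by algebra
      then have A: "?r2 * \<Delta> = - h 2 0 0 * E0 - - h 1 0 0 * F0
          + (f (Some 1) 1 * F0 - f (Some 1) 2 * E0) * x + (f (Some 2) 1 * F0 - f (Some 2) 2 * E0) * y"
        unfolding N W0 .
      show "?l2 * \<Delta> = ?r2 * \<Delta>"
        unfolding A conjunct2[OF W[OF xy]] h0[of _ x y] by algebra
    qed
    \<comment> \<open>Shifting the flux to vanish at the centre changes x Z2 - y Z1 by a linear
      function, which is absorbed into the coefficients on the right.\<close>
    have "(Z1 x y - Z1 0 0) + K1 * (x * (Z2 x y - Z2 0 0) - y * (Z1 x y - Z1 0 0)) = (n11 - K1 * Z2 0 0) * x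
      + (n12 + K1 * Z1 0 0) * y \<and>
        (Z2 x y - Z2 0 0) + K2 * (x * (Z2 x y - Z2 0 0) - y * (Z1 x y - Z1 0 0)) = (n21 - K2 * Z2 0 0) * x +
          (n22 + K2 * Z1 0 0) * y"
      (is "?l1 = ?r1 \<and> ?l2 = ?r2") if xy: "\<bar>x\<bar> < e'" "\<bar>y\<bar> < e'" for x y
    proof
      have "?l1
          = (Z1 x y + K1 * (x * Z2 x y - y * Z1 x y)) - Z1 0 0 - K1 * (x * Z2 0 0 - y * Z1 0 0)" by algebra
      then show "?l1 = ?r1"
        unfolding conjunct1[OF Wn[OF xy]] by algebra
      have "?l2
          = (Z2 x y + K2 * (x * Z2 x y - y * Z1 x y)) - Z2 0 0 - K2 * (x * Z2 0 0 - y * Z1 0 0)" by algebra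
      then show "?l2 = ?r2"
        unfolding conjunct2[OF Wn[OF xy]] by algebra
    qed
    with e' show ?thesis by blast
  qed
qed

text \<open>Converts the equations for \<open>g\<^sup>i\<^sup>j\<close> into those for the inverse
  metric (r, -q; -q, p) / D. The key is that D satisfies D' = -2 L D.\<close>

lemma inverse_metric_deriv_1:
  fixes p q r :: "real \<Rightarrow> real"
  assumes p: "(p has_real_derivative - 2 * K * q t) (at t)"
    and q: "(q has_real_derivative - K * r t - L * q t) (at t)"
    and r: "(r has_real_derivative - 2 * L * r t) (at t)"
    and D: "\<And>t. D t = p t * r t - q t ^ 2" and D0: "D t \<noteq> 0"
  shows "((\<lambda>t. r t / D t) has_real_derivative 0) (at t)"
    and "((\<lambda>t. - q t / D t) has_real_derivative K * (r t / D t) + L * (- q t / D t)) (at t)"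
    and "((\<lambda>t. p t / D t) has_real_derivative 2 * (K * (- q t / D t) + L * (p t / D t))) (at t)"
proof -
  have "D = (\<lambda>t. p t * r t - q t * q t)" by (rule ext) (simp add: D power2_eq_square)
  then have "(D has_real_derivative (- 2 * K * q t) * r t + (- 2 * L * r t) * p t
      - ((- K * r t - L * q t) * q t + (- K * r t - L * q t) * q t)) (at t)"
    by (simp only:) (intro DERIV_diff DERIV_mult p q r)
  then have DD: "(D has_real_derivative - 2 * L * D t) (at t)"
    by (rule DERIV_cong) (simp add: D power2_eq_square algebra_simps)
  show "((\<lambda>t. r t / D t) has_real_derivative 0) (at t)"
    by (rule DERIV_cong[OF DERIV_divide[OF r DD D0]]) (simp add: algebra_simps)
  show "((\<lambda>t. - q t / D t) has_real_derivative K * (r t / D t) + L * (- q t / D t)) (at t)"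
    by (rule DERIV_cong[OF DERIV_divide[OF DERIV_minus[OF q] DD D0]]) (use D0 in \<open>simp add: field_simps\<close>)
  show "((\<lambda>t. p t / D t) has_real_derivative 2 * (K * (- q t / D t) + L * (p t / D t))) (at t)"
    by (rule DERIV_cong[OF DERIV_divide[OF p DD D0]]) (use D0 in \<open>simp add: field_simps\<close>)
qed

text \<open>The lines of the congruence through the parameter values near \<open>p\<close> lie in a linear line complex.\<close>

definition in_line_complex :: "(real ^ 2 \<Rightarrow> real ^ 2) \<Rightarrow> real ^ 2 \<Rightarrow> real \<Rightarrow> 2 \<Rightarrow> real \<Rightarrow> real \<Rightarrow> real \<Rightarrow> bool" where
  "in_line_complex V p e i t m n \<longleftrightarrow> (\<forall>x y. \<bar>x\<bar> < e \<longrightarrow> \<bar>y\<bar> < e \<longrightarrow>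
     (V (p + vector [x, y]) $ i - V p $ i) + t * (x * (V (p + vector [x, y]) $ 2 - V p $ 2) - y *
       (V (p + vector [x, y]) $ 1 - V p $ 1)) = m * x + n * y)"

lemma smooth_on_differentiable: "smooth_on U f \<Longrightarrow> u \<in> U \<Longrightarrow> f differentiable (at u)"
  using Ck_on.simps(2)[of 0 U f] unfolding smooth_on_def by blast

text \<open>Centres the coordinates at \<open>p\<close>, passes to the inverse metric E, F, G,
  determines it by \<open>monge_quadratic\<close>, and hands the flux equations with lowered index
  to \<open>linear_congruence_local\<close>. The integration constants \<open>k i\<close> drop out
  because only differences of V enter the complexes.\<close>

lemma hamiltonian_linear_congruence:
  fixes g :: "real ^ 2 \<Rightarrow> real ^ 2 ^ 2" and c :: "real ^ 2 \<Rightarrow> real ^ 2 ^ 2 ^ 2"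
  assumes U: "open U" and smooth: "smooth_on U V" "smooth_on U g" "smooth_on U c"
    and nd: "nondegenerate_metric U g" and HO: "hamiltonian_operator U g c" and H:
      "hamiltonian_system U g c V" and p: "p \<in> U"
  shows "\<exists>e t1 t2 m11 m12 m21 m22. 0 < e \<and> in_line_complex V p e 1 t1 m11 m12
    \<and> in_line_complex V p e 2 t2 m21 m22"
proof -
  note V = smooth_on_differentiable[OF smooth(1)] and g = smooth_on_differentiable[OF smooth(2)]
    and c = smooth_on_differentiable[OF smooth(3)]
  obtain C where M: "\<And>u. u \<in> U \<Longrightarrow> monge_at g c u (C u)"
    using monge_structure[OF U g c nd _ HO HOL.refl] by metis
  have dC: "dir_deriv g 1 u $ 1 $ 1 = - 2 * C u 1 * g u $ 1 $ 2" "dir_deriv g 2 u $ 1 $ 1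
    = 2 * C u 1 * g u $ 1 $ 1"
    "dir_deriv g 1 u $ 1 $ 2 = - C u 1 * g u $ 2 $ 2 - C u 2 * g u $ 1 $ 2" "dir_deriv g 2 u $ 1 $ 2
      = C u 1 * g u $ 1 $ 2 + C u 2 * g u $ 1 $ 1"
    "dir_deriv g 1 u $ 2 $ 2 = - 2 * C u 2 * g u $ 2 $ 2" "dir_deriv g 2 u $ 2 $ 2
      = 2 * C u 2 * g u $ 1 $ 2" if "u \<in> U" for u
    using M[OF that] unfolding monge_at_def by simp_all
  obtain W h where WH: "hamiltonian_with U g c V W h" using H by (auto simp: hamiltonian_system_def)
  have "\<exists>e k f \<alpha>. flux_expansion U V g C p e k f \<alpha>"
    using V g c nd WH p M by (rule hamiltonian_flux_structure)
  then obtain e k f \<alpha> where fe: "flux_expansion U V g C p e k f \<alpha>" by blast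
  note e = conjunct1[OF fe[unfolded flux_expansion_def]] and S = conjunct2[OF fe[unfolded flux_expansion_def]]
  have in_U: "u \<in> U" if "\<forall>i. \<bar>u $ i - p $ i\<bar> < e" for u using S that by blast
  note al = S[THEN spec, THEN mp, THEN conjunct2, THEN conjunct1, THEN spec]
  note fl = S[THEN spec, THEN mp, THEN conjunct2, THEN conjunct2, THEN spec]
  define v where "v x y = p + vector [x, y]" for x y :: real
  have v12: "v x y $ 1 = p $ 1 + x" "v x y $ 2 = p $ 2 + y" for x y by (simp_all add: v_def)
  have near: "\<forall>i. \<bar>v x y $ i - p $ i\<bar> < e" if "\<bar>x\<bar> < e" "\<bar>y\<bar> < e" for x y
    using that by (simp add: forall_2 v12)
  note vU = in_U[OF near]
  define D where "D u = g u $ 1 $ 1 * g u $ 2 $ 2 - g u $ 1 $ 2 ^ 2" for u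
  have sym: "g u $ 2 $ 1 = g u $ 1 $ 2" and D0: "D u \<noteq> 0" if "u \<in> U" for u
  proof -
    have t: "transpose (g u) = g u" and d: "det (g u) \<noteq> 0"
      using nd that by (auto simp: nondegenerate_metric_def)
    have "transpose (g u) $ 1 $ 2 = g u $ 1 $ 2" using t by simp
    then show s: "g u $ 2 $ 1 = g u $ 1 $ 2" by (simp add: transpose_def)
    show "D u \<noteq> 0" using d s by (simp add: det_2 D_def power2_eq_square)
  qed
  have v_shift: "v (x + s) y = v x y + s *\<^sub>R axis 1 1" "v x (y + s) = v x y + s *\<^sub>R axis 2 1" for x y s
    by (simp_all add: vec_eq_iff forall_2 v12 axis_def)
  have dx: "((\<lambda>x. g (v x y) $ i $ j) has_real_derivative dir_deriv g 1 (v x y) $ i $ j) (at x)"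
    if xy: "\<bar>x\<bar> < e" "\<bar>y\<bar> < e" for x y i j
    using DERIV_dir2[OF g[OF vU[OF xy]], of 1 i j] DERIV_shift[of "\<lambda>x. g (v x y) $ i $ j" _ 0 x]
    by (simp add: v_shift add.commute[of _ x])
  have dy: "((\<lambda>y. g (v x y) $ i $ j) has_real_derivative dir_deriv g 2 (v x y) $ i $ j) (at y)"
    if xy: "\<bar>x\<bar> < e" "\<bar>y\<bar> < e" for x y i j
    using DERIV_dir2[OF g[OF vU[OF xy]], of 2 i j] DERIV_shift[of "\<lambda>y. g (v x y) $ i $ j" _ 0 y]
    by (simp add: v_shift add.commute[of _ y])
  define E where "E x y = g (v x y) $ 2 $ 2 / D (v x y)" for x y
  define F where "F x y = - g (v x y) $ 1 $ 2 / D (v x y)" for x y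
  define G where "G x y = g (v x y) $ 1 $ 1 / D (v x y)" for x y
  define C1 where "C1 x y = C (v x y) 1" for x y
  define C2 where "C2 x y = C (v x y) 2" for x y
  define c1 where "c1 x y = E x y * C1 x y + F x y * C2 x y" for x y
  define c2 where "c2 x y = F x y * C1 x y + G x y * C2 x y" for x y
  have X: "((\<lambda>x. E x y) has_real_derivative 0) (at x)" "((\<lambda>x. F x y) has_real_derivative c1 x y) (at x)"
    "((\<lambda>x. G x y) has_real_derivative 2 * c2 x y) (at x)" if xy: "\<bar>x\<bar> < e" "\<bar>y\<bar> < e" for x y
  proof -
    note d = dC[OF vU[OF xy]]
    note i = inverse_metric_deriv_1[where p = "\<lambda>x. g (v x y) $ 1 $ 1" and q = "\<lambda>x. g (v x y) $ 1 $ 2" and r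
      = "\<lambda>x. g (v x y) $ 2 $ 2"
        and D = "\<lambda>x. D (v x y)" and t = x and K = "C (v x y) 1" and L = "C (v x y) 2",
        OF dx[OF xy, of 1 1, unfolded d] dx[OF xy, of 1 2, unfolded d] dx[OF xy, of 2 2, unfolded d] D_def
          D0[OF vU[OF xy]]]
    show "((\<lambda>x. E x y) has_real_derivative 0) (at x)" "((\<lambda>x. F x y) has_real_derivative c1 x y) (at x)"
      "((\<lambda>x. G x y) has_real_derivative 2 * c2 x y) (at x)"
      using i unfolding E_def F_def G_def c1_def c2_def by (simp_all add: C1_def C2_def mult.commute)
  qed
  have Y: "((\<lambda>y. E x y) has_real_derivative - 2 * c1 x y) (at y)"
    "((\<lambda>y. F x y) has_real_derivative - c2 x y) (at y)"
    "((\<lambda>y. G x y) has_real_derivative 0) (at y)" if xy: "\<bar>x\<bar> < e" "\<bar>y\<bar> < e" for x y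
  proof -
    note d = dC[OF vU[OF xy]]
    have d': "((\<lambda>y. g (v x y) $ 2 $ 2) has_real_derivative - 2 * (- C (v x y) 2) * g (v x y) $ 1 $ 2) (at y)"
      "((\<lambda>y. g (v x y) $ 1 $ 2) has_real_derivative - (- C (v x y) 2) * g (v x y) $ 1 $ 1 -
        (- C (v x y) 1) * g (v x y) $ 1 $ 2) (at y)"
      "((\<lambda>y. g (v x y) $ 1 $ 1) has_real_derivative - 2 * (- C (v x y) 1) * g (v x y) $ 1 $ 1) (at y)"
      using dy[OF xy, of 1 1] dy[OF xy, of 1 2] dy[OF xy, of 2 2] by (simp_all add: d add.commute)
    have D': "D (v x t) = g (v x t) $ 2 $ 2 * g (v x t) $ 1 $ 1 - g (v x t) $ 1 $ 2 ^ 2" for t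
      by (simp add: D_def)
    \<comment> \<open>The second direction is the first with the two indices exchanged. The skew
      symbol changes sign under the exchange, whence the negative \<open>K\<close> and
      \<open>L\<close>.\<close>
    note i = inverse_metric_deriv_1[where p = "\<lambda>y. g (v x y) $ 2 $ 2" and q = "\<lambda>y. g (v x y) $ 1 $ 2" and r
      = "\<lambda>y. g (v x y) $ 1 $ 1"
        and D = "\<lambda>y. D (v x y)" and t = y and K = "- C (v x y) 2" and L = "- C (v x y) 1",
        OF d' D' D0[OF vU[OF xy]]]
    show "((\<lambda>y. E x y) has_real_derivative - 2 * c1 x y) (at y)"
      unfolding E_def by (rule DERIV_cong[OF i(3)]) (simp add: c1_def C1_def C2_def E_def F_def algebra_simps)
    show "((\<lambda>y. F x y) has_real_derivative - c2 x y) (at y)"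
      unfolding F_def by (rule DERIV_cong[OF i(2)]) (simp add: c2_def C1_def C2_def F_def G_def algebra_simps)
    show "((\<lambda>y. G x y) has_real_derivative 0) (at y)"
      unfolding G_def by (rule i(1))
  qed
  have nz: "E x y * G x y - F x y ^ 2 \<noteq> 0" if xy: "\<bar>x\<bar> < e" "\<bar>y\<bar> < e" for x y
  proof -
    have "E x y * G x y - F x y ^ 2 = D (v x y) / (D (v x y)) ^ 2"
      unfolding E_def F_def G_def by (simp add: D_def power2_eq_square diff_divide_distrib mult.commute)
    then show ?thesis using D0[OF vU[OF xy]] by simp
  qed
  have "\<exists>\<kappa>. \<forall>x y. \<bar>x\<bar> < e \<longrightarrow> \<bar>y\<bar> < e \<longrightarrow>
    c1 x y = c1 0 0 - \<kappa> * y \<and> c2 x y = c2 0 0 + \<kappa> * x \<and>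
    E x y = E 0 0 - 2 * c1 0 0 * y + \<kappa> * y ^ 2 \<and>
    F x y = F 0 0 + c1 0 0 * x - c2 0 0 * y - \<kappa> * x * y \<and>
    G x y = G 0 0 + 2 * c2 0 0 * x + \<kappa> * x ^ 2"
    using e X(1) Y(1) X(2) Y(2) X(3) Y(3) by (rule monge_quadratic)
  then obtain \<kappa> where q: "\<forall>x y. \<bar>x\<bar> < e \<longrightarrow> \<bar>y\<bar> < e \<longrightarrow>
    c1 x y = c1 0 0 - \<kappa> * y \<and> c2 x y = c2 0 0 + \<kappa> * x \<and>
    E x y = E 0 0 - 2 * c1 0 0 * y + \<kappa> * y ^ 2 \<and>
    F x y = F 0 0 + c1 0 0 * x - c2 0 0 * y - \<kappa> * x * y \<and>
    G x y = G 0 0 + 2 * c2 0 0 * x + \<kappa> * x ^ 2" ..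
  have k1: "c1 x y = c1 0 0 - \<kappa> * y" and k2: "c2 x y = c2 0 0 + \<kappa> * x"
    and kE: "E x y = E 0 0 - 2 * c1 0 0 * y + \<kappa> * y ^ 2"
    and kF: "F x y = F 0 0 + c1 0 0 * x - c2 0 0 * y - \<kappa> * x * y"
    and kG: "G x y = G 0 0 + 2 * c2 0 0 * x + \<kappa> * x ^ 2" if "\<bar>x\<bar> < e" "\<bar>y\<bar> < e" for x y
    using q[rule_format, OF that] by - ((elim conjE, assumption)+)
  define A where "A i x y = f None i + (if i = 1 then \<alpha> None * y else - \<alpha> None * x)
    + (p $ 1 + x) * (f (Some 1) i + (if i = 1 then \<alpha> (Some 1) * y else - \<alpha> (Some 1) * x))
    + (p $ 2 + y) * (f (Some 2) i + (if i = 1 then \<alpha> (Some 2) * y else - \<alpha> (Some 2) * x))" for i x y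
  have Z: "V (v x y) $ i - k i = - (g (v x y) $ i $ 1 * A 1 x y + g (v x y) $ i $ 2 * A 2 x y)"
    if xy: "\<bar>x\<bar> < e" "\<bar>y\<bar> < e" for x y i
    using fl[OF near[OF xy], of i] by (simp add: A_def v12)
  \<comment> \<open>The inverse matrix applied to the flux equations; this isolates the components
    of the covector.\<close>
  have lower: "(r / \<Delta>) * - (p' * a + q * b) + (- q / \<Delta>) * - (q * a + r * b) + a = 0"
    "(- q / \<Delta>) * - (p' * a + q * b) + (p' / \<Delta>) * - (q * a + r * b) + b = 0"
    if "\<Delta> = p' * r - q ^ 2" "\<Delta> \<noteq> 0" for p' q r a b \<Delta> :: real
    using that(2) by (simp_all add: field_simps) (simp_all add: that(1) power2_eq_square algebra_simps)
  have L1: "E x y * (V (v x y) $ 1 - k 1) + F x y * (V (v x y) $ 2 - k 2) + A 1 x y = 0"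
    and L2: "F x y * (V (v x y) $ 1 - k 1) + G x y * (V (v x y) $ 2 - k 2) + A 2 x y = 0"
    if xy: "\<bar>x\<bar> < e" "\<bar>y\<bar> < e" for x y
    using lower[OF D_def D0[OF vU[OF xy]]] unfolding Z[OF xy] E_def F_def G_def sym[OF vU[OF xy]] by simp_all
  have R0: "\<exists>e' t1 t2 m11 m12 m21 m22. 0 < e' \<and> e' \<le> e \<and> (\<forall>x y. \<bar>x\<bar> < e' \<longrightarrow> \<bar>y\<bar> < e' \<longrightarrow>
     ((V (v x y) $ 1 - k 1) - (V (v 0 0) $ 1 - k 1)) + t1 * (x * ((V (v x y) $ 2 - k 2) - (V (v 0 0) $ 2 - k 2))
         - y * ((V (v x y) $ 1 - k 1) - (V (v 0 0) $ 1 - k 1))) = m11 * x + m12 * y \<and>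
     ((V (v x y) $ 2 - k 2) - (V (v 0 0) $ 2 - k 2)) + t2 * (x * ((V (v x y) $ 2 - k 2) - (V (v 0 0) $ 2 - k 2))
         - y * ((V (v x y) $ 1 - k 1) - (V (v 0 0) $ 1 - k 1))) = m21 * x + m22 * y)"
  proof (rule linear_congruence_local[OF e kE kF kG nz, where H = C1 and L = C2 and f = f and \<alpha> = \<alpha>
        and P = "p $ 1" and R = "p $ 2"])
    fix x y :: real and d assume xy: "\<bar>x\<bar> < e" "\<bar>y\<bar> < e"
    show "E x y * C1 x y + F x y * C2 x y = c1 0 0 - \<kappa> * y" using k1[OF xy] by (simp only: c1_def)
    show "F x y * C1 x y + G x y * C2 x y = c2 0 0 + \<kappa> * x" using k2[OF xy] by (simp only: c2_def)
    show "\<alpha> d = - (C1 x y * (f d 1 + \<alpha> d * y) + C2 x y * (f d 2 - \<alpha> d * x))"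
      using al[OF near[OF xy], of d] unfolding v12 C1_def C2_def by (simp only: add_diff_cancel_left')
    show "E x y * (V (v x y) $ 1 - k 1) + F x y * (V (v x y) $ 2 - k 2) + (f None 1 + \<alpha> None * y
           + (p $ 1 + x) * (f (Some 1) 1 + \<alpha> (Some 1) * y) + (p $ 2 + y) * (f (Some 2) 1 + \<alpha> (Some 2) * y)) = 0"
      using L1[OF xy] by (simp add: A_def)
    show "F x y * (V (v x y) $ 1 - k 1) + G x y * (V (v x y) $ 2 - k 2) + (f None 2 - \<alpha> None * x
           + (p $ 1 + x) * (f (Some 1) 2 - \<alpha> (Some 1) * x) + (p $ 2 + y) * (f (Some 2) 2 - \<alpha> (Some 2) * x)) = 0"
      using L2[OF xy] by (simp add: A_def)
  qed
  have v0: "v 0 0 = p" by (simp add: vec_eq_iff forall_2 v12)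
  have cancel: "s - l - (t - l) = s - t" for s t l :: real by simp
  show ?thesis
    using R0 unfolding in_line_complex_def v_def[symmetric] v0 cancel by blast
qed

section \<open>Reduction to the diagonal linear system\<close>

lemma frechet_derivative_eqI: "(f has_derivative f') (at x) \<Longrightarrow> frechet_derivative f (at x) = f'"
  by (rule frechet_derivative_at[symmetric])

lemma differentiableD: "f differentiable (at x) \<Longrightarrow> (f has_derivative frechet_derivative f (at x)) (at x)"
  using frechet_derivative_works by blast

lemma Ck_on_cong:
  assumes S: "open S" and "\<And>x. x \<in> S \<Longrightarrow> f x = g x" "Ck_on k S g"
  shows "Ck_on k S f"
  using assms(2,3)
proof (induction k arbitrary: f g)
  case 0
  then show ?case using continuous_on_cong[of S S f g] by simp
next
  case (Suc k)
  have d: "(f has_derivative frechet_derivative g (at x)) (at x)" if x: "x \<in> S" for x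
  proof (rule has_derivative_transform_within_open[OF _ S x])
    have "g differentiable (at x)" using Suc.prems(2) x by simp
    then show "(g has_derivative frechet_derivative g (at x)) (at x)" by (rule differentiableD)
  qed (rule Suc.prems(1)[symmetric])
  show ?case unfolding Ck_on.simps
  proof (intro conjI ballI)
    show "f differentiable (at x)" if "x \<in> S" for x using d[OF that] by (rule differentiableI)
    fix e :: 'a assume "e \<in> Basis"
    then have ck: "Ck_on k S (\<lambda>x. frechet_derivative g (at x) e)" using Suc.prems(2) by simp
    have eq: "frechet_derivative f (at x) e = frechet_derivative g (at x) e" if "x \<in> S" for x
      by (simp only: frechet_derivative_eqI[OF d[OF that]])
    show "Ck_on k S (\<lambda>x. frechet_derivative f (at x) e)"
      using eq ck by (rule Suc.IH)
  qed
qed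

lemma Ck_on_SucI:
  assumes S: "open S" and d: "\<And>x. x \<in> S \<Longrightarrow> (f has_derivative f' x) (at x)"
    and C: "\<And>e. e \<in> Basis \<Longrightarrow> Ck_on k S (\<lambda>x. f' x e)"
  shows "Ck_on (Suc k) S f"
  unfolding Ck_on.simps
proof (intro conjI ballI)
  show "f differentiable (at x)" if "x \<in> S" for x using d[OF that] by (rule differentiableI)
  fix e :: 'a assume e: "e \<in> Basis"
  show "Ck_on k S (\<lambda>x. frechet_derivative f (at x) e)"
    by (rule Ck_on_cong[OF S _ C[OF e]]) (simp only: frechet_derivative_eqI[OF d])
qed

lemma Ck_on_SucD:
  assumes "Ck_on (Suc k) S f"
  shows "x \<in> S \<Longrightarrow> (f has_derivative frechet_derivative f (at x)) (at x)"
    and "e \<in> Basis \<Longrightarrow> Ck_on k S (\<lambda>x. frechet_derivative f (at x) e)"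
proof -
  show "(f has_derivative frechet_derivative f (at x)) (at x)" if "x \<in> S"
    using assms that by (intro differentiableD) simp
  show "Ck_on k S (\<lambda>x. frechet_derivative f (at x) e)" if "e \<in> Basis"
    using assms that by simp
qed

lemma Ck_on_imp_continuous_on:
  assumes "Ck_on k S f" shows "continuous_on S f"
proof (cases k)
  case 0 then show ?thesis using assms by simp
next
  case (Suc m)
  then have "f differentiable (at x)" if "x \<in> S" for x using assms that by simp
  then show ?thesis by (intro continuous_at_imp_continuous_on ballI differentiable_imp_continuous_within)
qed

lemma Ck_on_mono: "Ck_on (Suc k) S f \<Longrightarrow> Ck_on k S f"
proof (induction k arbitrary: f)
  case 0
  then show ?case using Ck_on_imp_continuous_on[OF 0] by simp
next
  case (Suc k)
  have "(\<forall>x\<in>S. f differentiable (at x)) \<and> (\<forall>e\<in>Basis. Ck_on (Suc k) S (\<lambda>x. frechet_derivative f (at x) e))"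
    by (rule Suc.prems[unfolded Ck_on.simps(2)[of "Suc k"]])
  then have d: "\<forall>x\<in>S. f differentiable (at x)" and c: "\<forall>e\<in>Basis. Ck_on (Suc k) S
    (\<lambda>x. frechet_derivative f (at x) e)"
    by (rule conjunct1, rule conjunct2)
  have "\<forall>e\<in>Basis. Ck_on k S (\<lambda>x. frechet_derivative f (at x) e)"
    by (rule ballI, rule Suc.IH, rule bspec[OF c])
  with d show ?case unfolding Ck_on.simps(2)[of k] by (rule conjI)
qed

lemma Ck_on_add:
  assumes S: "open S" and "Ck_on k S f" "Ck_on k S g"
  shows "Ck_on k S (\<lambda>x. f x + g x)"
  using assms(2,3)
proof (induction k arbitrary: f g)
  case (Suc k)
  show ?case
    by (rule Ck_on_SucI[OF S has_derivative_add[OF Ck_on_SucD(1)[OF Suc.prems(1)]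
      Ck_on_SucD(1)[OF Suc.prems(2)]]])
      (simp_all only: Suc.IH Ck_on_SucD(2)[OF Suc.prems(1)] Ck_on_SucD(2)[OF Suc.prems(2)])
qed (auto intro!: continuous_intros)

lemma Ck_on_scaleR_const:
  assumes S: "open S" and "Ck_on k S f"
  shows "Ck_on k S (\<lambda>x. (f x :: real) *\<^sub>R v)"
  using assms(2)
proof (induction k arbitrary: f)
  case (Suc k)
  show ?case
    by (rule Ck_on_SucI[OF S has_derivative_scaleR_left[OF Ck_on_SucD(1)[OF Suc.prems]]])
      (simp_all only: Suc.IH Ck_on_SucD(2)[OF Suc.prems])
qed (auto intro!: continuous_intros)

lemma Ck_on_mult:
  fixes f g :: "'a::euclidean_space \<Rightarrow> real"
  assumes S: "open S" and "Ck_on k S f" "Ck_on k S g"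
  shows "Ck_on k S (\<lambda>x. f x * g x)"
  using assms(2,3)
proof (induction k arbitrary: f g)
  case (Suc k)
  show ?case
    by (rule Ck_on_SucI[OF S has_derivative_mult[OF Ck_on_SucD(1)[OF Suc.prems(1)]
      Ck_on_SucD(1)[OF Suc.prems(2)]]])
      (simp_all only: Ck_on_add[OF S] Suc.IH Ck_on_SucD(2)[OF Suc.prems(1)] Ck_on_SucD(2)[OF Suc.prems(2)]
        Ck_on_mono[OF Suc.prems(1)] Ck_on_mono[OF Suc.prems(2)])
qed (auto intro!: continuous_intros)

lemma Ck_on_inverse:
  fixes f :: "'a::euclidean_space \<Rightarrow> real"
  assumes S: "open S" and "Ck_on k S f" and nz: "\<And>x. x \<in> S \<Longrightarrow> f x \<noteq> 0"
  shows "Ck_on k S (\<lambda>x. inverse (f x))"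
  using assms(2)
proof (induction k)
  case 0
  then show ?case using nz by (auto intro!: continuous_intros)
next
  case (Suc k)
  have I: "Ck_on k S (\<lambda>x. inverse (f x))" by (rule Suc.IH[OF Ck_on_mono[OF Suc.prems]])
  have d: "((\<lambda>x. inverse (f x)) has_derivative (\<lambda>h. (-1) *
    (inverse (f x) * (frechet_derivative f (at x) h * inverse (f x))))) (at x)"
    if "x \<in> S" for x
    using Deriv.has_derivative_inverse[OF nz[OF that] Ck_on_SucD(1)[OF Suc.prems that]] by
      (simp add: mult.assoc)
  show ?case
    by (rule Ck_on_SucI[OF S d])
      (assumption | intro Ck_on_mult[OF S] Ck_on_const I Ck_on_SucD(2)[OF Suc.prems])+
qed

lemma Ck_on_linear:
  assumes S: "open S" and f: "bounded_linear f"
  shows "Ck_on k S f"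
proof (cases k)
  case 0
  then show ?thesis using f by (simp add: linear_continuous_on)
next
  case (Suc m)
  show ?thesis unfolding Suc
    by (rule Ck_on_SucI[OF S bounded_linear.has_derivative[OF f has_derivative_ident]]) (rule Ck_on_const)
qed

section \<open>The reciprocal transformation to the diagonal system\<close>

definition wave_matrix :: "real ^ 2 ^ 2" where
  "wave_matrix = vector [vector [1, 0], vector [0, -1]]"

lemma wave_matrix_mult: "(wave_matrix *v u) $ 1 = u $ 1" "(wave_matrix *v u) $ 2 = - u $ 2"
  by (simp_all add: wave_matrix_def matrix_vector_mult_def sum_2)

lemma vec2_eqI: "(u :: real ^ 2) $ 1 = v $ 1 \<Longrightarrow> u $ 2 = v $ 2 \<Longrightarrow> u = v"
  by (simp add: vec_eq_iff forall_2)

lemma smooth_on_pair: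
  fixes f g :: "real ^ 2 \<Rightarrow> real"
  assumes "open S" "\<And>k. Ck_on k S f" "\<And>k. Ck_on k S g"
  shows "smooth_on S (\<lambda>u. vector [f u, g u] :: real ^ 2)"
proof -
  have "(vector [a, b] :: real ^ 2) = a *\<^sub>R axis 1 1 + b *\<^sub>R axis 2 1" for a b
    by (rule vec2_eqI) (simp_all add: axis_def)
  then show ?thesis unfolding smooth_on_def
    using assms by (auto intro!: Ck_on_add Ck_on_scaleR_const)
qed

text \<open>For a given image v the equations x = v1 (1 - r y), y = v2 (1 + s x) are linear in x, y
  with determinant 1 + r s v1 v2; Cramer's rule is the inverse map. At v = \<open>\<phi> u\<close>
  this determinant is (1 - r y + s x) / ((1 - r y) (1 + s x)), which explains the third condition in
  \<open>N\<close>.\<close>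

lemma diffeo_between_fractional:
  fixes N0 :: "(real ^ 2) set" and r s :: real
  assumes N0: "open N0"
  defines "N \<equiv> {u \<in> N0. 1 - r * u $ 2 \<noteq> 0 \<and> 1 + s * u $ 1 \<noteq> 0 \<and> 1 - r * u $ 2 + s * u $ 1 \<noteq> 0}"
    and "\<phi> \<equiv> \<lambda>u. vector [u $ 1 * inverse (1 + - r * u $ 2), u $ 2 * inverse (1 + s * u $ 1)] :: real ^ 2"
  shows "\<exists>M. diffeo_between N M \<phi>"
proof -
  define O1 where "O1 = {v :: real ^ 2. 1 + r * s * (v $ 1 * v $ 2) \<noteq> 0}"
  define \<psi> where "\<psi> v = (vector [v $ 1 * (1 + - r * v $ 2) * inverse (1 + r * s * (v $ 1 * v $ 2)),
      v $ 2 * (1 + s * v $ 1) * inverse (1 + r * s * (v $ 1 * v $ 2))] :: real ^ 2)" for v :: "real ^ 2"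
  \<comment> \<open>Exactly the image of \<open>N\<close>, described as a preimage under the inverse
    map so that openness follows from continuity.\<close>
  define M where "M = {v \<in> O1. \<psi> v \<in> N}"
  have oN: "open N"
  proof -
    have "N = N0 \<inter> {u. 1 - r * u $ 2 \<noteq> 0} \<inter> {u. 1 + s * u $ 1 \<noteq> 0} \<inter> {u. 1 - r * u $ 2 + s * u $ 1 \<noteq> 0}"
      by (auto simp: N_def)
    then show ?thesis using N0 by (auto intro!: open_Int open_Collect_neq continuous_intros)
  qed
  have oO: "open O1" unfolding O1_def by (intro open_Collect_neq continuous_intros)
  have L: "Ck_on k S (\<lambda>u :: real ^ 2. u $ i)" if "open S" for k S i
    by (rule Ck_on_linear[OF that bounded_linear_vec_nth])
  have sphi: "smooth_on N \<phi>"
    unfolding \<phi>_def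
    by (intro smooth_on_pair oN Ck_on_mult Ck_on_inverse Ck_on_add Ck_on_const L) (auto simp: N_def)
  have spsi: "smooth_on S \<psi>" if "open S" "S \<subseteq> O1" for S
    unfolding \<psi>_def[abs_def]
    by (intro smooth_on_pair that(1) Ck_on_mult Ck_on_inverse Ck_on_add Ck_on_const L)
      (use that(2) in \<open>auto simp: O1_def\<close>)
  have cont: "continuous_on S f" if "smooth_on S f" for S and f :: "real ^ 2 \<Rightarrow> real ^ 2"
    using that Ck_on.simps(1) unfolding smooth_on_def by blast
  have oM: "open M"
    using continuous_open_preimage[OF cont[OF spsi[OF oO order_refl]] oO oN]
    by (simp add: M_def vimage_def Int_def)
  have 1: "1 + r * s * (\<phi> u $ 1 * \<phi> u $ 2) \<noteq> 0 \<and> \<psi> (\<phi> u) = u" if u: "u \<in> N" for u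
  proof -
    define x y P Q where "x = u $ 1" and "y = u $ 2" and "P = 1 - r * y" and "Q = 1 + s * x"
    have nz: "P \<noteq> 0" "Q \<noteq> 0" "P + s * x \<noteq> 0" using u by (auto simp: N_def x_def y_def P_def Q_def)
    have f: "\<phi> u $ 1 = x / P" "\<phi> u $ 2 = y / Q"
      by (simp_all add: \<phi>_def x_def y_def P_def Q_def divide_inverse)
    have e: "1 + r * s * ((x / P) * (y / Q)) = (P + s * x) / (P * Q)"
    proof -
      have "P * Q + r * s * (x * y) = P + s * x" by (simp add: P_def Q_def algebra_simps)
      then show ?thesis using nz by (simp add: field_simps)
    qed
    have c: "(z / P) * (t / Q) * inverse (t / (P * Q)) = z" if "t \<noteq> 0" for z t
      using nz(1,2) that by (simp add: field_simps)
    have "1 + - r * (y / Q) = (Q - r * y) / Q" using nz(2) by (simp add: diff_divide_distrib)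
    also have "Q - r * y = P + s * x" by (simp add: P_def Q_def)
    finally have a: "(x / P) * (1 + - r * (y / Q)) * inverse ((P + s * x) / (P * Q)) = x"
      using c[OF nz(3)] by simp
    have "1 + s * (x / P) = (P + s * x) / P" using nz(1) by (simp add: add_divide_distrib)
    then have b: "(y / Q) * (1 + s * (x / P)) * inverse ((P + s * x) / (P * Q)) = y"
      using c[OF nz(3), of y] by (simp add: mult.commute)
    have "\<psi> (\<phi> u) = u"
      by (rule vec2_eqI; simp only: \<psi>_def vector_2 f e a b; simp only: x_def y_def)
    moreover have "1 + r * s * (\<phi> u $ 1 * \<phi> u $ 2) \<noteq> 0" unfolding f e using nz by simp
    ultimately show ?thesis by simp
  qed
  have 2: "\<phi> (\<psi> v) = v" if v: "v \<in> M" for v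
  proof -
    define x y E where "x = v $ 1" and "y = v $ 2" and "E = 1 + r * s * (x * y)"
    have E: "E \<noteq> 0" using v by (simp add: M_def O1_def E_def x_def y_def)
    have f: "\<psi> v $ 1 = x * (1 - r * y) / E" "\<psi> v $ 2 = y * (1 + s * x) / E"
      by (simp_all add: \<psi>_def x_def y_def E_def divide_inverse)
    have p: "1 + - r * (y * (1 + s * x) / E) = (1 - r * y) / E" "1 + s * (x * (1 - r * y) / E) =
      (1 + s * x) / E"
      using E by (simp_all add: field_simps) (simp_all add: E_def algebra_simps)
    have "\<psi> v \<in> N" using v by (simp add: M_def)
    then have "1 + - r * (y * (1 + s * x) / E) \<noteq> 0" "1 + s * (x * (1 - r * y) / E) \<noteq> 0"
      unfolding N_def by (simp_all add: f)
    then have n: "1 - r * y \<noteq> 0" "1 + s * x \<noteq> 0" unfolding p by auto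
    show ?thesis
      by (rule vec2_eqI; simp only: \<phi>_def vector_2 f p; use n E in
        \<open>simp add: x_def[symmetric] y_def[symmetric]\<close>)
  qed
  have 3: "\<phi> u \<in> M" if "u \<in> N" for u using 1[OF that] that by (simp add: M_def O1_def)
  have "homeomorphism N M \<phi> \<psi>"
    unfolding homeomorphism_def
  proof (intro conjI ballI)
    show "\<psi> (\<phi> u) = u" if "u \<in> N" for u using 1[OF that] by simp
    show "\<phi> (\<psi> v) = v" if "v \<in> M" for v by (rule 2[OF that])
    show "\<phi> ` N = M"
    proof
      show "\<phi> ` N \<subseteq> M" using 3 by blast
      show "M \<subseteq> \<phi> ` N"
      proof
        fix v assume v: "v \<in> M"
        then have "\<psi> v \<in> N" by (simp add: M_def)
        then show "v \<in> \<phi> ` N" using 2[OF v] by (metis imageI)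
      qed
    qed
    show "\<psi> ` M = N"
    proof
      show "\<psi> ` M \<subseteq> N" by (auto simp: M_def)
      show "N \<subseteq> \<psi> ` M"
      proof
        fix u assume u: "u \<in> N"
        then show "u \<in> \<psi> ` M" using 1[OF u] 3[OF u] by (metis imageI)
      qed
    qed
    show "continuous_on N \<phi>" by (rule cont[OF sphi])
    show "continuous_on M \<psi>" by (rule cont[OF spsi[OF oM]]) (auto simp: M_def)
  qed
  moreover have "smooth_on M \<psi>" by (rule spsi[OF oM]) (auto simp: M_def)
  ultimately show ?thesis using oN oM sphi unfolding diffeo_between_def by blast
qed

text \<open>The hypotheses say that each line of the congruence meets the two lines y1 = 0, y3 +
  \<open>\<mu>\<close> y4 = r y2 and y2 = 0, y3 + \<open>\<nu>\<close> y4 = -s y1. The lines of the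
  diagonal system meet y1 = 0, y3 + y4 = 0 and y2 = 0, y3 - y4 = 0. A projective map taking one pair
  to the other is the required transformation.\<close>

lemma reciprocal_normal_form:
  fixes W :: "real ^ 2 \<Rightarrow> real ^ 2"
  assumes N0: "open N0" "0 \<in> N0" and m: "\<mu> \<noteq> \<nu>"
    and R: "\<And>w. w \<in> N0 \<Longrightarrow> W w $ 1 + r * (w $ 1 * W w $ 2 - w $ 2 * W w $ 1) = \<mu> * w $ 1"
     "\<And>w. w \<in> N0 \<Longrightarrow> W w $ 2 + s * (w $ 1 * W w $ 2 - w $ 2 * W w $ 1) = \<nu> * w $ 2"
  shows "reciprocal_related W 0 (\<lambda>u. wave_matrix *v u) 0"
proof -
  define N where "N = {u \<in> N0. 1 - r * u $ 2 \<noteq> 0 \<and> 1 + s * u $ 1 \<noteq> 0 \<and> 1 - r * u $ 2 + s * u $ 1 \<noteq> 0}"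
  define \<phi> where "\<phi> = (\<lambda>u :: real ^ 2. vector [u $ 1 * inverse (1 + - r * u $ 2), u $ 2 * inverse
    (1 + s * u $ 1)] :: real ^ 2)"
  obtain M where M: "diffeo_between N M \<phi>"
    using diffeo_between_fractional[OF N0(1), of r s] unfolding N_def \<phi>_def by blast
  \<comment> \<open>The new y3 and y4 are half the sum and half the difference of y3 +
    \<open>\<mu>\<close> y4 - r y2 and y3 + \<open>\<nu>\<close> y4 + s y1. Their coefficients are
    these vectors and the constants 1, (\<open>\<mu>\<close> + \<open>\<nu>\<close>) / 2, 0,
    (\<open>\<mu>\<close> - \<open>\<nu>\<close>) / 2.\<close>
  define \<alpha> \<beta> :: "real ^ 2" where "\<alpha> = vector [s / 2, - r / 2]" and "\<beta> = vector [- s / 2, - r / 2]"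
  have ip: "\<alpha> \<bullet> u = s / 2 * u $ 1 - r / 2 * u $ 2" "\<beta> \<bullet> u = - s / 2 * u $ 1 - r / 2 * u $ 2" for u
    by (simp_all add: \<alpha>_def \<beta>_def inner_vec_def sum_2)
  have main: "(\<alpha> \<bullet> u + 1) * (\<beta> \<bullet> W u + (\<mu> - \<nu>) / 2) - (\<alpha> \<bullet> W u + (\<mu> + \<nu>) / 2) * (\<beta> \<bullet> u + 0) \<noteq> 0 \<and>
          u = (\<alpha> \<bullet> u + 1) *\<^sub>R \<phi> u + (\<beta> \<bullet> u + 0) *\<^sub>R (wave_matrix *v \<phi> u) \<and>
          W u = (\<alpha> \<bullet> W u + (\<mu> + \<nu>) / 2) *\<^sub>R \<phi> u + (\<beta> \<bullet> W u + (\<mu> - \<nu>) / 2) *\<^sub>R (wave_matrix *v \<phi> u)"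
    if u: "u \<in> N" for u
  proof -
    let ?X = "(\<alpha> \<bullet> u + 1) *\<^sub>R \<phi> u + (\<beta> \<bullet> u + 0) *\<^sub>R (wave_matrix *v \<phi> u)"
      and ?Y = "(\<alpha> \<bullet> W u + (\<mu> + \<nu>) / 2) *\<^sub>R \<phi> u + (\<beta> \<bullet> W u + (\<mu> - \<nu>) / 2) *\<^sub>R (wave_matrix *v \<phi> u)"
    define x y X Y P Q where d: "x = u $ 1" "y = u $ 2" "X = W u $ 1" "Y = W u $ 2" "P = 1 - r * y" "Q = 1
      + s * x"
    have nz: "P \<noteq> 0" "Q \<noteq> 0" "P + s * x \<noteq> 0" using u by (auto simp: N_def d)
    have r1: "X * P = x * (\<mu> - r * Y)" and r2: "Y * Q = y * (\<nu> + s * X)"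
      using R[of u] u unfolding N_def d by (auto simp: algebra_simps)
    have f: "\<phi> u $ 1 = x / P" "\<phi> u $ 2 = y / Q"
      by (simp_all add: \<phi>_def d divide_inverse)
    \<comment> \<open>The first factor is twice the determinant of the transformation of (dx, dt),
      so distinct \<open>\<mu>\<close>, \<open>\<nu>\<close> make it nonzero.\<close>
    have "(Q * (\<mu> - r * Y) - P * (\<nu> + s * X)) * (P + s * x) = (\<mu> - \<nu>) * P * Q"
    proof -
      have "X * P = x * \<mu> - x * r * Y" "Y * Q = y * \<nu> + y * s * X" using r1 r2 by (simp_all add: algebra_simps)
      then show ?thesis unfolding d(5,6) by algebra
    qed
    then have "Q * (\<mu> - r * Y) - P * (\<nu> + s * X) \<noteq> 0" using nz m by auto
    moreover have "(s / 2 * x - r / 2 * y + 1) * (- s / 2 * X - r / 2 * Y + (\<mu> - \<nu>) / 2)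
        - (s / 2 * X - r / 2 * Y + (\<mu> + \<nu>) / 2) * (- s / 2 * x - r / 2 * y + 0) =
          (Q * (\<mu> - r * Y) - P * (\<nu> + s * X)) / 2"
      unfolding d(5,6) by (simp add: field_simps)
    ultimately have A: "(\<alpha> \<bullet> u + 1) * (\<beta> \<bullet> W u + (\<mu> - \<nu>) / 2) - (\<alpha> \<bullet> W u + (\<mu> + \<nu>) / 2) * (\<beta> \<bullet> u + 0) \<noteq> 0"
      unfolding ip d(1-4)[symmetric] by simp
    have u1: "u $ 1 = (P) * (x / P)" "u $ 2 = Q * (y / Q)" using nz by (simp_all add: d)
    have w1: "X = (\<mu> - r * Y) * (x / P)" "Y = (\<nu> + s * X) * (y / Q)"
      using r1 r2 nz by (simp_all add: nonzero_eq_divide_eq mult.commute)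
    have B: "u = ?X"
    proof (rule vec2_eqI)
      show "u $ 1 = ?X $ 1"
      proof -
        have "?X $ 1 = P * (x / P)"
        proof -
          have "(s / 2 * x - r / 2 * y + 1) + (- s / 2 * x - r / 2 * y + 0) = P" by (simp add: d(5))
          then show ?thesis
            unfolding vector_add_component vector_scaleR_component wave_matrix_mult f ip d(1,2)[symmetric]
              real_scaleR_def
            by (simp only: distrib_right[symmetric])
        qed
        then show ?thesis using u1 by simp
      qed
      show "u $ 2 = ?X $ 2"
      proof -
        have "?X $ 2 = Q * (y / Q)"
        proof -
          have "(s / 2 * x - r / 2 * y + 1) - (- s / 2 * x - r / 2 * y + 0) = Q" by (simp add: d(6))
          then show ?thesis
            unfolding vector_add_component vector_scaleR_component wave_matrix_mult f ip d(1,2)[symmetric]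
              real_scaleR_def
            by (simp only: mult_minus_right add_uminus_conv_diff left_diff_distrib[symmetric])
        qed
        then show ?thesis using u1 by simp
      qed
    qed
    have C: "W u = ?Y"
    proof (rule vec2_eqI)
      show "W u $ 1 = ?Y $ 1"
      proof -
        have "?Y $ 1 = (\<mu> - r * Y) * (x / P)"
        proof -
          have "(s / 2 * X - r / 2 * Y + (\<mu> + \<nu>) / 2) + (- s / 2 * X - r / 2 * Y + (\<mu> - \<nu>) / 2) = \<mu> - r * Y"
            by (simp add: field_simps)
          then show ?thesis
            unfolding vector_add_component vector_scaleR_component wave_matrix_mult f ip d(3,4)[symmetric]
              real_scaleR_def
            by (simp only: distrib_right[symmetric])
        qed
        then show ?thesis unfolding d(3)[symmetric] by (simp only: w1(1)[symmetric])
      qed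
      show "W u $ 2 = ?Y $ 2"
      proof -
        have "?Y $ 2 = (\<nu> + s * X) * (y / Q)"
        proof -
          have "(s / 2 * X - r / 2 * Y + (\<mu> + \<nu>) / 2) - (- s / 2 * X - r / 2 * Y + (\<mu> - \<nu>) / 2) = \<nu> + s * X"
            by (simp add: field_simps)
          then show ?thesis
            unfolding vector_add_component vector_scaleR_component wave_matrix_mult f ip d(3,4)[symmetric]
              real_scaleR_def
            by (simp only: mult_minus_right add_uminus_conv_diff left_diff_distrib[symmetric])
        qed
        then show ?thesis unfolding d(4)[symmetric] by (simp only: w1(2)[symmetric])
      qed
    qed
    show ?thesis using A B C by blast
  qed
  have N: "0 \<in> N" using N0(2) by (simp add: N_def)
  have z: "\<phi> 0 = 0" by (rule vec2_eqI) (simp_all add: \<phi>_def)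
  have nz: "1 * ((\<mu> - \<nu>) / 2) - (\<mu> + \<nu>) / 2 * 0 \<noteq> 0" using m by simp
  show ?thesis
    unfolding reciprocal_related_def
    by (rule exI[of _ \<alpha>], rule exI[of _ \<beta>], rule exI[of _ 1], rule exI[of _ "(\<mu> + \<nu>) / 2"], rule exI[of _ 0],
        rule exI[of _ "(\<mu> - \<nu>) / 2"], rule exI[of _ N], rule exI[of _ M], rule exI[of _ \<phi>],
        intro conjI nz M N z) (rule ballI, erule main)
qed

section \<open>Diagonalisation of the Jacobian and the two special complexes\<close>

lemma eigenvectors_independent:
  fixes a b c d \<mu> \<nu> m11 m12 m21 m22 :: real
  assumes v: "m11 * a + m12 * c = \<mu> * a" "m21 * a + m22 * c = \<mu> * c" and w: "m11 * b + m12 * d = \<nu> * b"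
    "m21 * b + m22 * d = \<nu> * d"
    and ne: "\<mu> \<noteq> \<nu>" "a \<noteq> 0 \<or> c \<noteq> 0" "b \<noteq> 0 \<or> d \<noteq> 0"
  shows "a * d - b * c \<noteq> 0"
proof
  assume 0: "a * d - b * c = 0"
  have "(\<mu> - \<nu>) * (a * b) = (\<mu> * a) * b - (\<nu> * b) * a" by algebra
  also have "\<dots> = - m12 * (a * d - b * c)" unfolding v[symmetric] w[symmetric] by algebra
  finally have 1: "a * b = 0" using 0 ne by simp
  have "(\<mu> - \<nu>) * (c * d) = (\<mu> * c) * d - (\<nu> * d) * c" by algebra
  also have "\<dots> = m21 * (a * d - b * c)" unfolding v[symmetric] w[symmetric] by algebra
  finally have 2: "c * d = 0" using 0 ne by simp
  have "(\<mu> - \<nu>) * (a * d) = (\<mu> * a) * d - (\<nu> * b) * c - \<nu> * (a * d - b * c)" by algebra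
  also have "\<dots> = (m11 - \<nu>) * (a * d - b * c)" unfolding v[symmetric] w[symmetric] by algebra
  finally have "(\<mu> - \<nu>) * (a * d) = 0" unfolding 0 by simp
  then have 3: "a * d = 0" using ne by simp
  have "b * c = a * d - (a * d - b * c)" by simp
  then have "b * c = 0" unfolding 0 unfolding 3 by simp
  with 1 2 3 ne show False by auto
qed

text \<open>The row (d, -b) annihilates the eigenvector (b, d) of \<open>\<nu>\<close>. Multiplied
  by M - \<open>\<mu>\<close> it therefore vanishes on both eigenvectors, which span the
  plane.\<close>

lemma left_eigenvector:
  fixes a b c d \<mu> \<nu> m11 m12 m21 m22 :: real
  assumes v: "m11 * a + m12 * c = \<mu> * a" "m21 * a + m22 * c = \<mu> * c" and w: "m11 * b + m12 * d = \<nu> * b"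
    "m21 * b + m22 * d = \<nu> * d"
    and ne: "a * d - b * c \<noteq> 0"
  shows "d * m11 - b * m21 = \<mu> * d" "d * m12 - b * m22 = - \<mu> * b"
proof -
  define X where "X = d * m11 - b * m21 - \<mu> * d"
  define Y where "Y = d * m12 - b * m22 + \<mu> * b"
  have "X * a + Y * c = d * (m11 * a + m12 * c) - b * (m21 * a + m22 * c) - \<mu> * (d * a - b * c)"
    unfolding X_def Y_def by algebra
  also have "\<dots> = 0" unfolding v by algebra
  finally have 1: "X * a + Y * c = 0" .
  have "X * b + Y * d = d * (m11 * b + m12 * d) - b * (m21 * b + m22 * d)"
    unfolding X_def Y_def by algebra
  also have "\<dots> = 0" unfolding w by algebra
  finally have 2: "X * b + Y * d = 0" .
  have "X * (a * d - b * c) = (X * a + Y * c) * d - (X * b + Y * d) * c" by algebra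
  then have "X = 0" unfolding 1 2 using ne by simp
  have "Y * (a * d - b * c) = (X * b + Y * d) * a - (X * a + Y * c) * b" by algebra
  then have "Y = 0" unfolding 1 2 using ne by simp
  from \<open>X = 0\<close> \<open>Y = 0\<close> show "d * m11 - b * m21 = \<mu> * d" "d * m12 - b * m22 = - \<mu> * b"
    unfolding X_def Y_def by simp_all
qed

text \<open>The term with factor \<open>t\<close> is of second order at \<open>p\<close>, so the
  coefficients of the complex are a row of the Jacobian.\<close>

lemma congruence_jacobian:
  fixes V :: "real ^ 2 \<Rightarrow> real ^ 2"
  assumes V: "V differentiable (at p)" and e: "0 < e"
    and C: "in_line_complex V p e i t m n"
  shows "matrix (frechet_derivative V (at p)) $ i $ 1 = m" "matrix (frechet_derivative V (at p)) $ i $ 2 = n"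
proof -
  note R = C[unfolded in_line_complex_def, THEN spec, THEN spec, THEN mp, THEN mp]
  have ev: "eventually (\<lambda>s. \<bar>s\<bar> < e) (nhds (0::real))"
  proof -
    have "open {s :: real. \<bar>s\<bar> < e}" by (intro open_Collect_less continuous_intros)
    then show ?thesis using e unfolding eventually_nhds by (intro exI[of _ "{s. \<bar>s\<bar> < e}"]) simp
  qed
  have ax: "(vector [s, 0] :: real ^ 2) = s *\<^sub>R axis 1 1" "(vector [0, s] :: real ^ 2)
    = s *\<^sub>R axis 2 1" for s :: real
    by (simp_all add: vec_eq_iff forall_2 axis_def)
  have D: "((\<lambda>s. V (p + s *\<^sub>R axis l 1) $ j) has_real_derivative dir_deriv V l p $ j) (at 0)" for l j
    by (rule DERIV_dir1[OF V])
  have D0: "((\<lambda>s. V (p + s *\<^sub>R axis l 1) $ j - V p $ j) has_real_derivative dir_deriv V l p $ j) (at 0)" for l j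
    using DERIV_diff[OF D DERIV_const] by simp
  have DP: "((\<lambda>s. (V (p + s *\<^sub>R axis l 1) $ i - V p $ i) + q * (s * (V (p + s *\<^sub>R axis l 1) $ j - V p $ j)))
      has_real_derivative dir_deriv V l p $ i) (at 0)" for l j q
    using DERIV_add[OF D0[of l i] DERIV_cmult[OF DERIV_mult[OF DERIV_ident D0[of l j]], of q]] by simp
  have "\<forall>\<^sub>F s in nhds 0. (V (p + s *\<^sub>R axis 1 1) $ i - V p $ i) + t *
    (s * (V (p + s *\<^sub>R axis 1 1) $ 2 - V p $ 2)) = m * s"
    using ev
  proof eventually_elim
    case (elim s)
    show ?case using R[OF elim, of 0] e by (simp add: ax)
  qed
  from DERIV_unique[OF DP iffD2[OF DERIV_cong_ev[OF HOL.refl this HOL.refl] DERIV_cmult[OF DERIV_ident]]]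
  have 1: "dir_deriv V 1 p $ i = m" by simp
  have "\<forall>\<^sub>F s in nhds 0. (V (p + s *\<^sub>R axis 2 1) $ i - V p $ i) + (- t) *
    (s * (V (p + s *\<^sub>R axis 2 1) $ 1 - V p $ 1)) = n * s"
    using ev
  proof eventually_elim
    case (elim s)
    show ?case using R[OF _ elim, of 0] e by (simp add: ax)
  qed
  from DERIV_unique[OF DP iffD2[OF DERIV_cong_ev[OF HOL.refl this HOL.refl] DERIV_cmult[OF DERIV_ident]]]
  have 2: "dir_deriv V 2 p $ i = n" by simp
  show "matrix (frechet_derivative V (at p)) $ i $ 1 = m" "matrix (frechet_derivative V (at p)) $ i $ 2 = n"
    using 1 2 by (simp_all add: matrix_def dir_deriv_def)
qed

text \<open>Left eigenvectors of the Jacobian select the two combinations of the complexes whose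
  linear part is a multiple of a single coordinate; these are the complexes of lines meeting a fixed
  line. An affine change of variables makes those coordinates the new densities.\<close>

lemma locally_equivalent_wave:
  fixes V :: "real ^ 2 \<Rightarrow> real ^ 2"
  assumes V: "V differentiable (at p)" and e: "0 < e"
    and L1: "in_line_complex V p e 1 t1 m11 m12" and L2: "in_line_complex V p e 2 t2 m21 m22"
    and hyp: "card {l::real. \<exists>v. v \<noteq> 0 \<and> matrix (frechet_derivative V (at p)) *v v = l *\<^sub>R v} = 2"
  shows "locally_equivalent V p (\<lambda>u. wave_matrix *v u) 0"
proof -
  let ?M = "matrix (frechet_derivative V (at p))"
  have M: "?M $ 1 $ 1 = m11" "?M $ 1 $ 2 = m12" "?M $ 2 $ 1 = m21" "?M $ 2 $ 2 = m22"
    using congruence_jacobian[OF V e L1] congruence_jacobian[OF V e L2] by simp_all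
  obtain \<mu> \<nu> where mn: "{l::real. \<exists>v. v \<noteq> 0 \<and> ?M *v v = l *\<^sub>R v} = {\<mu>, \<nu>}" "\<mu> \<noteq> \<nu>"
    using hyp unfolding card_2_iff by blast
  have "\<mu> \<in> {l::real. \<exists>v. v \<noteq> 0 \<and> ?M *v v = l *\<^sub>R v}" "\<nu> \<in> {l::real. \<exists>v. v \<noteq> 0 \<and> ?M *v v = l *\<^sub>R v}"
    unfolding mn(1) by simp_all
  then obtain v w where v: "v \<noteq> 0" "?M *v v = \<mu> *\<^sub>R v" and w: "w \<noteq> 0" "?M *v w = \<nu> *\<^sub>R w" by blast
  define a b c d where "a = v $ 1" and "b = w $ 1" and "c = v $ 2" and "d = w $ 2"
  have comp: "(?M *v z) $ 1 = m11 * z $ 1 + m12 * z $ 2" "(?M *v z) $ 2 = m21 * z $ 1 + m22 * z $ 2" for z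
    by (simp_all add: matrix_vector_mult_def sum_2 M)
  have ev: "m11 * a + m12 * c = \<mu> * a" "m21 * a + m22 * c = \<mu> * c"
    using comp[of v] unfolding v(2) a_def c_def by simp_all
  have ew: "m11 * b + m12 * d = \<nu> * b" "m21 * b + m22 * d = \<nu> * d"
    using comp[of w] unfolding w(2) b_def d_def by simp_all
  have "a \<noteq> 0 \<or> c \<noteq> 0" "b \<noteq> 0 \<or> d \<noteq> 0"
    using v(1) w(1) unfolding a_def b_def c_def d_def by (simp_all add: vec_eq_iff forall_2)
  note nz = eigenvectors_independent[OF ev ew mn(2) this]
  define \<delta> where "\<delta> = a * d - b * c"
  have \<delta>: "\<delta> \<noteq> 0" using nz by (simp add: \<delta>_def)
  have nz': "d * a - c * b \<noteq> 0" using nz by (simp add: mult.commute)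
  note l1 = left_eigenvector[OF ev ew nz]
  \<comment> \<open>The same lemma with both the two indices and the two eigenvectors
    exchanged.\<close>
  have l2: "a * m21 - c * m11 = - \<nu> * c" "a * m22 - c * m12 = \<nu> * a"
    using left_eigenvector[of m22 d m21 b \<nu> m12 m11 c a \<mu>] ev ew nz' by (simp_all add: add.commute)
  \<comment> \<open>Up to the factor \<open>\<delta>\<close> the inverse of the matrix of
    eigenvectors, so its rows are left eigenvectors.\<close>
  define B :: "real ^ 2 ^ 2" where "B = vector [vector [d, - b], vector [- c, a]]"
  define Bi :: "real ^ 2 ^ 2" where "Bi = vector [vector [a / \<delta>, b / \<delta>], vector [c / \<delta>, d / \<delta>]]"
  have B: "(B *v z) $ 1 = d * z $ 1 - b * z $ 2" "(B *v z) $ 2 = a * z $ 2 - c * z $ 1" for z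
    by (simp_all add: B_def matrix_vector_mult_def sum_2)
  have Bi: "(Bi *v z) $ 1 = (a * z $ 1 + b * z $ 2) / \<delta>" "(Bi *v z) $ 2 = (c * z $ 1 + d * z $ 2) / \<delta>" for z
    by (simp_all add: Bi_def matrix_vector_mult_def sum_2 add_divide_distrib)
  have BiB: "Bi *v (B *v z) = z" for z
  proof (rule vec2_eqI)
    have "a * (d * z $ 1 - b * z $ 2) + b * (a * z $ 2 - c * z $ 1) = z $ 1 * \<delta>"
      unfolding \<delta>_def by (simp add: algebra_simps)
    then show "(Bi *v (B *v z)) $ 1 = z $ 1" unfolding Bi B using \<delta> by simp
    have "c * (d * z $ 1 - b * z $ 2) + d * (a * z $ 2 - c * z $ 1) = z $ 2 * \<delta>"
      unfolding \<delta>_def by (simp add: algebra_simps)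
    then show "(Bi *v (B *v z)) $ 2 = z $ 2" unfolding Bi B using \<delta> by simp
  qed
  have BBi: "d * (Bi *v z) $ 1 - b * (Bi *v z) $ 2 = z $ 1" "a * (Bi *v z) $ 2 - c * (Bi *v z) $ 1
    = z $ 2" for z
  proof -
    have "d * (a * z $ 1 + b * z $ 2) - b * (c * z $ 1 + d * z $ 2) = z $ 1 * \<delta>"
      "a * (c * z $ 1 + d * z $ 2) - c * (a * z $ 1 + b * z $ 2) = z $ 2 * \<delta>"
      unfolding \<delta>_def by (simp_all add: algebra_simps)
    then have "(d * (a * z $ 1 + b * z $ 2) - b * (c * z $ 1 + d * z $ 2)) / \<delta> = z $ 1"
      "(a * (c * z $ 1 + d * z $ 2) - c * (a * z $ 1 + b * z $ 2)) / \<delta> = z $ 2"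
      using \<delta> by simp_all
    then show "d * (Bi *v z) $ 1 - b * (Bi *v z) $ 2 = z $ 1" "a * (Bi *v z) $ 2 - c * (Bi *v z) $ 1 = z $ 2"
      unfolding Bi by (simp_all add: diff_divide_distrib)
  qed
  define W where "W = (\<lambda>z. B *v V (Bi *v z + p) - B *v V p)"
  have aff: "affinely_related V p W 0"
    unfolding affinely_related_def
  proof (intro exI conjI ballI)
    have "det B = \<delta>" by (simp add: det_2 B_def \<delta>_def)
    then show "invertible B" using \<delta> invertible_det_nz by blast
    show "open (UNIV :: (real ^ 2) set)" "p \<in> UNIV" by simp_all
    show "0 = B *v p + - (B *v p)" by simp
    fix u
    have "Bi *v (B *v u + - (B *v p)) = u - p"
      using BiB[of "u - p"] by (simp add: matrix_vector_mult_diff_distrib)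
    then show "W (B *v u + - (B *v p)) = B *v V u + - (B *v V p)" by (simp add: W_def)
  qed
  define N0 where "N0 = {z. \<bar>(Bi *v z) $ 1\<bar> < e \<and> \<bar>(Bi *v z) $ 2\<bar> < e}"
  have oN: "open N0"
  proof -
    have "open {z. \<bar>(a * z $ 1 + b * z $ 2) / \<delta>\<bar> < e}" "open {z. \<bar>(c * z $ 1 + d * z $ 2) / \<delta>\<bar> < e}"
      by (intro open_Collect_less continuous_intros; simp add: \<delta>)+
    from open_Int[OF this] show ?thesis unfolding N0_def Bi by (simp add: Collect_conj_eq)
  qed
  \<comment> \<open>The rows of \<open>B\<close> combine the coefficients t1, t2; the division by
    \<open>\<delta>\<close> = det B arises since x Y2 - y Y1 is a determinant and is multiplied by
    det B under the change of variables.\<close>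
  define r where "r = (d * t1 - b * t2) / \<delta>"
  define s where "s = (a * t2 - c * t1) / \<delta>"
  have rs: "r * \<delta> = d * t1 - b * t2" "s * \<delta> = a * t2 - c * t1" using \<delta> by (simp_all add: r_def s_def)
  have W: "W z $ 1 + r * (z $ 1 * W z $ 2 - z $ 2 * W z $ 1) = \<mu> * z $ 1 \<and>
      W z $ 2 + s * (z $ 1 * W z $ 2 - z $ 2 * W z $ 1) = \<nu> * z $ 2" if z: "z \<in> N0" for z
  proof -
    define x y where "x = (Bi *v z) $ 1" and "y = (Bi *v z) $ 2"
    have xy: "\<bar>x\<bar> < e" "\<bar>y\<bar> < e" using z by (simp_all add: N0_def x_def y_def)
    have pt: "Bi *v z + p = p + vector [x, y]" by (rule vec2_eqI) (simp_all add: x_def y_def)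
    define Y1 where "Y1 = V (p + vector [x, y]) $ 1 - V p $ 1"
    define Y2 where "Y2 = V (p + vector [x, y]) $ 2 - V p $ 2"
    have Wz: "W z $ 1 = d * Y1 - b * Y2" "W z $ 2 = a * Y2 - c * Y1"
      unfolding W_def pt vector_minus_component B Y1_def Y2_def by (simp_all add: algebra_simps)
    have zz: "z $ 1 = d * x - b * y" "z $ 2 = a * y - c * x" using BBi[of z] by (simp_all add: x_def y_def)
    have k: "z $ 1 * W z $ 2 - z $ 2 * W z $ 1 = \<delta> * (x * Y2 - y * Y1)"
      unfolding Wz zz \<delta>_def by algebra
    have R1': "Y1 + t1 * (x * Y2 - y * Y1) = m11 * x + m12 * y" and R2': "Y2 + t2 * (x * Y2 - y * Y1)
      = m21 * x + m22 * y"
      using L1 L2 xy by (simp_all add: in_line_complex_def Y1_def Y2_def)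
    have "W z $ 1 + r * (z $ 1 * W z $ 2 - z $ 2 * W z $ 1) = d * Y1 - b * Y2 + (r * \<delta>) * (x * Y2 - y * Y1)"
      unfolding k unfolding Wz by algebra
    also have "\<dots> = d * (Y1 + t1 * (x * Y2 - y * Y1)) - b * (Y2 + t2 * (x * Y2 - y * Y1))"
      unfolding rs by algebra
    also have "\<dots> = (d * m11 - b * m21) * x + (d * m12 - b * m22) * y" unfolding R1' R2' by algebra
    also have "\<dots> = \<mu> * z $ 1" unfolding l1 zz by algebra
    finally have 1: "W z $ 1 + r * (z $ 1 * W z $ 2 - z $ 2 * W z $ 1) = \<mu> * z $ 1" .
    have "W z $ 2 + s * (z $ 1 * W z $ 2 - z $ 2 * W z $ 1) = a * Y2 - c * Y1 + (s * \<delta>) * (x * Y2 - y * Y1)"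
      unfolding k unfolding Wz by algebra
    also have "\<dots> = a * (Y2 + t2 * (x * Y2 - y * Y1)) - c * (Y1 + t1 * (x * Y2 - y * Y1))"
      unfolding rs by algebra
    also have "\<dots> = (a * m21 - c * m11) * x + (a * m22 - c * m12) * y" unfolding R1' R2' by algebra
    also have "\<dots> = \<nu> * z $ 2" unfolding l2 zz by algebra
    finally show ?thesis using 1 by simp
  qed
  have "0 \<in> N0" using e by (simp add: N0_def Bi)
  then have "reciprocal_related W 0 (\<lambda>u. wave_matrix *v u) 0"
    using oN mn(2) W by (intro reciprocal_normal_form[of N0 \<mu> \<nu> W r s]) simp_all
  with locally_equivalent.affine[OF locally_equivalent.refl aff] show ?thesis
    by (rule locally_equivalent.reciprocal)
qed

section \<open>The Hamiltonian form of the diagonal system\<close>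

lemma total_deriv_coord: "total_deriv (\<lambda>p. a * snd p k $ i) p = a * snd p (Suc k) $ i"
proof -
  have d: "jet_deriv d (\<lambda>p. a * snd p k $ i) p = (if d = Some (k, i) then a else 0)" for d
    by (rule jet_deriv_eqI) (auto simp: jet_coord_move intro!: derivative_eq_intros)
  have "total_deriv (\<lambda>p. a * snd p k $ i) p = (\<Sum>j\<in>{k}. \<Sum>l\<in>UNIV. snd p (Suc j) $ l *
    (if j = k \<and> l = i then a else 0))"
    unfolding total_deriv_jet_deriv d
    by (subst suminf_finite[where N = "{k}"]) auto
  then show ?thesis by (simp add: if_distrib mult.commute cong: if_cong)
qed

text \<open>The density is quadratic in the potentials with diagonal signs \<open>\<sigma>\<close>,
  so its variational derivative is -\<open>\<sigma>\<^sub>j\<close> \<open>b\<^sup>j\<close>. One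
  total derivative gives -\<open>\<sigma>\<^sub>i\<close> \<open>u\<^sup>i\<close>, and the minus
  sign in \<open>hamiltonian_with\<close> restores the flux.\<close>

lemma wave_matrix_hamiltonian:
  "hamiltonian_with UNIV (\<lambda>_. mat 1) (\<lambda>_. 0) (\<lambda>u. wave_matrix *v u) UNIV
    (\<lambda>p. - (1 / 2) * (snd p 0 \<bullet> (wave_matrix *v snd p 0)))"
proof -
  define h where "h p = - (1 / 2) * (snd p 0 \<bullet> (wave_matrix *v snd p 0))" for p :: "2 jet"
  define \<sigma> :: "2 \<Rightarrow> real" where "\<sigma> i = (if i = 1 then 1 else - 1)" for i
  have a: "(wave_matrix *v u) $ i = \<sigma> i * u $ i" for u i
    using exhaust_2[of i] by (auto simp: wave_matrix_mult \<sigma>_def)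
  have h: "h = (\<lambda>p. (- (1 / 2)) * (snd p 0 $ 1 * snd p 0 $ 1) + (1 / 2) * (snd p 0 $ 2 * snd p 0 $ 2))"
    by (rule ext) (simp add: h_def inner_vec_def sum_2 wave_matrix_mult algebra_simps)
  have "jet_smooth UNIV 1 h"
    unfolding h by (intro jet_smooth_add jet_smooth_mult jet_smooth_const jet_smooth_coord open_UNIV) simp_all
  then have df: "differential_function UNIV h" by (rule jet_smooth_differential_function)
  have d0: "jet_deriv (Some (k, j)) h = (\<lambda>p. if k = 0 then - \<sigma> j * snd p 0 $ j else 0)" for k j
  proof
    fix p
    show "jet_deriv (Some (k, j)) h p = (if k = 0 then - \<sigma> j * snd p 0 $ j else 0)"
      unfolding h using exhaust_2[of j]
      by (intro jet_deriv_eqI) (auto simp: jet_coord_move \<sigma>_def intro!: derivative_eq_intros)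
  qed
  have eu: "euler j h = (\<lambda>p. (- \<sigma> j) * snd p 0 $ j)" for j
  proof
    fix p
    have "euler j h p = (\<Sum>k\<in>{0}. (-1) ^ k * (total_deriv ^^ k) (jet_deriv (Some (k, j)) h) p)"
      unfolding euler_def jet_du_eq by (rule suminf_finite) (auto simp: d0)
    then show "euler j h p = (- \<sigma> j) * snd p 0 $ j" by (simp add: d0)
  qed
  have io: "inner_op 1 (\<lambda>_. mat 1) (\<lambda>_. 0) (\<lambda>j. euler j h) i = (\<lambda>p. (- \<sigma> i) * snd p 1 $ i)" for i
    unfolding inner_op_def eu total_deriv_coord
    by (rule ext) (simp add: mat_def if_distrib if_distribR cong: if_cong)
  have sur: "(\<lambda>p :: 2 jet. snd p 1) ` UNIV = UNIV"
  proof -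
    have "u \<in> (\<lambda>p :: 2 jet. snd p 1) ` UNIV" for u
      by (rule image_eqI[where x = "(0, \<lambda>_. u)"]) simp_all
    then show ?thesis by blast
  qed
  have "hamiltonian_with UNIV (\<lambda>_. mat 1) (\<lambda>_. 0) (\<lambda>u. wave_matrix *v u) UNIV h"
    unfolding hamiltonian_with_def io a total_deriv_coord using sur df by simp
  then show ?thesis unfolding h_def[abs_def] .
qed

theorem theorem5:
  fixes U :: "(real ^ 2) set"
    and V :: "real ^ 2 \<Rightarrow> real ^ 2"
    and g :: "real ^ 2 \<Rightarrow> real ^ 2 ^ 2"
    and c :: "real ^ 2 \<Rightarrow> real ^ 2 ^ 2 ^ 2"
  assumes "open U"
    and "smooth_on U V" and "smooth_on U g" and "smooth_on U c"
    and "nondegenerate_metric U g"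
    and "hamiltonian_operator U g c"
    and "strictly_hyperbolic_on U V"
    and "hamiltonian_system U g c V"
  shows "\<exists>a \<eta> :: real ^ 2 ^ 2.
           transpose \<eta> = \<eta> \<and> det \<eta> \<noteq> 0 \<and>
           transpose (matrix_inv \<eta> ** a) = matrix_inv \<eta> ** a \<and>
           hamiltonian_with UNIV (\<lambda>_. \<eta>) (\<lambda>_. 0) (\<lambda>u. a *v u)
             UNIV (\<lambda>p. - (1 / 2) * (snd p 0 \<bullet> ((matrix_inv \<eta> ** a) *v snd p 0))) \<and>
           (\<forall>p\<in>U. \<exists>q. locally_equivalent V p (\<lambda>u. a *v u) q)"
proof -
  have eq: "locally_equivalent V p (\<lambda>u. wave_matrix *v u) 0" if p: "p \<in> U" for p
  proof -
    obtain e t1 t2 m11 m12 m21 m22 where lc: "0 < e"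
      "in_line_complex V p e 1 t1 m11 m12" "in_line_complex V p e 2 t2 m21 m22"
      using hamiltonian_linear_congruence[OF assms(1-6,8) p] by blast
    have hyp: "card {l::real. \<exists>v. v \<noteq> 0 \<and> matrix (frechet_derivative V (at p)) *v v = l *\<^sub>R v} = 2"
      using assms(7) p by (simp add: strictly_hyperbolic_on_def)
    show ?thesis
      using smooth_on_differentiable[OF assms(2) p] lc hyp by (rule locally_equivalent_wave)
  qed
  have i: "matrix_inv (mat 1) ** wave_matrix = wave_matrix"
    by (simp add: matrix_inv_def)
  have t: "transpose wave_matrix = wave_matrix"
    by (simp add: vec_eq_iff forall_2 transpose_def wave_matrix_def)
  \<comment> \<open>With the unit matrix as \<open>\<eta>\<close> the Hamiltonian condition is the
    symmetry of the diagonal matrix. One linear system serves all points of \<open>U\<close>, each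
    being sent to the origin.\<close>
  show ?thesis
    by (rule exI[of _ wave_matrix], rule exI[of _ "mat 1"])
      (use eq i t wave_matrix_hamiltonian in \<open>auto simp: transpose_mat\<close>)
qed

end
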